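(* Let $(N,g)$ be a (not necessarily compact) connected Riemannian manifold. The space $TN$ is complete in the Sasaki metric associated with $(N,g)$ if and only if $(N,g)$ is complete.
   Context: The Sasaki metric on $TN$ associated with $(N,g)$ is the Riemannian metric for which the horizontal distribution of the Levi-Civita connection of $g$ and the vertical distribution are orthogonal and for which the horizontal lift $X\mapsto X^h$ and the vertical lift $X\mapsto X^v$ from $T_xN$ to $T_{(x,v)}TN$ are isometries onto their images: $\langle X^h,Y^h\rangle=\langle X^v,Y^v\rangle=g(X,Y)$ and $\langle X^h,Y^v\rangle=0$. *)

theory Defs
  imports "HOL-Analysis.Analysis"
begin

section \<open>Smooth maps between Euclidean spaces\<close>

text \<open>Intended for open \<open>S\<close>: \<open>Ck_on k S f\<close> says that \<open>f\<close> is of class \<open>C\<^sup>k\<close> on \<open>S\<close>.\<close>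

primrec Ck_on :: "nat \<Rightarrow> 'e::euclidean_space set \<Rightarrow> ('e \<Rightarrow> 'f::real_normed_vector) \<Rightarrow> bool" where
  "Ck_on 0 S f \<longleftrightarrow> continuous_on S f"
| "Ck_on (Suc k) S f \<longleftrightarrow>
     (\<forall>x\<in>S. f differentiable (at x)) \<and>
     (\<forall>v. Ck_on k S (\<lambda>x. frechet_derivative f (at x) v))"

definition smooth_on :: "'e::euclidean_space set \<Rightarrow> ('e \<Rightarrow> 'f::real_normed_vector) \<Rightarrow> bool" where
  "smooth_on S f \<longleftrightarrow> (\<forall>k. Ck_on k S f)"


section \<open>Smooth manifolds\<close>

text \<open>
  A chart is a pair of its domain and its coordinate map (whose values outside of the domain are
  irrelevant).  A manifold is given by an atlas; its points are those covered by the charts, and its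
  topology is the one induced by the atlas, i.e. the unique one for which all the charts are
  homeomorphisms from open sets onto open subsets of the model space.
\<close>

type_synonym ('a, 'e) chart = "'a set \<times> ('a \<Rightarrow> 'e)"

definition chart_inv :: "('a, 'e) chart \<Rightarrow> 'e \<Rightarrow> 'a" where
  "chart_inv c = inv_into (fst c) (snd c)"

definition points :: "('a, 'e) chart set \<Rightarrow> 'a set" where
  "points M = (\<Union>c\<in>M. fst c)"

definition charts_at :: "('a, 'e) chart set \<Rightarrow> 'a \<Rightarrow> ('a, 'e) chart set" where
  "charts_at M p = {c \<in> M. p \<in> fst c}"

definition some_chart :: "('a, 'e) chart set \<Rightarrow> 'a \<Rightarrow> ('a, 'e) chart" where
  "some_chart M p = (SOME c. c \<in> charts_at M p)"

definition manifold_topology :: "('a, 'e::euclidean_space) chart set \<Rightarrow> 'a topology" where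
  "manifold_topology M =
     topology (\<lambda>W. W \<subseteq> points M \<and> (\<forall>c\<in>M. open (snd c ` (W \<inter> fst c))))"

definition smooth_atlas :: "('a, 'e::euclidean_space) chart set \<Rightarrow> bool" where
  "smooth_atlas M \<longleftrightarrow>
     (\<forall>c\<in>M. inj_on (snd c) (fst c)) \<and>
     (\<forall>c\<in>M. \<forall>d\<in>M. open (snd c ` (fst c \<inter> fst d)) \<and>
        smooth_on (snd c ` (fst c \<inter> fst d)) (snd d \<circ> chart_inv c))"

definition smooth_manifold :: "('a, 'e::euclidean_space) chart set \<Rightarrow> bool" where
  "smooth_manifold M \<longleftrightarrow>
     smooth_atlas M \<and> Hausdorff_space (manifold_topology M) \<and> second_countable (manifold_topology M)"


section \<open>Tangent vectors\<close>

text \<open>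
  A tangent vector at \<open>p\<close> is the family of its components in all the charts around \<open>p\<close>, any two of
  which are related by the derivative of the change of coordinates.  The value at any other chart is
  fixed to be \<open>0\<close>, so that equality of tangent vectors is equality of functions.
\<close>

type_synonym ('a, 'e) tangent = "('a, 'e) chart \<Rightarrow> 'e"

definition tangent_space ::
    "('a, 'e::euclidean_space) chart set \<Rightarrow> 'a \<Rightarrow> ('a, 'e) tangent set" where
  "tangent_space M p =
     {v. (\<forall>c. c \<notin> charts_at M p \<longrightarrow> v c = 0) \<and>
         (\<forall>c\<in>charts_at M p. \<forall>d\<in>charts_at M p.
            v d = frechet_derivative (snd d \<circ> chart_inv c) (at (snd c p)) (v c))}"

definition tzero :: "('a, 'e::euclidean_space) tangent" where
  "tzero = (\<lambda>c. 0)"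

definition tadd ::
    "('a, 'e::euclidean_space) tangent \<Rightarrow> ('a, 'e) tangent \<Rightarrow> ('a, 'e) tangent" where
  "tadd u v = (\<lambda>c. u c + v c)"

definition tscale :: "real \<Rightarrow> ('a, 'e::euclidean_space) tangent \<Rightarrow> ('a, 'e) tangent" where
  "tscale a v = (\<lambda>c. a *\<^sub>R v c)"

text \<open>\<open>coord_vec M c u p\<close> is the tangent vector at \<open>p\<close> with component \<open>u\<close> in the chart \<open>c\<close>.\<close>

definition coord_vec ::
    "('a, 'e::euclidean_space) chart set \<Rightarrow> ('a, 'e) chart \<Rightarrow> 'e \<Rightarrow> 'a \<Rightarrow> ('a, 'e) tangent" where
  "coord_vec M c u p =
     (\<lambda>d. if d \<in> charts_at M p
          then frechet_derivative (snd d \<circ> chart_inv c) (at (snd c p)) u else 0)"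

text \<open>\<open>dir_deriv M p X f\<close> is the derivative \<open>X f\<close> of the function \<open>f\<close> along \<open>X \<in> T\<^sub>p M\<close>.\<close>

definition dir_deriv ::
    "('a, 'e::euclidean_space) chart set \<Rightarrow> 'a \<Rightarrow> ('a, 'e) tangent \<Rightarrow> ('a \<Rightarrow> real) \<Rightarrow> real" where
  "dir_deriv M p X f =
     (let c = some_chart M p in frechet_derivative (f \<circ> chart_inv c) (at (snd c p)) (X c))"

definition differential ::
    "('a, 'e::euclidean_space) chart set \<Rightarrow> ('b, 'f::euclidean_space) chart set \<Rightarrow>
     ('a \<Rightarrow> 'b) \<Rightarrow> 'a \<Rightarrow> ('a, 'e) tangent \<Rightarrow> ('b, 'f) tangent" where
  "differential M M' F p X =
     (let c = some_chart M p in
      (\<lambda>d. if d \<in> charts_at M' (F p)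
           then frechet_derivative (snd d \<circ> F \<circ> chart_inv c) (at (snd c p)) (X c) else 0))"

text \<open>The velocity at time \<open>t\<close> of a curve defined on \<open>I\<close>, one-sided at the end points of \<open>I\<close>.\<close>

definition velocity ::
    "('a, 'e::euclidean_space) chart set \<Rightarrow> real set \<Rightarrow> (real \<Rightarrow> 'a) \<Rightarrow> real \<Rightarrow> ('a, 'e) tangent" where
  "velocity M I \<gamma> t =
     (\<lambda>c. if c \<in> charts_at M (\<gamma> t) then vector_derivative (snd c \<circ> \<gamma>) (at t within I) else 0)"


section \<open>Vector fields and affine connections\<close>

text \<open>
  Functions and vector fields on an open subset \<open>W\<close> are represented by total functions whose values
  outside of \<open>W\<close> are irrelevant.
\<close>

definition smooth_function ::
    "('a, 'e::euclidean_space) chart set \<Rightarrow> 'a set \<Rightarrow> ('a \<Rightarrow> real) \<Rightarrow> bool" where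
  "smooth_function M W f \<longleftrightarrow>
     openin (manifold_topology M) W \<and> (\<forall>c\<in>M. smooth_on (snd c ` (W \<inter> fst c)) (f \<circ> chart_inv c))"

definition smooth_field ::
    "('a, 'e::euclidean_space) chart set \<Rightarrow> 'a set \<Rightarrow> ('a \<Rightarrow> ('a, 'e) tangent) \<Rightarrow> bool" where
  "smooth_field M W Y \<longleftrightarrow>
     openin (manifold_topology M) W \<and> (\<forall>p\<in>W. Y p \<in> tangent_space M p) \<and>
     (\<forall>c\<in>M. smooth_on (snd c ` (W \<inter> fst c)) (\<lambda>x. Y (chart_inv c x) c))"

definition lie_bracket ::
    "('a, 'e::euclidean_space) chart set \<Rightarrow> ('a \<Rightarrow> ('a, 'e) tangent) \<Rightarrow> ('a \<Rightarrow> ('a, 'e) tangent) \<Rightarrow>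
     'a \<Rightarrow> ('a, 'e) tangent" where
  "lie_bracket M X Y p =
     (\<lambda>c. if c \<in> charts_at M p
          then frechet_derivative (\<lambda>x. Y (chart_inv c x) c) (at (snd c p)) (X p c)
             - frechet_derivative (\<lambda>x. X (chart_inv c x) c) (at (snd c p)) (Y p c)
          else 0)"

text \<open>
  \<open>D p X Y\<close> is the covariant derivative at \<open>p\<close> along \<open>X \<in> T\<^sub>p M\<close> of a vector field \<open>Y\<close> that is
  smooth on a neighbourhood of \<open>p\<close>.
\<close>

type_synonym ('a, 'e) connection =
  "'a \<Rightarrow> ('a, 'e) tangent \<Rightarrow> ('a \<Rightarrow> ('a, 'e) tangent) \<Rightarrow> ('a, 'e) tangent"

definition affine_connection ::
    "('a, 'e::euclidean_space) chart set \<Rightarrow> ('a, 'e) connection \<Rightarrow> bool" where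
  "affine_connection M D \<longleftrightarrow>
     (\<forall>W Y. smooth_field M W Y \<longrightarrow>
        (\<forall>p\<in>W. \<forall>X\<in>tangent_space M p.
           D p X Y \<in> tangent_space M p \<and>
           (\<forall>X'\<in>tangent_space M p. D p (tadd X X') Y = tadd (D p X Y) (D p X' Y)) \<and>
           (\<forall>a. D p (tscale a X) Y = tscale a (D p X Y)) \<and>
           (\<forall>Y'. smooth_field M W Y' \<longrightarrow>
              D p X (\<lambda>q. tadd (Y q) (Y' q)) = tadd (D p X Y) (D p X Y')) \<and>
           (\<forall>f. smooth_function M W f \<longrightarrow>
              D p X (\<lambda>q. tscale (f q) (Y q)) =
                tadd (tscale (dir_deriv M p X f) (Y p)) (tscale (f p) (D p X Y)))) \<and>
        (\<forall>X. smooth_field M W X \<longrightarrow> smooth_field M W (\<lambda>p. D p (X p) Y)))"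

definition torsion_free ::
    "('a, 'e::euclidean_space) chart set \<Rightarrow> ('a, 'e) connection \<Rightarrow> bool" where
  "torsion_free M D \<longleftrightarrow>
     (\<forall>W X Y. smooth_field M W X \<longrightarrow> smooth_field M W Y \<longrightarrow>
        (\<forall>p\<in>W. D p (X p) Y = tadd (D p (Y p) X) (lie_bracket M X Y p)))"


section \<open>Riemannian metrics\<close>

type_synonym ('a, 'e) metric_tensor = "'a \<Rightarrow> ('a, 'e) tangent \<Rightarrow> ('a, 'e) tangent \<Rightarrow> real"

definition riemannian_metric ::
    "('a, 'e::euclidean_space) chart set \<Rightarrow> ('a, 'e) metric_tensor \<Rightarrow> bool" where
  "riemannian_metric M g \<longleftrightarrow>
     (\<forall>p\<in>points M. \<forall>u\<in>tangent_space M p. \<forall>v\<in>tangent_space M p.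
        g p u v = g p v u \<and>
        (\<forall>w\<in>tangent_space M p. g p (tadd u v) w = g p u w + g p v w) \<and>
        (\<forall>a. g p (tscale a u) v = a * g p u v) \<and>
        (u \<noteq> tzero \<longrightarrow> 0 < g p u u)) \<and>
     (\<forall>c\<in>M. \<forall>u w. smooth_on (snd c ` fst c)
        (\<lambda>x. g (chart_inv c x) (coord_vec M c u (chart_inv c x)) (coord_vec M c w (chart_inv c x))))"

definition riemannian_manifold ::
    "('a, 'e::euclidean_space) chart set \<Rightarrow> ('a, 'e) metric_tensor \<Rightarrow> bool" where
  "riemannian_manifold M g \<longleftrightarrow> smooth_manifold M \<and> riemannian_metric M g"

definition metric_compatible ::
    "('a, 'e::euclidean_space) chart set \<Rightarrow> ('a, 'e) metric_tensor \<Rightarrow> ('a, 'e) connection \<Rightarrow> bool" where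
  "metric_compatible M g D \<longleftrightarrow>
     (\<forall>W Y Z. smooth_field M W Y \<longrightarrow> smooth_field M W Z \<longrightarrow>
        (\<forall>p\<in>W. \<forall>X\<in>tangent_space M p.
           dir_deriv M p X (\<lambda>q. g q (Y q) (Z q)) = g p (D p X Y) (Z p) + g p (Y p) (D p X Z)))"

definition levi_civita ::
    "('a, 'e::euclidean_space) chart set \<Rightarrow> ('a, 'e) metric_tensor \<Rightarrow> ('a, 'e) connection \<Rightarrow> bool" where
  "levi_civita M g D \<longleftrightarrow>
     affine_connection M D \<and> torsion_free M D \<and> metric_compatible M g D"


section \<open>Riemannian distance and completeness\<close>

definition C1_curve ::
    "('a, 'e::euclidean_space) chart set \<Rightarrow> real set \<Rightarrow> (real \<Rightarrow> 'a) \<Rightarrow> bool" where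
  "C1_curve M I \<gamma> \<longleftrightarrow>
     continuous_map (top_of_set I) (manifold_topology M) \<gamma> \<and>
     (\<forall>c\<in>M. (\<forall>t\<in>{t \<in> I. \<gamma> t \<in> fst c}. (snd c \<circ> \<gamma>) differentiable (at t within I)) \<and>
        continuous_on {t \<in> I. \<gamma> t \<in> fst c} (\<lambda>t. vector_derivative (snd c \<circ> \<gamma>) (at t within I)))"

definition piecewise_C1_curve ::
    "('a, 'e::euclidean_space) chart set \<Rightarrow> (real \<Rightarrow> 'a) \<Rightarrow> bool" where
  "piecewise_C1_curve M \<gamma> \<longleftrightarrow>
     continuous_map (top_of_set {0..1}) (manifold_topology M) \<gamma> \<and>
     (\<exists>S. finite S \<and>
        (\<forall>a b. 0 \<le> a \<longrightarrow> a < b \<longrightarrow> b \<le> 1 \<longrightarrow> {a<..<b} \<inter> S = {} \<longrightarrow> C1_curve M {a..b} \<gamma>))"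

definition curve_length ::
    "('a, 'e::euclidean_space) chart set \<Rightarrow> ('a, 'e) metric_tensor \<Rightarrow> (real \<Rightarrow> 'a) \<Rightarrow> real" where
  "curve_length M g \<gamma> =
     integral {0..1} (\<lambda>t. sqrt (g (\<gamma> t) (velocity M {0..1} \<gamma> t) (velocity M {0..1} \<gamma> t)))"

definition curves_between ::
    "('a, 'e::euclidean_space) chart set \<Rightarrow> 'a \<Rightarrow> 'a \<Rightarrow> (real \<Rightarrow> 'a) set" where
  "curves_between M p q = {\<gamma>. piecewise_C1_curve M \<gamma> \<and> \<gamma> 0 = p \<and> \<gamma> 1 = q}"

text \<open>
  Only meant for connected manifolds, where any two points are joined by a curve; the value for
  points that are not joined by a curve is arbitrary.
\<close>

definition riemannian_dist ::
    "('a, 'e::euclidean_space) chart set \<Rightarrow> ('a, 'e) metric_tensor \<Rightarrow> 'a \<Rightarrow> 'a \<Rightarrow> real" where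
  "riemannian_dist M g p q =
     (if curves_between M p q = {} then 0 else Inf (curve_length M g ` curves_between M p q))"

definition riemannian_complete ::
    "('a, 'e::euclidean_space) chart set \<Rightarrow> ('a, 'e) metric_tensor \<Rightarrow> bool" where
  "riemannian_complete M g \<longleftrightarrow> Metric_space.mcomplete (points M) (riemannian_dist M g)"


section \<open>The tangent bundle and the Sasaki metric\<close>

definition bundle_chart ::
    "('a, 'e::euclidean_space) chart set \<Rightarrow> ('a, 'e) chart \<Rightarrow>
     ('a \<times> ('a, 'e) tangent, 'e \<times> 'e) chart" where
  "bundle_chart M c =
     ({(p, v). p \<in> fst c \<and> v \<in> tangent_space M p}, (\<lambda>(p, v). (snd c p, v c)))"

definition tangent_bundle ::
    "('a, 'e::euclidean_space) chart set \<Rightarrow> ('a \<times> ('a, 'e) tangent, 'e \<times> 'e) chart set" where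
  "tangent_bundle M = bundle_chart M ` M"

definition vertical_lift ::
    "('a, 'e::euclidean_space) chart set \<Rightarrow> 'a \<times> ('a, 'e) tangent \<Rightarrow> ('a, 'e) tangent \<Rightarrow>
     ('a \<times> ('a, 'e) tangent, 'e \<times> 'e) tangent" where
  "vertical_lift M z X =
     velocity (tangent_bundle M) UNIV (\<lambda>t. (fst z, tadd (snd z) (tscale t X))) 0"

text \<open>
  The horizontal space at \<open>(p, v)\<close> consists of the images \<open>dY(X)\<close> of the tangent vectors
  \<open>X \<in> T\<^sub>p M\<close> under local vector fields \<open>Y\<close>, viewed as maps into the tangent bundle, with
  \<open>Y(p) = v\<close> and \<open>D\<^sub>X Y = 0\<close>.
\<close>

definition horizontal_space ::
    "('a, 'e::euclidean_space) chart set \<Rightarrow> ('a, 'e) connection \<Rightarrow> 'a \<times> ('a, 'e) tangent \<Rightarrow>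
     ('a \<times> ('a, 'e) tangent, 'e \<times> 'e) tangent set" where
  "horizontal_space M D z =
     {differential M (tangent_bundle M) (\<lambda>q. (q, Y q)) (fst z) X | X Y W.
        X \<in> tangent_space M (fst z) \<and> smooth_field M W Y \<and> fst z \<in> W \<and> Y (fst z) = snd z \<and>
        D (fst z) X Y = tzero}"

definition horizontal_lift ::
    "('a, 'e::euclidean_space) chart set \<Rightarrow> ('a, 'e) connection \<Rightarrow> 'a \<times> ('a, 'e) tangent \<Rightarrow>
     ('a, 'e) tangent \<Rightarrow> ('a \<times> ('a, 'e) tangent, 'e \<times> 'e) tangent" where
  "horizontal_lift M D z X =
     (THE \<xi>. \<xi> \<in> horizontal_space M D z \<and> differential (tangent_bundle M) M fst z \<xi> = X)"

text \<open>
  The Levi-Civita connection is unique on locally defined smooth fields, which is all that enters the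
  horizontal lift; and horizontal and vertical lifts together span each tangent space of the tangent
  bundle, so at most one metric (on tangent vectors) satisfies this predicate.
\<close>

definition sasaki_metric ::
    "('a, 'e::euclidean_space) chart set \<Rightarrow> ('a, 'e) metric_tensor \<Rightarrow>
     ('a \<times> ('a, 'e) tangent, 'e \<times> 'e) metric_tensor \<Rightarrow> bool" where
  "sasaki_metric M g G \<longleftrightarrow>
     riemannian_metric (tangent_bundle M) G \<and>
     (\<exists>D. levi_civita M g D \<and>
       (\<forall>z\<in>points (tangent_bundle M).
          \<forall>X\<in>tangent_space M (fst z). \<forall>Y\<in>tangent_space M (fst z).
            G z (horizontal_lift M D z X) (horizontal_lift M D z Y) = g (fst z) X Y \<and>
            G z (vertical_lift M z X) (vertical_lift M z Y) = g (fst z) X Y \<and>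
            G z (horizontal_lift M D z X) (vertical_lift M z Y) = 0))"

end

theory Submission
  imports Defs
begin

text \<open>
Three facts about the Sasaki metric relate lengths of curves in \<open>TN\<close> to geometry of \<open>N\<close>.
They all come from the splitting \<open>sasaki_decomposition\<close>: the squared length of a tangent vector of
\<open>TN\<close> is the squared length of its projection to \<open>N\<close> plus the squared length of its vertical part,
which for a velocity vector of a curve of tangent vectors is the covariant derivative along the curve.

 \<^item> The projection \<open>TN \<rightarrow> N\<close> shortens curves, since the vertical term is dropped
   (\<open>projection_length_le\<close>).
 \<^item> The zero section preserves lengths, since the zero field is parallel (\<open>zero_section_length\<close>).
 \<^item> The function \<open>sqrt (1 + \<bar>v\<bar>\<^sup>2)\<close> is 1-Lipschitz on \<open>TN\<close>, since by metric compatibility its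
   derivative along a curve is bounded by the length of the covariant derivative of \<open>v\<close>
   (\<open>fibre_height_Lipschitz\<close>).

If \<open>TN\<close> is complete and \<open>p\<^sub>n\<close> is a Cauchy sequence in \<open>N\<close>, then the zero vectors at \<open>p\<^sub>n\<close> form a
Cauchy sequence in \<open>TN\<close>, and the base point of their limit is the limit of \<open>p\<^sub>n\<close>
(\<open>complete_base\<close>).  If \<open>N\<close> is complete and \<open>(p\<^sub>n, v\<^sub>n)\<close> is a Cauchy sequence in \<open>TN\<close>, then \<open>p\<^sub>n\<close>
converges to some \<open>p\<close> and the norms of \<open>v\<^sub>n\<close> are bounded, so that in a bundle chart around \<open>p\<close> the
sequence eventually stays in a compact set; it has a convergent subsequence and hence converges
(\<open>complete_total\<close>).

To make this precise, the Riemannian distance has to be compared with the Euclidean distance in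
charts.  This is done once for a class of manifolds that contains both \<open>N\<close> and \<open>TN\<close>: those with
\<open>C\<^sup>1\<close> transition maps, a Hausdorff topology and a continuous metric.  The local comparison
\<open>dist_chart_comparison\<close> shows that the distance is a metric and that a sequence in a chart converges
as soon as its coordinates do.  The other ingredient is the coordinate formula
\<open>D\<^sub>X Y = dY(X) + \<Gamma>(X, Y)\<close> for the connection (\<open>coord_field_derivative\<close>), which yields the
horizontal lift in a bundle chart (\<open>horizontal_lift_eq\<close>).
\<close>

text \<open>
  Charts are pairs; splitting the quantifiers over charts into quantifiers over the components would
  destroy the shape of the facts about charts.
\<close>

declare split_paired_All [simp del] split_paired_Ex [simp del]

section \<open>Calculus of \<open>C\<^sup>k\<close> maps\<close>

text \<open>
Openness matters: only then does the derivative at a point of \<open>S\<close> depend on the values on \<open>S\<close> alone.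
\<close>

lemma Ck_on_cong:
  assumes "open S" "\<And>x. x \<in> S \<Longrightarrow> f x = g x"
  shows "Ck_on k S f \<longleftrightarrow> Ck_on k S g"
  using assms(2)
proof (induction k arbitrary: f g)
  case 0
  then show ?case by (simp cong: continuous_on_cong)
next
  case (Suc k)
  have diff: "f differentiable at x \<longleftrightarrow> g differentiable at x" if "x \<in> S" for x
    using that Suc.prems \<open>open S\<close> unfolding differentiable_def
    by (metis has_derivative_transform_within_open)
  have eq: "frechet_derivative f (at x) v = frechet_derivative g (at x) v"
    if "x \<in> S" "\<forall>x\<in>S. f differentiable at x" for x v
    using frechet_derivative_transform_within_open[of f x S g] that Suc.prems \<open>open S\<close> by auto
  have "Ck_on k S (\<lambda>x. frechet_derivative f (at x) v) \<longleftrightarrow> Ck_on k S (\<lambda>x. frechet_derivative g (at x) v)"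
    if "\<forall>x\<in>S. f differentiable at x" for v
    by (rule Suc.IH) (use eq that in blast)
  with diff show ?case
    by (simp only: Ck_on.simps(2)) blast
qed

lemma Ck_on_subset: "Ck_on k S f \<Longrightarrow> T \<subseteq> S \<Longrightarrow> Ck_on k T f"
  by (induction k arbitrary: f) (auto intro: continuous_on_subset)

lemma Ck_on_SucD: "Ck_on (Suc k) S f \<Longrightarrow> Ck_on k S f"
proof (induction k arbitrary: f)
  case 0
  then show ?case
    by (simp add: continuous_at_imp_continuous_on differentiable_imp_continuous_within)
next
  case (Suc k)
  show ?case
    using Suc.prems Suc.IH[of "\<lambda>x. frechet_derivative f (at x) v" for v] by (subst Ck_on.simps(2)) (simp only: Ck_on.simps(2)[of "Suc k"], blast)
qed

text \<open>
The recursive definition speaks of \<open>frechet_derivative\<close>; this form accepts any candidate for the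
derivative.
\<close>

lemma Ck_on_SucI:
  assumes "open S" "\<And>x. x \<in> S \<Longrightarrow> (f has_derivative f' x) (at x)"
    and "\<And>v. Ck_on k S (\<lambda>x. f' x v)"
  shows "Ck_on (Suc k) S f"
proof -
  have "frechet_derivative f (at x) = f' x" if "x \<in> S" for x
    using frechet_derivative_at[OF assms(2)[OF that]] by simp
  then have "Ck_on k S (\<lambda>x. frechet_derivative f (at x) v)" for v
    using assms(3)[of v]
      Ck_on_cong[OF assms(1), of "\<lambda>x. frechet_derivative f (at x) v" "\<lambda>x. f' x v" k] by simp
  then show ?thesis
    using assms(2) by (auto simp: differentiable_def)
qed

lemma Ck_on_has_derivative:
  "Ck_on (Suc k) S f \<Longrightarrow> x \<in> S \<Longrightarrow> (f has_derivative frechet_derivative f (at x)) (at x)"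
  by (simp add: frechet_derivative_works[symmetric])

lemma Ck_on_const: "Ck_on k S (\<lambda>x. c)"
  by (induction k arbitrary: c) auto

lemma Ck_on_bounded_linear:
  assumes "open S" "bounded_linear L" "Ck_on k S f"
  shows "Ck_on k S (\<lambda>x. L (f x))"
  using assms(3)
proof (induction k arbitrary: f)
  case 0
  then show ?case
    by (simp add: bounded_linear.continuous_on[OF assms(2)])
next
  case (Suc k)
  show ?case
    by (rule Ck_on_SucI[OF assms(1) bounded_linear.has_derivative[OF assms(2)
          Ck_on_has_derivative[OF Suc.prems]]]) (use Suc in auto)
qed

lemma Ck_on_add:
  assumes "open S" "Ck_on k S f" "Ck_on k S g"
  shows "Ck_on k S (\<lambda>x. f x + g x)"
  using assms(2,3)
proof (induction k arbitrary: f g)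
  case 0
  then show ?case by (auto intro: continuous_intros)
next
  case (Suc k)
  show ?case
    by (rule Ck_on_SucI[OF assms(1) has_derivative_add[OF Ck_on_has_derivative[OF Suc.prems(1)]
          Ck_on_has_derivative[OF Suc.prems(2)]]]) (use Suc in auto)
qed

lemma Ck_on_sum:
  assumes "open S" "\<And>i. i \<in> I \<Longrightarrow> Ck_on k S (f i)"
  shows "Ck_on k S (\<lambda>x. \<Sum>i\<in>I. f i x)"
  using assms(2)
proof (induction I rule: infinite_finite_induct)
  case (insert i I)
  have "Ck_on k S (\<lambda>x. f i x + (\<Sum>i\<in>I. f i x))"
    by (intro Ck_on_add[OF assms(1)] insert.IH insert.prems) auto
  with insert.hyps show ?case by simp
qed (simp_all add: Ck_on_const)

lemma Ck_on_bounded_bilinear: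
  assumes "open S" "bounded_bilinear B" "Ck_on k S f" "Ck_on k S g"
  shows "Ck_on k S (\<lambda>x. B (f x) (g x))"
  using assms(3,4)
proof (induction k arbitrary: f g)
  case 0
  then show ?case
    by (simp add: bounded_bilinear.continuous_on[OF assms(2)])
next
  case (Suc k)
  show ?case
  proof (rule Ck_on_SucI[OF assms(1) bounded_bilinear.FDERIV[OF assms(2)
          Ck_on_has_derivative[OF Suc.prems(1)] Ck_on_has_derivative[OF Suc.prems(2)]]])
    show "Ck_on k S (\<lambda>x. B (f x) (frechet_derivative g (at x) v) + B (frechet_derivative f (at x) v) (g x))" for v
      using Suc.prems by (intro Ck_on_add[OF assms(1)] Suc.IH Ck_on_SucD[OF Suc.prems(1)]
          Ck_on_SucD[OF Suc.prems(2)]) simp_all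
  qed
qed

lemma Ck_on_bounded_linear_fun:
  assumes "open S" "bounded_linear L" 
  shows "Ck_on k S L"
proof (cases k)
  case 0
  then show ?thesis using assms by (simp add: linear_continuous_on)
next
  case (Suc n)
  show ?thesis unfolding Suc
    by (rule Ck_on_SucI[where f' = "\<lambda>x. L"])
      (simp_all add: assms bounded_linear_imp_has_derivative Ck_on_const)
qed

lemma linear_expand:
  fixes L :: "'a::euclidean_space \<Rightarrow> 'b::real_vector"
  assumes "linear L"
  shows "L v = (\<Sum>b\<in>Basis. (v \<bullet> b) *\<^sub>R L b)"
proof -
  have "L v = L (\<Sum>b\<in>Basis. (v \<bullet> b) *\<^sub>R b)" by (simp add: euclidean_representation)
  then show ?thesis by (simp add: linear_sum[OF assms] linear_scale[OF assms])
qed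

text \<open>
The derivative of \<open>f \<circ> g\<close> in a fixed direction is the derivative of \<open>f\<close> in the varying direction
\<open>g'(x) v\<close>.  Expanding that direction in the basis leaves sums of products of coefficients of class
\<open>C\<^sup>k\<close> with composites to which the induction hypothesis applies.
\<close>

lemma Ck_on_compose:
  fixes f :: "'b::euclidean_space \<Rightarrow> 'c::real_normed_vector" and g :: "'a::euclidean_space \<Rightarrow> 'b"
  assumes "open S" "open T" "Ck_on k T f" "Ck_on k S g" "g ` S \<subseteq> T"
  shows "Ck_on k S (f \<circ> g)"
  using assms(3,4)
proof (induction k arbitrary: f)
  case 0
  then show ?case
    using assms(5) by (auto simp: o_def intro: continuous_on_compose2)
next
  case (Suc k)
  have T: "g x \<in> T" if "x \<in> S" for x using that assms(5) by auto
  note dg = Ck_on_has_derivative[OF Suc.prems(2)]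
  note df = Ck_on_has_derivative[OF Suc.prems(1) T]
  show ?case
  proof (rule Ck_on_SucI[OF assms(1)])
    show "(f \<circ> g has_derivative (\<lambda>v. \<Sum>b\<in>Basis. (frechet_derivative g (at x) v \<bullet> b) *\<^sub>R
        ((\<lambda>y. frechet_derivative f (at y) b) \<circ> g) x)) (at x)" if "x \<in> S" for x
    proof -
      have "(\<lambda>v. \<Sum>b\<in>Basis. (frechet_derivative g (at x) v \<bullet> b) *\<^sub>R
        ((\<lambda>y. frechet_derivative f (at y) b) \<circ> g) x) 
        = frechet_derivative f (at (g x)) \<circ> frechet_derivative g (at x)"
        unfolding o_def by (rule ext) (rule linear_expand[OF has_derivative_linear[OF df[OF that]], symmetric])
      then show ?thesis using diff_chain_at[OF dg[OF that] df[OF that]] by simp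
    qed
    show "Ck_on k S (\<lambda>x. \<Sum>b\<in>Basis. (frechet_derivative g (at x) v \<bullet> b) *\<^sub>R
        ((\<lambda>y. frechet_derivative f (at y) b) \<circ> g) x)" for v
    proof (intro Ck_on_sum assms(1) Ck_on_bounded_bilinear[OF assms(1) bounded_bilinear_scaleR]
          Ck_on_bounded_linear[OF assms(1) bounded_linear_inner_left])
      show "Ck_on k S (\<lambda>x. frechet_derivative g (at x) v)"
        using Suc.prems(2) by simp
      show "Ck_on k S (\<lambda>x. ((\<lambda>y. frechet_derivative f (at y) b) \<circ> g) x)" for b
        using Suc.IH[of "\<lambda>y. frechet_derivative f (at y) b"] Suc.prems(1) Ck_on_SucD[OF Suc.prems(2)] by simp
    qed
  qed
qed

text \<open>
The definition of \<open>Ck_on\<close> only covers constant directions; a varying one is expanded in the basis.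
\<close>

lemma Ck_on_derivative_apply:
  fixes f :: "'a::euclidean_space \<Rightarrow> 'b::real_normed_vector"
  assumes "open S" "Ck_on (Suc k) S f" "Ck_on k S F"
  shows "Ck_on k S (\<lambda>x. frechet_derivative f (at x) (F x))"
proof -
  have "Ck_on k S (\<lambda>x. \<Sum>b\<in>Basis. (F x \<bullet> b) *\<^sub>R frechet_derivative f (at x) b)"
    using assms(2,3) by (intro Ck_on_sum assms(1) Ck_on_bounded_bilinear[OF assms(1) bounded_bilinear_scaleR]
          Ck_on_bounded_linear[OF assms(1) bounded_linear_inner_left]) simp_all
  moreover have "frechet_derivative f (at x) (F x) = (\<Sum>b\<in>Basis. (F x \<bullet> b) *\<^sub>R frechet_derivative f (at x) b)" 
    if "x \<in> S" for x
    by (rule linear_expand[OF has_derivative_linear[OF Ck_on_has_derivative[OF assms(2) that]]])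
  ultimately show ?thesis
    by (subst Ck_on_cong[OF assms(1)])
qed

lemma Ck_on_Pair:
  assumes "open S" "Ck_on k S f" "Ck_on k S g"
  shows "Ck_on k S (\<lambda>x. (f x, g x))"
proof -
  have "Ck_on k S (\<lambda>x. (\<lambda>a. (a, 0)) (f x) + (\<lambda>b. (0, b)) (g x))"
    by (intro Ck_on_add assms(1) Ck_on_bounded_linear[OF assms(1) _ assms(2)]
        Ck_on_bounded_linear[OF assms(1) _ assms(3)] bounded_linear_Pair
        bounded_linear_ident bounded_linear_zero)
  then show ?thesis by simp
qed

section \<open>A mean value inequality\<close>

text \<open>
All length estimates below are instances: \<open>f\<close> is a function along a curve and \<open>\<phi>\<close> bounds its
derivative by the speed of the curve.  The finite set \<open>S\<close> takes the corners of the curve; with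
\<open>f = 0\<close> the lemma says that a function which is nonnegative outside of \<open>S\<close> has a nonnegative
integral.
\<close>

lemma increment_le_integral:
  fixes f :: "real \<Rightarrow> 'b::banach"
  assumes S: "finite S" and ab: "a \<le> b" and f: "continuous_on {a..b} f"
    and \<phi>: "\<phi> integrable_on {a..b}"
    and deriv: "\<And>t. t \<in> {a<..<b} - S \<Longrightarrow> \<exists>f'. (f has_vector_derivative f') (at t) \<and> norm f' \<le> \<phi> t"
  shows "norm (f b - f a) \<le> integral {a..b} \<phi>"
proof -
  define T where "T = {a<..<b} - S"
  define D where "D t = (if t \<in> T then vector_derivative f (at t) else 0)" for t
  define \<psi> where "\<psi> t = (if t \<in> T then \<phi> t else 0)" for t
  have T: "(f has_vector_derivative D t) (at t)" "norm (D t) \<le> \<psi> t" if t: "t \<in> T" for t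
  proof -
    obtain f' where f': "(f has_vector_derivative f') (at t)" "norm f' \<le> \<phi> t"
      using deriv t by (auto simp: T_def)
    then have "D t = f'" using t by (simp add: D_def vector_derivative_at)
    then show "(f has_vector_derivative D t) (at t)" "norm (D t) \<le> \<psi> t"
      using f' t by (simp_all add: \<psi>_def)
  qed
  have "(D has_integral (f b - f a)) {a..b}"
    by (rule fundamental_theorem_of_calculus_interior_strong[OF S ab _ f]) (use T(1) in \<open>simp add: T_def\<close>)
  then have D: "D integrable_on {a..b}" "integral {a..b} D = f b - f a"
    by (auto simp: has_integral_iff)
  have fin: "finite (S \<union> {a, b})" using S by simp
  have eq: "\<psi> t = \<phi> t" if "t \<in> {a..b} - (S \<union> {a, b})" for t
    using that by (auto simp: \<psi>_def T_def)
  have \<psi>: "\<psi> integrable_on {a..b}" "integral {a..b} \<psi> = integral {a..b} \<phi>"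
    using integrable_spike_finite[OF fin eq \<phi>] integral_spike[OF negligible_finite[OF fin], of "{a..b}" \<phi> \<psi>] eq
    by auto
  have "norm (integral {a..b} D) \<le> integral {a..b} \<psi>"
    by (rule Henstock_Kurzweil_Integration.integral_norm_bound_integral[OF D(1) \<psi>(1)])
      (use T(2) in \<open>auto simp: D_def \<psi>_def split: if_splits\<close>)
  then show ?thesis using D \<psi> by simp
qed

section \<open>Atlases, tangent vectors and velocities\<close>

text \<open>
Tangent vectors and lengths of curves depend on first derivatives of the transition maps.  Stated at
this level of regularity, the theory applies both to \<open>N\<close> and to its tangent bundle.
\<close>

locale c1_atlas =
  fixes M :: "('a, 'e::euclidean_space) chart set"
  assumes inj_chart: "c \<in> M \<Longrightarrow> inj_on (snd c) (fst c)"
    and open_overlap: "c \<in> M \<Longrightarrow> d \<in> M \<Longrightarrow> open (snd c ` (fst c \<inter> fst d))"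
    and transition_C1: "c \<in> M \<Longrightarrow> d \<in> M \<Longrightarrow>
      Ck_on (Suc 0) (snd c ` (fst c \<inter> fst d)) (snd d \<circ> chart_inv c)"
begin

lemma open_chart_image: "c \<in> M \<Longrightarrow> open (snd c ` fst c)"
  using open_overlap[of c c] by simp

lemma chart_inv_chart: "c \<in> M \<Longrightarrow> p \<in> fst c \<Longrightarrow> chart_inv c (snd c p) = p"
  by (simp add: chart_inv_def inj_chart)

lemma chart_inv_in: "x \<in> snd c ` fst c \<Longrightarrow> chart_inv c x \<in> fst c"
  by (simp add: chart_inv_def inv_into_into)

lemma chart_chart_inv: "x \<in> snd c ` fst c \<Longrightarrow> snd c (chart_inv c x) = x"
  by (simp add: chart_inv_def f_inv_into_f)

lemma chart_image_Int:
  "c \<in> M \<Longrightarrow> A \<subseteq> fst c \<Longrightarrow> B \<subseteq> fst c \<Longrightarrow> snd c ` (A \<inter> B) = snd c ` A \<inter> snd c ` B"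
  using inj_on_image_Int[OF inj_chart] .

text \<open>
The sets described in the definition form a topology because injective chart maps commute with
intersections.
\<close>

lemma openin_manifold:
  "openin (manifold_topology M) W \<longleftrightarrow> W \<subseteq> points M \<and> (\<forall>c\<in>M. open (snd c ` (W \<inter> fst c)))"
proof -
  have "istopology (\<lambda>W. W \<subseteq> points M \<and> (\<forall>c\<in>M. open (snd c ` (W \<inter> fst c))))"
    unfolding istopology_def
  proof (intro conjI allI impI ballI)
    fix S T assume ST: "S \<subseteq> points M \<and> (\<forall>c\<in>M. open (snd c ` (S \<inter> fst c)))"
      "T \<subseteq> points M \<and> (\<forall>c\<in>M. open (snd c ` (T \<inter> fst c)))"
    show "S \<inter> T \<subseteq> points M" using ST by blast
    fix c assume c: "c \<in> M"
    have "snd c ` (S \<inter> T \<inter> fst c) = snd c ` (S \<inter> fst c) \<inter> snd c ` (T \<inter> fst c)"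
      using chart_image_Int[OF c, of "S \<inter> fst c" "T \<inter> fst c"] by (simp add: Int_ac)
    then show "open (snd c ` (S \<inter> T \<inter> fst c))"
      using ST c by auto
  next
    fix \<K> assume K: "\<forall>K\<in>\<K>. K \<subseteq> points M \<and> (\<forall>c\<in>M. open (snd c ` (K \<inter> fst c)))"
    show "\<Union>\<K> \<subseteq> points M" using K by blast
    fix c assume c: "c \<in> M"
    have "snd c ` (\<Union>\<K> \<inter> fst c) = (\<Union>K\<in>\<K>. snd c ` (K \<inter> fst c))" by blast
    then show "open (snd c ` (\<Union>\<K> \<inter> fst c))"
      using K c by auto
  qed
  then show ?thesis
    unfolding manifold_topology_def by (simp add: topology_inverse')
qed

lemma openin_domain: "c \<in> M \<Longrightarrow> openin (manifold_topology M) (fst c)"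
  unfolding openin_manifold using open_overlap by (auto simp: points_def Int_commute)

lemma topspace_manifold: "topspace (manifold_topology M) = points M"
proof
  show "topspace (manifold_topology M) \<subseteq> points M"
    using openin_topspace openin_manifold by blast
  show "points M \<subseteq> topspace (manifold_topology M)"
    using openin_domain openin_subset unfolding points_def by blast
qed

lemma transition_continuous:
  "c \<in> M \<Longrightarrow> d \<in> M \<Longrightarrow> continuous_on (snd c ` (fst c \<inter> fst d)) (snd d \<circ> chart_inv c)"
  using Ck_on_SucD[OF transition_C1] by simp

lemma openin_chart_preimage:
  assumes c: "c \<in> M" and V: "open V"
  shows "openin (manifold_topology M) {p \<in> fst c. snd c p \<in> V}"
  unfolding openin_manifold
proof (intro conjI ballI)
  show "{p \<in> fst c. snd c p \<in> V} \<subseteq> points M" using c by (auto simp: points_def)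
  fix d assume d: "d \<in> M"
  have "snd d ` ({p \<in> fst c. snd c p \<in> V} \<inter> fst d) =
      snd d ` (fst d \<inter> fst c) \<inter> (snd c \<circ> chart_inv d) -` V"
    using chart_inv_chart[OF d] by (auto simp: image_iff)
  then show "open (snd d ` ({p \<in> fst c. snd c p \<in> V} \<inter> fst d))"
    using continuous_open_preimage[OF transition_continuous[OF d c] open_overlap[OF d c] V]
    by simp
qed

lemma continuous_map_chart_inv:
  assumes c: "c \<in> M"
  shows "continuous_map (top_of_set (snd c ` fst c)) (manifold_topology M) (chart_inv c)"
  unfolding continuous_map
proof (intro conjI allI impI)
  show "chart_inv c ` topspace (top_of_set (snd c ` fst c)) \<subseteq> topspace (manifold_topology M)"
    using c by (auto simp: topspace_manifold points_def chart_inv_chart)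
  fix W assume W: "openin (manifold_topology M) W"
  have "{x \<in> topspace (top_of_set (snd c ` fst c)). chart_inv c x \<in> W} = snd c ` (W \<inter> fst c)"
    using chart_inv_chart[OF c] by (auto simp: image_iff)
  then show "openin (top_of_set (snd c ` fst c))
      {x \<in> topspace (top_of_set (snd c ` fst c)). chart_inv c x \<in> W}"
    using W c open_chart_image[OF c] by (auto simp: openin_manifold openin_open_eq)
qed

lemma charts_at_iff: "c \<in> charts_at M p \<longleftrightarrow> c \<in> M \<and> p \<in> fst c"
  by (simp add: charts_at_def)

lemma some_chart: "p \<in> points M \<Longrightarrow> some_chart M p \<in> charts_at M p"
  unfolding some_chart_def by (rule someI_ex) (auto simp: points_def charts_at_def)

text \<open>
The derivative at \<open>p\<close> of the change of coordinates from \<open>c\<close> to \<open>d\<close>.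
\<close>

abbreviation jac :: "('a, 'e) chart \<Rightarrow> ('a, 'e) chart \<Rightarrow> 'a \<Rightarrow> 'e \<Rightarrow> 'e" where
  "jac c d p \<equiv> frechet_derivative (snd d \<circ> chart_inv c) (at (snd c p))"

lemma transition_has_derivative:
  assumes "c \<in> charts_at M p" "d \<in> charts_at M p"
  shows "((snd d \<circ> chart_inv c) has_derivative jac c d p) (at (snd c p))"
  by (rule Ck_on_has_derivative[OF transition_C1]) (use assms in \<open>auto simp: charts_at_iff\<close>)

lemma linear_jac: "c \<in> charts_at M p \<Longrightarrow> d \<in> charts_at M p \<Longrightarrow> linear (jac c d p)"
  using transition_has_derivative has_derivative_linear by blast

lemma jac_self:
  assumes c: "c \<in> charts_at M p"
  shows "jac c c p u = u"
proof -
  have cM: "c \<in> M" and p: "p \<in> fst c" using c by (auto simp: charts_at_iff)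
  have "((\<lambda>x. x) has_derivative jac c c p) (at (snd c p))"
    by (rule has_derivative_transform_within_open[OF transition_has_derivative[OF c c] open_chart_image[OF cM]])
      (use p in \<open>auto simp: chart_chart_inv\<close>)
  then have "jac c c p = (\<lambda>x. x)"
    using has_derivative_ident has_derivative_unique by blast
  then show ?thesis by simp
qed

lemma jac_compose:
  assumes c: "c \<in> charts_at M p" and d: "d \<in> charts_at M p" and e: "e \<in> charts_at M p"
  shows "jac d e p (jac c d p u) = jac c e p u"
proof -
  have M: "c \<in> M" "d \<in> M" "e \<in> M" and p: "p \<in> fst c" "p \<in> fst d" "p \<in> fst e"
    using assms by (auto simp: charts_at_iff)
  have "(snd d \<circ> chart_inv c) (snd c p) = snd d p"
    using chart_inv_chart[OF M(1) p(1)] by simp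
  then have "((snd e \<circ> chart_inv d) \<circ> (snd d \<circ> chart_inv c) has_derivative jac d e p \<circ> jac c d p) (at (snd c p))"
    using diff_chain_at[OF transition_has_derivative[OF c d]] transition_has_derivative[OF d e] by simp
  then have "((snd e \<circ> chart_inv c) has_derivative jac d e p \<circ> jac c d p) (at (snd c p))"
  proof (rule has_derivative_transform_within_open)
    show "open (snd c ` (fst c \<inter> fst d) \<inter> snd c ` (fst c \<inter> fst e))"
      using open_overlap M by blast
    show "snd c p \<in> snd c ` (fst c \<inter> fst d) \<inter> snd c ` (fst c \<inter> fst e)"
      using p by blast
    fix x assume "x \<in> snd c ` (fst c \<inter> fst d) \<inter> snd c ` (fst c \<inter> fst e)"
    then obtain q where "x = snd c q" "q \<in> fst c" "q \<in> fst d"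
      by blast
    then show "((snd e \<circ> chart_inv d) \<circ> (snd d \<circ> chart_inv c)) x = (snd e \<circ> chart_inv c) x"
      using M by (simp add: chart_inv_chart)
  qed
  then have "jac d e p \<circ> jac c d p = jac c e p"
    using transition_has_derivative[OF c e] has_derivative_unique by blast
  then show ?thesis by (auto simp: fun_eq_iff)
qed

lemma coord_vec_apply: "d \<in> charts_at M p \<Longrightarrow> coord_vec M c u p d = jac c d p u"
  by (simp add: coord_vec_def)

lemma coord_vec_same: "c \<in> charts_at M p \<Longrightarrow> coord_vec M c u p c = u"
  by (simp add: coord_vec_apply jac_self)

lemma tangent_component:
  "v \<in> tangent_space M p \<Longrightarrow> c \<in> charts_at M p \<Longrightarrow> d \<in> charts_at M p \<Longrightarrow> v d = jac c d p (v c)"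
  unfolding tangent_space_def by blast

lemma tangent_space_intro:
  assumes "\<And>c. c \<notin> charts_at M p \<Longrightarrow> v c = 0"
    and "\<And>c d. c \<in> charts_at M p \<Longrightarrow> d \<in> charts_at M p \<Longrightarrow> v d = jac c d p (v c)"
  shows "v \<in> tangent_space M p"
  using assms unfolding tangent_space_def by blast

lemma tangent_outside: "v \<in> tangent_space M p \<Longrightarrow> c \<notin> charts_at M p \<Longrightarrow> v c = 0"
  unfolding tangent_space_def by blast

lemma coord_vec_tangent:
  assumes "c \<in> charts_at M p"
  shows "coord_vec M c u p \<in> tangent_space M p"
proof (rule tangent_space_intro)
  fix d e assume de: "d \<in> charts_at M p" "e \<in> charts_at M p"
  show "coord_vec M c u p e = jac d e p (coord_vec M c u p d)"
    unfolding coord_vec_apply[OF de(1)] coord_vec_apply[OF de(2)] jac_compose[OF assms de] ..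
qed (simp add: coord_vec_def)

lemma coord_vec_component:
  assumes c: "c \<in> charts_at M p" and v: "v \<in> tangent_space M p"
  shows "coord_vec M c (v c) p = v"
proof
  fix d
  show "coord_vec M c (v c) p d = v d"
  proof (cases "d \<in> charts_at M p")
    case True
    then show ?thesis
      unfolding coord_vec_apply[OF True] by (rule tangent_component[OF v c, symmetric])
  next
    case False
    then show ?thesis
      by (simp add: coord_vec_def tangent_outside[OF v])
  qed
qed

lemma tangent_space_eqI:
  assumes "c \<in> charts_at M p" "u \<in> tangent_space M p" "v \<in> tangent_space M p" "u c = v c"
  shows "u = v"
proof -
  have "u = coord_vec M c (u c) p"
    by (rule coord_vec_component[OF assms(1,2), symmetric])
  also have "\<dots> = coord_vec M c (v c) p"
    by (simp only: assms(4))
  also have "\<dots> = v"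
    by (rule coord_vec_component[OF assms(1,3)])
  finally show ?thesis .
qed

lemma coord_vec_add:
  assumes c: "c \<in> charts_at M p"
  shows "coord_vec M c (u + w) p = tadd (coord_vec M c u p) (coord_vec M c w p)"
proof
  show "coord_vec M c (u + w) p d = tadd (coord_vec M c u p) (coord_vec M c w p) d" for d
    using linear_add[OF linear_jac[OF c]] by (cases "d \<in> charts_at M p") (simp_all add: coord_vec_def tadd_def)
qed

lemma coord_vec_scaleR:
  assumes c: "c \<in> charts_at M p"
  shows "coord_vec M c (a *\<^sub>R u) p = tscale a (coord_vec M c u p)"
proof
  show "coord_vec M c (a *\<^sub>R u) p d = tscale a (coord_vec M c u p) d" for d
    using linear_scale[OF linear_jac[OF c]] by (cases "d \<in> charts_at M p") (simp_all add: coord_vec_def tscale_def)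
qed

lemma coord_vec_zero:
  assumes c: "c \<in> charts_at M p"
  shows "coord_vec M c 0 p = tzero"
proof
  show "coord_vec M c 0 p d = tzero d" for d
    using linear_0[OF linear_jac[OF c]] by (cases "d \<in> charts_at M p") (simp_all add: coord_vec_def tzero_def)
qed

lemma tadd_tangent:
  assumes "u \<in> tangent_space M p" "v \<in> tangent_space M p"
  shows "tadd u v \<in> tangent_space M p"
proof (rule tangent_space_intro)
  fix c d assume cd: "c \<in> charts_at M p" "d \<in> charts_at M p"
  show "tadd u v d = jac c d p (tadd u v c)"
    unfolding tadd_def linear_add[OF linear_jac[OF cd]]
    using tangent_component[OF assms(1) cd] tangent_component[OF assms(2) cd] by simp
qed (use tangent_outside[OF assms(1)] tangent_outside[OF assms(2)] in \<open>simp add: tadd_def\<close>)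

lemma tscale_tangent:
  assumes "v \<in> tangent_space M p"
  shows "tscale a v \<in> tangent_space M p"
proof (rule tangent_space_intro)
  fix c d assume cd: "c \<in> charts_at M p" "d \<in> charts_at M p"
  show "tscale a v d = jac c d p (tscale a v c)"
    unfolding tscale_def linear_scale[OF linear_jac[OF cd]]
    using tangent_component[OF assms cd] by simp
qed (use tangent_outside[OF assms] in \<open>simp add: tscale_def\<close>)

lemma tzero_tangent: "tzero \<in> tangent_space M p"
  by (rule tangent_space_intro) (simp_all add: tzero_def linear_0[OF linear_jac])

lemma eventually_curve_in:
  assumes \<gamma>: "continuous_map (top_of_set I) X \<gamma>" and W: "openin X W" and t: "t \<in> I" "\<gamma> t \<in> W"
  shows "\<forall>\<^sub>F s in at t within I. \<gamma> s \<in> W"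
proof -
  have "openin (top_of_set I) {s \<in> I. \<gamma> s \<in> W}"
    using openin_continuous_map_preimage[OF \<gamma> W] by simp
  then obtain T where "open T" "{s \<in> I. \<gamma> s \<in> W} = I \<inter> T"
    unfolding openin_open by blast
  then show ?thesis
    using t unfolding eventually_at_topological by blast
qed

lemma continuous_on_chart_curve:
  assumes \<gamma>: "continuous_map (top_of_set I) (manifold_topology M) \<gamma>" and c: "c \<in> M"
  shows "continuous_on {t \<in> I. \<gamma> t \<in> fst c} (snd c \<circ> \<gamma>)"
  unfolding continuous_on_open_invariant
proof (intro allI impI)
  fix V :: "'e set" assume "open V"
  then have "openin (top_of_set I) {t \<in> topspace (top_of_set I). \<gamma> t \<in> {p \<in> fst c. snd c p \<in> V}}"
    by (intro openin_continuous_map_preimage[OF \<gamma>] openin_chart_preimage[OF c])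
  then obtain T where "open T"
      "{t \<in> topspace (top_of_set I). \<gamma> t \<in> {p \<in> fst c. snd c p \<in> V}} = I \<inter> T"
    unfolding openin_open by blast
  then have "open T" "\<And>t. t \<in> I \<Longrightarrow> \<gamma> t \<in> fst c \<and> snd c (\<gamma> t) \<in> V \<longleftrightarrow> t \<in> T"
    by auto
  then show "\<exists>A. open A \<and> A \<inter> {t \<in> I. \<gamma> t \<in> fst c} = (snd c \<circ> \<gamma>) -` V \<inter> {t \<in> I. \<gamma> t \<in> fst c}"
    by (intro exI[of _ T] conjI set_eqI) (simp, simp, metis)
qed

lemma curve_chart_change:
  assumes \<gamma>: "continuous_map (top_of_set I) (manifold_topology M) \<gamma>" and t: "t \<in> I"
    and c: "c \<in> charts_at M (\<gamma> t)" and d: "d \<in> charts_at M (\<gamma> t)"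
    and u: "(snd c \<circ> \<gamma> has_vector_derivative u) (at t within I)"
  shows "(snd d \<circ> \<gamma> has_vector_derivative jac c d (\<gamma> t) u) (at t within I)"
proof -
  have M: "c \<in> M" "\<gamma> t \<in> fst c" using c by (auto simp: charts_at_iff)
  have "((\<lambda>s. (snd d \<circ> chart_inv c) ((snd c \<circ> \<gamma>) s)) has_derivative (\<lambda>h. jac c d (\<gamma> t) (h *\<^sub>R u))) (at t within I)"
  proof (rule has_derivative_compose[OF u[unfolded has_vector_derivative_def]])
    show "(snd d \<circ> chart_inv c has_derivative jac c d (\<gamma> t)) (at ((snd c \<circ> \<gamma>) t))"
      unfolding o_apply[of "snd c" \<gamma> t] by (rule transition_has_derivative[OF c d])
  qed
  then have "(snd d \<circ> \<gamma> has_derivative (\<lambda>h. jac c d (\<gamma> t) (h *\<^sub>R u))) (at t within I)"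
  proof (rule has_derivative_transform_eventually)
    show "\<forall>\<^sub>F s in at t within I. (snd d \<circ> chart_inv c) ((snd c \<circ> \<gamma>) s) = (snd d \<circ> \<gamma>) s"
      using eventually_curve_in[OF \<gamma> openin_domain[OF M(1)] t M(2)]
      by eventually_elim (simp add: chart_inv_chart M)
    show "(snd d \<circ> chart_inv c) ((snd c \<circ> \<gamma>) t) = (snd d \<circ> \<gamma>) t"
      by (simp add: chart_inv_chart M)
  qed (fact t)
  then show ?thesis
    unfolding has_vector_derivative_def by (simp add: linear_scale[OF linear_jac[OF c d]])
qed

text \<open>
By the chain rule, the derivative in a single chart determines the components of the velocity in all
the charts.
\<close>

lemma velocity_eq_coord_vec:
  assumes \<gamma>: "continuous_map (top_of_set I) (manifold_topology M) \<gamma>" and t: "t \<in> I"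
    and I: "at t within I \<noteq> bot" and c: "c \<in> charts_at M (\<gamma> t)"
    and u: "(snd c \<circ> \<gamma> has_vector_derivative u) (at t within I)"
  shows "velocity M I \<gamma> t = coord_vec M c u (\<gamma> t)"
proof
  fix d
  show "velocity M I \<gamma> t d = coord_vec M c u (\<gamma> t) d"
    using vector_derivative_within[OF I curve_chart_change[OF \<gamma> t c _ u], of d]
    by (simp add: velocity_def coord_vec_def)
qed

text \<open>
Around each time the curve stays in one chart, so continuity can be checked on the relatively open
sets of times spent in the various charts.
\<close>

lemma continuous_on_chartwise:
  fixes I :: "real set"
  assumes \<gamma>: "continuous_map (top_of_set I) (manifold_topology M) \<gamma>"
    and f: "\<And>c. c \<in> M \<Longrightarrow> continuous_on {t \<in> I. \<gamma> t \<in> fst c} f"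
  shows "continuous_on I f"
  unfolding continuous_on_eq_continuous_within
proof
  fix t assume t: "t \<in> I"
  then have "\<gamma> t \<in> points M"
    using continuous_map_image_subset_topspace[OF \<gamma>] by (auto simp: topspace_manifold)
  then obtain c where c: "c \<in> M" "\<gamma> t \<in> fst c" by (auto simp: points_def)
  define J where "J = {s \<in> I. \<gamma> s \<in> fst c}"
  have "continuous (at t within J) f"
    using f[OF c(1)] t c(2) by (simp add: continuous_on_eq_continuous_within J_def)
  moreover have "at t within I = at t within J"
  proof -
    have "openin (top_of_set I) J"
      using openin_continuous_map_preimage[OF \<gamma> openin_domain[OF c(1)]] by (simp add: J_def)
    then obtain T where T: "open T" "J = I \<inter> T" unfolding openin_open by blast
    then show ?thesis using t c(2) by (intro at_within_nhd[of t T]) (auto simp: J_def)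
  qed
  ultimately show "continuous (at t within I) f" by simp
qed

end

section \<open>Continuous metrics and the length of curves\<close>

text \<open>
Continuity of the coefficients is what comparing lengths with Euclidean distances depends on, and the
Hausdorff property is what makes the distance of different points positive.
\<close>

locale metric_manifold = c1_atlas M
  for M :: "('a, 'e::euclidean_space) chart set" +
  fixes g :: "('a, 'e) metric_tensor"
  assumes g_sym: "p \<in> points M \<Longrightarrow> u \<in> tangent_space M p \<Longrightarrow> v \<in> tangent_space M p \<Longrightarrow> g p u v = g p v u"
    and g_add: "p \<in> points M \<Longrightarrow> u \<in> tangent_space M p \<Longrightarrow> v \<in> tangent_space M p \<Longrightarrow>
      w \<in> tangent_space M p \<Longrightarrow> g p (tadd u v) w = g p u w + g p v w"
    and g_scale: "p \<in> points M \<Longrightarrow> u \<in> tangent_space M p \<Longrightarrow> v \<in> tangent_space M p \<Longrightarrow>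
      g p (tscale a u) v = a * g p u v"
    and g_pos: "p \<in> points M \<Longrightarrow> u \<in> tangent_space M p \<Longrightarrow> u \<noteq> tzero \<Longrightarrow> 0 < g p u u"
    and g_continuous: "c \<in> M \<Longrightarrow> continuous_on (snd c ` fst c)
      (\<lambda>x. g (chart_inv c x) (coord_vec M c i (chart_inv c x)) (coord_vec M c j (chart_inv c x)))"
    and Hausdorff: "Hausdorff_space (manifold_topology M)"
begin

text \<open>
The metric at the point with coordinates \<open>x\<close>, as a bilinear form on components in the chart \<open>c\<close>.
\<close>

definition ip :: "('a, 'e) chart \<Rightarrow> 'e \<Rightarrow> 'e \<Rightarrow> 'e \<Rightarrow> real" where
  "ip c x u w = g (chart_inv c x) (coord_vec M c u (chart_inv c x)) (coord_vec M c w (chart_inv c x))"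

lemma charts_at_points: "c \<in> charts_at M p \<Longrightarrow> p \<in> points M"
  by (auto simp: charts_at_def points_def)

lemma chart_inv_charts_at: "c \<in> M \<Longrightarrow> x \<in> snd c ` fst c \<Longrightarrow> c \<in> charts_at M (chart_inv c x)"
  by (simp add: charts_at_iff chart_inv_in)

lemma ip_chart:
  "c \<in> charts_at M p \<Longrightarrow> g p (coord_vec M c u p) (coord_vec M c w p) = ip c (snd c p) u w"
  by (simp add: ip_def charts_at_iff chart_inv_chart)

context
  fixes c x
  assumes c: "c \<in> M" and x: "x \<in> snd c ` fst c"
begin

lemma ip_sym: "ip c x u w = ip c x w u"
  unfolding ip_def using chart_inv_charts_at[OF c x]
  by (intro g_sym coord_vec_tangent charts_at_points)

lemma ip_add_left: "ip c x (u + v) w = ip c x u w + ip c x v w"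
  unfolding ip_def coord_vec_add[OF chart_inv_charts_at[OF c x]] using chart_inv_charts_at[OF c x]
  by (intro g_add coord_vec_tangent charts_at_points)

lemma ip_scale_left: "ip c x (a *\<^sub>R u) w = a *\<^sub>R ip c x u w"
  unfolding ip_def coord_vec_scaleR[OF chart_inv_charts_at[OF c x]] real_scaleR_def
  using chart_inv_charts_at[OF c x] by (intro g_scale coord_vec_tangent charts_at_points)

lemma ip_linear_left: "linear (\<lambda>u. ip c x u w)"
  by (rule linearI) (rule ip_add_left ip_scale_left)+

lemma ip_linear_right: "linear (\<lambda>w. ip c x u w)"
  unfolding ip_sym[of u] by (rule ip_linear_left)

lemma ip_zero: "ip c x 0 w = 0"
  by (rule linear_0[OF ip_linear_left])

text \<open>
This reduces continuity and differentiability in all three arguments to those of the coefficients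
of the metric.
\<close>

lemma ip_expand: "ip c x u w = (\<Sum>i\<in>Basis. \<Sum>j\<in>Basis. (u \<bullet> i) * ((w \<bullet> j) * ip c x i j))"
proof -
  have "ip c x u w = (\<Sum>i\<in>Basis. (u \<bullet> i) *\<^sub>R ip c x i w)"
    by (rule linear_expand[OF ip_linear_left])
  also have "\<dots> = (\<Sum>i\<in>Basis. (u \<bullet> i) *\<^sub>R (\<Sum>j\<in>Basis. (w \<bullet> j) *\<^sub>R ip c x i j))"
    by (intro sum.cong refl arg_cong2[where f = scaleR] linear_expand[OF ip_linear_right])
  finally show ?thesis
    by (simp add: sum_distrib_left)
qed

lemma ip_pos: "u \<noteq> 0 \<Longrightarrow> 0 < ip c x u u"
proof -
  assume u: "u \<noteq> 0"
  have *: "c \<in> charts_at M (chart_inv c x)" by (rule chart_inv_charts_at[OF c x])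
  have "coord_vec M c u (chart_inv c x) c \<noteq> tzero c"
    using u by (simp add: coord_vec_same[OF *] tzero_def)
  then have "coord_vec M c u (chart_inv c x) \<noteq> tzero" by metis
  then show ?thesis
    unfolding ip_def using * by (intro g_pos coord_vec_tangent charts_at_points)
qed

lemma ip_nonneg: "0 \<le> ip c x u u"
  using ip_pos[of u] ip_zero[of 0] by (cases "u = 0") auto

end

lemma ip_add_self:
  assumes c: "c \<in> M" and x: "x \<in> snd c ` fst c"
  shows "ip c x (u + w) (u + w) = ip c x u u + ip c x w w + 2 * ip c x u w"
  using linear_add[OF ip_linear_left[OF c x]] linear_add[OF ip_linear_right[OF c x]] ip_sym[OF c x, of w u]
  by simp

text \<open>
The classical argument: the form is nonnegative at the point of the line \<open>w + s u\<close> closest to the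
origin.
\<close>

lemma ip_cauchy_schwarz:
  assumes c: "c \<in> M" and x: "x \<in> snd c ` fst c"
  shows "\<bar>ip c x w u\<bar> \<le> sqrt (ip c x w w) * sqrt (ip c x u u)"
proof (cases "u = 0")
  case True
  then show ?thesis
    using linear_0[OF ip_linear_right[OF c x]] ip_zero[OF c x] by simp
next
  case False
  then have pos: "0 < ip c x u u" by (rule ip_pos[OF c x])
  define s where "s = - (ip c x w u / ip c x u u)"
  have "0 \<le> ip c x (w + s *\<^sub>R u) (w + s *\<^sub>R u)" by (rule ip_nonneg[OF c x])
  also have "\<dots> = ip c x w w + s * (s * ip c x u u) + 2 * (s * ip c x w u)"
    unfolding ip_add_self[OF c x]
    using linear_scale[OF ip_linear_left[OF c x]] linear_scale[OF ip_linear_right[OF c x]] by simp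
  also have "\<dots> = ip c x w w - (ip c x w u)\<^sup>2 / ip c x u u"
    using pos by (simp add: s_def field_simps power2_eq_square)
  finally have "(ip c x w u)\<^sup>2 \<le> ip c x w w * ip c x u u"
    using pos by (simp add: field_simps)
  then show ?thesis
    by (metis real_sqrt_abs real_sqrt_le_mono real_sqrt_mult)
qed

lemma continuous_on_ip:
  assumes c: "c \<in> M" and f: "continuous_on S f" "f ` S \<subseteq> snd c ` fst c"
    and u: "continuous_on S u" and w: "continuous_on S w"
  shows "continuous_on S (\<lambda>t. ip c (f t) (u t) (w t))"
proof -
  have "continuous_on S (\<lambda>t. ip c (f t) i j)" for i j
    using continuous_on_compose2[OF g_continuous[OF c] f] by (simp add: ip_def)
  then have "continuous_on S (\<lambda>t. \<Sum>i\<in>Basis. \<Sum>j\<in>Basis. (u t \<bullet> i) * ((w t \<bullet> j) * ip c (f t) i j))"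
    by (intro continuous_intros u w)
  moreover have "ip c (f t) (u t) (w t) =
      (\<Sum>i\<in>Basis. \<Sum>j\<in>Basis. (u t \<bullet> i) * ((w t \<bullet> j) * ip c (f t) i j))" if "t \<in> S" for t
    by (rule ip_expand[OF c]) (use f(2) that in blast)
  ultimately show ?thesis
    by (subst continuous_on_cong[OF refl])
qed

text \<open>
The form is continuous and positive on the compact product of \<open>K\<close> with the unit sphere; its extreme
values there are the constants.
\<close>

lemma chart_norm_comparison:
  assumes c: "c \<in> M" and K: "compact K" "K \<subseteq> snd c ` fst c"
  obtains a b where "0 < a" "0 < b"
    "\<And>x u. x \<in> K \<Longrightarrow> a * norm u \<le> sqrt (ip c x u u)"
    "\<And>x u. x \<in> K \<Longrightarrow> sqrt (ip c x u u) \<le> b * norm u"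
proof (cases "K = {}")
  case True
  then show ?thesis using that[of 1 1] by auto
next
  case False
  let ?f = "\<lambda>(x, u). sqrt (ip c x u u)"
  define A where "A = K \<times> sphere (0::'e) 1"
  have cpt: "compact A" unfolding A_def by (intro compact_Times K compact_sphere)
  have ne: "A \<noteq> {}"
    using False vector_choose_size[of 1, where 'a = 'e] by (auto simp: A_def)
  have cont: "continuous_on A ?f"
    unfolding case_prod_beta A_def using K(2)
    by (intro continuous_on_real_sqrt continuous_on_ip[OF c] continuous_intros) auto
  obtain y where y: "y \<in> A" "\<forall>w\<in>A. ?f y \<le> ?f w"
    using continuous_attains_inf[OF cpt ne cont] by blast
  obtain z where z: "z \<in> A" "\<forall>w\<in>A. ?f w \<le> ?f z"
    using continuous_attains_sup[OF cpt ne cont] by blast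
  have pos: "0 < ?f w" if "w \<in> A" for w
  proof -
    obtain x u where "w = (x, u)" by (cases w)
    with that have w: "w = (x, u)" "x \<in> K" "norm u = 1"
      by (auto simp: A_def)
    have "u \<noteq> 0" using w(3) by auto
    moreover have "x \<in> snd c ` fst c" using w(2) K(2) by blast
    ultimately show ?thesis
      using ip_pos[OF c] w(1) by simp
  qed
  have scale: "sqrt (ip c x u u) = norm u * ?f (x, u /\<^sub>R norm u)" "(x, u /\<^sub>R norm u) \<in> A"
    if "x \<in> K" "u \<noteq> 0" for x u
  proof -
    have x: "x \<in> snd c ` fst c" using that K(2) by blast
    define w where "w = u /\<^sub>R norm u"
    have "u = norm u *\<^sub>R w" using that by (simp add: w_def)
    then have "ip c x u u = ip c x (norm u *\<^sub>R w) (norm u *\<^sub>R w)"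
      by (rule arg_cong[where f = "\<lambda>v. ip c x v v"])
    also have "\<dots> = norm u * (norm u * ip c x w w)"
      using linear_scale[OF ip_linear_left[OF c x]] linear_scale[OF ip_linear_right[OF c x]]
      by simp
    finally show "sqrt (ip c x u u) = norm u * ?f (x, u /\<^sub>R norm u)"
      by (simp add: w_def[symmetric] real_sqrt_mult)
    show "(x, u /\<^sub>R norm u) \<in> A" using that by (simp add: A_def)
  qed
  show ?thesis
  proof (rule that)
    show "0 < ?f y" "0 < ?f z" using pos y z by auto
    fix x u assume x: "x \<in> K"
    have ip0: "ip c x 0 0 = 0" using ip_zero[OF c] x K(2) by blast
    have bounds: "?f y * norm u \<le> norm u * ?f (x, u /\<^sub>R norm u)" "norm u * ?f (x, u /\<^sub>R norm u) \<le> ?f z * norm u"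
      if "u \<noteq> 0"
      using bspec[OF y(2) scale(2)[OF x that]] bspec[OF z(2) scale(2)[OF x that]]
      by (simp_all only: mult.commute[of _ "norm u"] mult_left_mono norm_ge_zero)
    show "?f y * norm u \<le> sqrt (ip c x u u)" "sqrt (ip c x u u) \<le> ?f z * norm u"
      unfolding atomize_conj
    proof (cases "u = 0")
      case True
      then show "?f y * norm u \<le> sqrt (ip c x u u) \<and> sqrt (ip c x u u) \<le> ?f z * norm u"
        by (simp only: ip0 norm_zero mult_zero_right real_sqrt_zero order_refl simp_thms)
    next
      case False
      then show "?f y * norm u \<le> sqrt (ip c x u u) \<and> sqrt (ip c x u u) \<le> ?f z * norm u"
        unfolding scale(1)[OF x False] using bounds by blast
    qed
  qed
qed

text \<open>
The two-sided velocity makes the speed independent of the interval of definition, so that integrals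
over adjacent intervals add up.  At end points and corners the value is meaningless, but these are
finitely many.
\<close>

definition speed :: "(real \<Rightarrow> 'a) \<Rightarrow> real \<Rightarrow> real" where
  "speed \<gamma> t = sqrt (g (\<gamma> t) (velocity M UNIV \<gamma> t) (velocity M UNIV \<gamma> t))"

lemma velocity_interior:
  "a < t \<Longrightarrow> t < b \<Longrightarrow> velocity M {a..b} \<gamma> t = velocity M UNIV \<gamma> t" for t :: real
  by (simp add: velocity_def at_within_Icc_at cong: if_cong)

lemma at_within_Icc_nontrivial: "a < b \<Longrightarrow> t \<in> {a..b} \<Longrightarrow> at t within {a..b} \<noteq> bot" for t :: real
  by (simp add: trivial_limit_within islimpt_Icc)

lemma speed_eq:
  assumes \<gamma>: "continuous_map (top_of_set {a..b}) (manifold_topology M) \<gamma>" and t: "a < t" "t < b"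
    and c: "c \<in> charts_at M (\<gamma> t)" and u: "(snd c \<circ> \<gamma> has_vector_derivative u) (at t)"
  shows "speed \<gamma> t = sqrt (ip c (snd c (\<gamma> t)) u u)"
proof -
  have "velocity M UNIV \<gamma> t = coord_vec M c u (\<gamma> t)"
    using velocity_eq_coord_vec[OF \<gamma> _ _ c, of u] at_within_Icc_nontrivial[of a b t] t u
    by (simp add: velocity_interior at_within_Icc_at)
  then show ?thesis
    by (simp add: speed_def ip_chart[OF c])
qed

text \<open>
The speed computed with one-sided velocities at the end points is continuous on the closed interval.
\<close>

lemma C1_curve_speed_integrable:
  assumes \<gamma>: "C1_curve M {a..b} \<gamma>" and ab: "a < b"
  shows "speed \<gamma> integrable_on {a..b}"
proof -
  have cont: "continuous_map (top_of_set {a..b}) (manifold_topology M) \<gamma>"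
    using \<gamma> by (simp add: C1_curve_def)
  define \<sigma> where "\<sigma> t = sqrt (g (\<gamma> t) (velocity M {a..b} \<gamma> t) (velocity M {a..b} \<gamma> t))" for t
  have "continuous_on {a..b} \<sigma>"
  proof (rule continuous_on_chartwise[OF cont])
    fix c assume c: "c \<in> M"
    define J where "J = {s \<in> {a..b}. \<gamma> s \<in> fst c}"
    define u where "u = (\<lambda>s. vector_derivative (snd c \<circ> \<gamma>) (at s within {a..b}))"
    have u: "continuous_on J u" "\<And>s. s \<in> J \<Longrightarrow> (snd c \<circ> \<gamma> has_vector_derivative u s) (at s within {a..b})"
      using \<gamma> c unfolding C1_curve_def J_def u_def by (auto simp: vector_derivative_works)
    have J: "c \<in> charts_at M (\<gamma> s)" "s \<in> {a..b}" if "s \<in> J" for s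
      using that c by (auto simp: J_def charts_at_iff)
    have "\<sigma> s = sqrt (ip c ((snd c \<circ> \<gamma>) s) (u s) (u s))" if "s \<in> J" for s
      using velocity_eq_coord_vec[OF cont J(2)[OF that] at_within_Icc_nontrivial[OF ab J(2)[OF that]]
        J(1)[OF that] u(2)[OF that]]
      by (simp add: \<sigma>_def ip_chart[OF J(1)[OF that]])
    moreover have "continuous_on J (\<lambda>s. sqrt (ip c ((snd c \<circ> \<gamma>) s) (u s) (u s)))"
      using continuous_on_chart_curve[OF cont c] u(1)
      by (intro continuous_on_real_sqrt continuous_on_ip[OF c]) (auto simp: J_def)
    ultimately have "continuous_on J \<sigma>"
      by (subst continuous_on_cong[OF refl])
    then show "continuous_on {s \<in> {a..b}. \<gamma> s \<in> fst c} \<sigma>"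
      by (simp add: J_def)
  qed
  then have "\<sigma> integrable_on {a..b}"
    by (rule integrable_continuous_real)
  then show ?thesis
    by (rule integrable_spike_finite[of "{a, b}", rotated 2]) (auto simp: \<sigma>_def speed_def velocity_interior)
qed

text \<open>
A property of intervals that is additive and holds between consecutive points of \<open>S\<close> holds in
general; this extends statements from \<open>C\<^sup>1\<close> to piecewise \<open>C\<^sup>1\<close> curves.
\<close>

lemma interval_partition_induct:
  fixes a b :: real
  assumes "finite S" "l \<le> a" "a < b" "b \<le> r"
    and base: "\<And>a b. l \<le> a \<Longrightarrow> a < b \<Longrightarrow> b \<le> r \<Longrightarrow> {a<..<b} \<inter> S = {} \<Longrightarrow> P a b"
    and step: "\<And>a s b. l \<le> a \<Longrightarrow> a < s \<Longrightarrow> s < b \<Longrightarrow> b \<le> r \<Longrightarrow> P a s \<Longrightarrow> P s b \<Longrightarrow> P a b"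
  shows "P a b"
  using assms(2-4)
proof (induction "card ({a<..<b} \<inter> S)" arbitrary: a b rule: less_induct)
  case less
  show ?case
  proof (cases "{a<..<b} \<inter> S = {}")
    case True
    then show ?thesis using base less.prems by blast
  next
    case False
    then obtain s where s: "s \<in> S" "a < s" "s < b" by auto
    have "card ({a<..<s} \<inter> S) < card ({a<..<b} \<inter> S)" "card ({s<..<b} \<inter> S) < card ({a<..<b} \<inter> S)"
      using s \<open>finite S\<close> by (auto intro!: psubset_card_mono)
    then show ?thesis
      using less.hyps[of a s] less.hyps[of s b] less.prems s by (intro step[of a s b]) auto
  qed
qed

lemma piecewise_C1_speed_integrable:
  assumes \<gamma>: "piecewise_C1_curve M \<gamma>" and ab: "0 \<le> a" "b \<le> 1"
  shows "speed \<gamma> integrable_on {a..b}"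
proof (cases "a < b")
  case True
  obtain S where S: "finite S" "\<forall>a b. 0 \<le> a \<longrightarrow> a < b \<longrightarrow> b \<le> 1 \<longrightarrow> {a<..<b} \<inter> S = {} \<longrightarrow> C1_curve M {a..b} \<gamma>"
    using \<gamma> unfolding piecewise_C1_curve_def by blast
  show ?thesis
  proof (rule interval_partition_induct[of S 0 a b 1 "\<lambda>a b. speed \<gamma> integrable_on {a..b}", OF S(1) ab(1) True ab(2)])
    show "speed \<gamma> integrable_on {a..b}" if "0 \<le> a" "a < b" "b \<le> 1" "{a<..<b} \<inter> S = {}" for a b
      using S(2) that C1_curve_speed_integrable by blast
    show "speed \<gamma> integrable_on {a..b}"
      if "a < s" "s < b" "speed \<gamma> integrable_on {a..s}" "speed \<gamma> integrable_on {s..b}" for a s b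
      using that by (rule Henstock_Kurzweil_Integration.integrable_combine[OF less_imp_le less_imp_le])
  qed
next
  case False
  then show ?thesis
    using integrable_on_refl[of "speed \<gamma>" a] by (cases "a = b") auto
qed

lemma curve_length_eq: "curve_length M g \<gamma> = integral {0..1} (speed \<gamma>)"
  unfolding curve_length_def
  by (rule integral_spike[of "{0, 1}"]) (auto simp: speed_def velocity_interior)

lemma piecewise_C1_continuous:
  "piecewise_C1_curve M \<gamma> \<Longrightarrow> continuous_map (top_of_set {0..1}) (manifold_topology M) \<gamma>"
  by (simp add: piecewise_C1_curve_def)

lemma piecewise_C1_in_points:
  "piecewise_C1_curve M \<gamma> \<Longrightarrow> t \<in> {0..1} \<Longrightarrow> \<gamma> t \<in> points M"
  using continuous_map_image_subset_topspace[OF piecewise_C1_continuous, of \<gamma>]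
  by (auto simp: topspace_manifold)

text \<open>
Each time outside of the finite set of corners lies in the interior of an interval on which the curve
is \<open>C\<^sup>1\<close>.
\<close>

lemma piecewise_C1_velocity:
  assumes \<gamma>: "piecewise_C1_curve M \<gamma>"
  obtains S where "finite S"
    "\<And>t c. t \<in> {0<..<1} - S \<Longrightarrow> c \<in> charts_at M (\<gamma> t) \<Longrightarrow>
      \<exists>u. (snd c \<circ> \<gamma> has_vector_derivative u) (at t) \<and> speed \<gamma> t = sqrt (ip c (snd c (\<gamma> t)) u u)"
proof -
  obtain S where S: "finite S" "\<forall>a b. 0 \<le> a \<longrightarrow> a < b \<longrightarrow> b \<le> 1 \<longrightarrow> {a<..<b} \<inter> S = {} \<longrightarrow> C1_curve M {a..b} \<gamma>"
    using \<gamma> unfolding piecewise_C1_curve_def by blast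
  show ?thesis
  proof (rule that[OF S(1)])
    fix t c assume t: "t \<in> {0<..<1} - S" and c: "c \<in> charts_at M (\<gamma> t)"
    have "open ({0<..<1} - S)" using S(1) by (intro open_Diff finite_imp_closed) auto
    then obtain e where e: "0 < e" "ball t e \<subseteq> {0<..<1} - S"
      using t by (meson openE)
    define a b where "a = t - e/2" and "b = t + e/2"
    have sub: "{a..b} \<subseteq> {0<..<1} - S" and ab: "a < t" "t < b"
      using e by (auto simp: a_def b_def dist_real_def subset_iff abs_if)
    have "a \<in> {0<..<1}" "b \<in> {0<..<1}" "{a<..<b} \<inter> S = {}"
      using ab subsetD[OF sub, of a] subsetD[OF sub, of b] subsetD[OF sub] by force+
    then have "C1_curve M {a..b} \<gamma>" using S(2) ab by simp
    then have "(snd c \<circ> \<gamma>) differentiable (at t within {a..b})"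
      using c ab unfolding C1_curve_def by (auto simp: charts_at_iff)
    then obtain u where u: "(snd c \<circ> \<gamma> has_vector_derivative u) (at t)"
      using ab by (auto simp: at_within_Icc_at vector_derivative_works)
    moreover have "speed \<gamma> t = sqrt (ip c (snd c (\<gamma> t)) u u)"
      by (rule speed_eq[OF piecewise_C1_continuous[OF \<gamma>] _ _ c u]) (use t in auto)
    ultimately show "\<exists>u. (snd c \<circ> \<gamma> has_vector_derivative u) (at t) \<and> speed \<gamma> t = sqrt (ip c (snd c (\<gamma> t)) u u)"
      by blast
  qed
qed

lemma speed_integral_nonneg:
  assumes \<gamma>: "piecewise_C1_curve M \<gamma>" and ab: "0 \<le> a" "a \<le> b" "b \<le> 1"
  shows "0 \<le> integral {a..b} (speed \<gamma>)"
proof -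
  obtain S where S: "finite S" "\<And>t c. t \<in> {0<..<1} - S \<Longrightarrow> c \<in> charts_at M (\<gamma> t) \<Longrightarrow>
      \<exists>u. (snd c \<circ> \<gamma> has_vector_derivative u) (at t) \<and>
          speed \<gamma> t = sqrt (ip c (snd c (\<gamma> t)) u u)"
    using piecewise_C1_velocity[OF \<gamma>] by blast
  \<comment> \<open>the mean value inequality for the constant function \<open>0\<close>\<close>
  have "norm ((0::real) - 0) \<le> integral {a..b} (speed \<gamma>)"
  proof (rule increment_le_integral[OF S(1) ab(2) _ piecewise_C1_speed_integrable[OF \<gamma> ab(1,3)], of "\<lambda>_. 0"])
    fix t assume t: "t \<in> {a<..<b} - S"
    then have t': "t \<in> {0<..<1} - S" "t \<in> {0..1}" using ab by auto
    obtain c where c: "c \<in> charts_at M (\<gamma> t)"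
      using some_chart[OF piecewise_C1_in_points[OF \<gamma> t'(2)]] by blast
    then have "0 \<le> speed \<gamma> t"
      using S(2)[OF t'(1) c] ip_nonneg[of c "snd c (\<gamma> t)"] by (auto simp: charts_at_iff)
    then show "\<exists>f'. ((\<lambda>_. 0::real) has_vector_derivative f') (at t) \<and> norm f' \<le> speed \<gamma> t"
      by (intro exI[of _ 0]) auto
  qed auto
  then show ?thesis by simp
qed

lemma curve_length_nonneg: "piecewise_C1_curve M \<gamma> \<Longrightarrow> 0 \<le> curve_length M g \<gamma>"
  unfolding curve_length_eq by (rule speed_integral_nonneg) auto

lemma speed_integral_le_length:
  assumes \<gamma>: "piecewise_C1_curve M \<gamma>" and t: "0 \<le> t" "t \<le> 1"
  shows "integral {0..t} (speed \<gamma>) \<le> curve_length M g \<gamma>"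
  using Henstock_Kurzweil_Integration.integral_combine[OF t piecewise_C1_speed_integrable[OF \<gamma> order_refl order_refl]]
    speed_integral_nonneg[OF \<gamma> t order_refl]
  unfolding curve_length_eq by linarith

section \<open>Short curves and straight curves in a chart\<close>

text \<open>
As long as the curve stays in the coordinate ball, its Euclidean displacement is at most its length
divided by \<open>a\<close>, so it stays in the smaller closed ball of radius \<open>L / a < r\<close>.  That ball is compact,
hence closed because the space is Hausdorff, so the curve is still in it at the first time when it
could leave the open ball of radius \<open>r\<close>.  Without the Hausdorff property the conclusion fails, as the
line with a doubled origin shows.
\<close>

lemma short_curve_in_chart:
  assumes c: "c \<in> M" and \<gamma>: "piecewise_C1_curve M \<gamma>" and p: "\<gamma> 0 \<in> fst c"
    and r: "cball (snd c (\<gamma> 0)) r \<subseteq> snd c ` fst c"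
    and a: "0 < a" "\<And>x u. x \<in> cball (snd c (\<gamma> 0)) r \<Longrightarrow> a * norm u \<le> sqrt (ip c x u u)"
    and short: "curve_length M g \<gamma> < a * r"
  shows "\<gamma> 1 \<in> fst c" "a * norm (snd c (\<gamma> 1) - snd c (\<gamma> 0)) \<le> curve_length M g \<gamma>"
proof -
  define x0 where "x0 = snd c (\<gamma> 0)"
  define L where "L = curve_length M g \<gamma>"
  define B where "B = {p \<in> fst c. snd c p \<in> ball x0 r}"
  note cont = piecewise_C1_continuous[OF \<gamma>]
  have L0: "0 \<le> L" unfolding L_def by (rule curve_length_nonneg[OF \<gamma>])
  have "0 < a * r" using L0 short by (simp add: L_def)
  then have r0: "0 < r" using a(1) by (simp add: zero_less_mult_iff)
  obtain S where S: "finite S" "\<And>t c. t \<in> {0<..<1} - S \<Longrightarrow> c \<in> charts_at M (\<gamma> t) \<Longrightarrow>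
      \<exists>u. (snd c \<circ> \<gamma> has_vector_derivative u) (at t) \<and>
          speed \<gamma> t = sqrt (ip c (snd c (\<gamma> t)) u u)"
    using piecewise_C1_velocity[OF \<gamma>] by blast
  have bound: "norm (snd c (\<gamma> t) - x0) \<le> L / a" if t: "t \<in> {0..1}" and B: "\<forall>s\<in>{0..t}. \<gamma> s \<in> B" for t
  proof -
    have "norm ((snd c \<circ> \<gamma>) t - (snd c \<circ> \<gamma>) 0) \<le> integral {0..t} (\<lambda>s. speed \<gamma> s / a)"
    proof (rule increment_le_integral[OF S(1)])
      show "0 \<le> t" using t by simp
      show "continuous_on {0..t} (snd c \<circ> \<gamma>)"
        by (rule continuous_on_subset[OF continuous_on_chart_curve[OF cont c]])
          (use B t in \<open>auto simp: B_def\<close>)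
      show "(\<lambda>s. speed \<gamma> s / a) integrable_on {0..t}"
        using piecewise_C1_speed_integrable[OF \<gamma>, of 0 t] t by (intro integrable_on_divide) auto
      fix s assume s: "s \<in> {0<..<t} - S"
      then have s': "s \<in> {0<..<1} - S" "\<gamma> s \<in> B" using t B by auto
      then have "c \<in> charts_at M (\<gamma> s)" using c by (simp add: charts_at_iff B_def)
      from S(2)[OF s'(1) this] obtain u where u: "(snd c \<circ> \<gamma> has_vector_derivative u) (at s)"
        "speed \<gamma> s = sqrt (ip c (snd c (\<gamma> s)) u u)" by blast
      have "snd c (\<gamma> s) \<in> cball (snd c (\<gamma> 0)) r" using s'(2) by (simp add: B_def x0_def)
      from a(2)[OF this, of u] have "norm u \<le> speed \<gamma> s / a"
        using u(2) a(1) by (simp add: pos_le_divide_eq mult.commute)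
      then show "\<exists>f'. (snd c \<circ> \<gamma> has_vector_derivative f') (at s) \<and> norm f' \<le> speed \<gamma> s / a"
        using u(1) by blast
    qed
    also have "\<dots> = integral {0..t} (speed \<gamma>) / a"
      by (rule integral_divide)
    also have "\<dots> \<le> L / a"
      using speed_integral_le_length[OF \<gamma>, of t] t a(1) by (simp add: L_def divide_right_mono)
    finally show ?thesis by (simp add: x0_def)
  qed
  have B0: "\<gamma> 0 \<in> B" using p r0 by (simp add: B_def x0_def)
  have inB: "\<forall>t\<in>{0..1}. \<gamma> t \<in> B"
  proof (rule ccontr)
    define A where "A = {t \<in> {0..1}. \<gamma> t \<notin> B}"
    assume "\<not> (\<forall>t\<in>{0..1}. \<gamma> t \<in> B)"
    then have "A \<noteq> {}" by (auto simp: A_def)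
    have "openin (top_of_set {0..1}) {t \<in> {0..1}. \<gamma> t \<in> B}"
      using openin_continuous_map_preimage[OF cont openin_chart_preimage[OF c open_ball]]
      by (simp add: B_def)
    then have "closedin (top_of_set {0..1}) ({0..1} - {t \<in> {0..1}. \<gamma> t \<in> B})"
      by (intro closedin_diff) (simp_all only: closedin_subtopology_refl topspace_euclidean subset_UNIV)
    moreover have "{0..1} - {t \<in> {0..1}. \<gamma> t \<in> B} = A" by (auto simp: A_def)
    ultimately have "closed A" using closedin_closed_trans[of "{0..1}" A] by simp
    moreover have bdd: "bdd_below A" by (rule bdd_belowI[of _ 0]) (simp add: A_def)
    ultimately have s: "Inf A \<in> A" using \<open>A \<noteq> {}\<close> by (intro closed_contains_Inf)
    \<comment> \<open>the first time outside of the open ball\<close>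
    define s where "s = Inf A"
    have s01: "s \<in> {0..1}" "\<gamma> s \<notin> B" using s by (auto simp: A_def s_def)
    have less: "\<gamma> t \<in> B" if "t \<in> {0..<s}" for t
    proof (rule ccontr)
      assume "\<gamma> t \<notin> B"
      then have "t \<in> A" using that s01 by (auto simp: A_def)
      then have "s \<le> t" unfolding s_def using bdd by (rule cInf_lower)
      then show False using that by simp
    qed
    have "s \<noteq> 0" using s01 B0 by auto
    then have "0 < s" using s01 by simp
    \<comment> \<open>the smaller ball, which contains the curve before that time\<close>
    define K where "K = {p \<in> fst c. snd c p \<in> cball x0 (L / a)}"
    have "L / a < r" using short a(1) by (simp add: L_def pos_divide_less_eq mult.commute)
    then have sub: "cball x0 (L / a) \<subseteq> snd c ` fst c" and KB: "K \<subseteq> B"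
      using r by (auto simp: x0_def K_def B_def)
    have "K = chart_inv c ` cball x0 (L / a)"
    proof
      show "K \<subseteq> chart_inv c ` cball x0 (L / a)"
        using chart_inv_chart[OF c] by (force simp: K_def image_iff)
      show "chart_inv c ` cball x0 (L / a) \<subseteq> K"
        using sub chart_inv_in[of _ c] chart_chart_inv[of _ c] by (auto simp: K_def subset_iff)
    qed
    moreover have "compactin (top_of_set (snd c ` fst c)) (cball x0 (L / a))"
      using sub by (simp add: compactin_subtopology)
    ultimately have "compactin (manifold_topology M) K"
      using image_compactin[OF _ continuous_map_chart_inv[OF c]] by simp
    then have "closedin (manifold_topology M) K"
      by (rule compactin_imp_closedin[OF Hausdorff])
    then have "closedin (top_of_set {0..1}) {t \<in> {0..1}. \<gamma> t \<in> K}"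
      using closedin_continuous_map_preimage[OF cont] by simp
    then have "closed {t \<in> {0..1}. \<gamma> t \<in> K}"
      by (rule closedin_closed_trans) simp
    moreover have "{0..<s} \<subseteq> {t \<in> {0..1}. \<gamma> t \<in> K}"
    proof
      fix t assume t: "t \<in> {0..<s}"
      then have "norm (snd c (\<gamma> t) - x0) \<le> L / a"
        using s01 less by (intro bound) auto
      then show "t \<in> {t \<in> {0..1}. \<gamma> t \<in> K}"
        using less[OF t] t s01 by (simp add: K_def B_def dist_norm norm_minus_commute)
    qed
    ultimately have "closure {0..<s} \<subseteq> {t \<in> {0..1}. \<gamma> t \<in> K}"
      by (rule closure_minimal[rotated])
    moreover have "s \<in> closure {0..<s}" using \<open>0 < s\<close> by simp
    ultimately have "\<gamma> s \<in> K" by blast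
    then show False using KB s01 by blast
  qed
  then show "\<gamma> 1 \<in> fst c" by (simp add: B_def)
  have "norm (snd c (\<gamma> 1) - x0) \<le> L / a" using inB by (intro bound) auto
  then show "a * norm (snd c (\<gamma> 1) - snd c (\<gamma> 0)) \<le> curve_length M g \<gamma>"
    using a(1) by (simp add: pos_le_divide_eq mult.commute x0_def L_def)
qed

text \<open>
The velocity in the chart \<open>c\<close> is constant, so that the velocity in any other chart \<open>d\<close> is the
derivative of a transition map in a fixed direction, which is continuous along the curve.
\<close>

lemma chart_segment:
  assumes c: "c \<in> M" and seg: "\<And>t. t \<in> {0..1} \<Longrightarrow> x + t *\<^sub>R v \<in> snd c ` fst c"
  shows "piecewise_C1_curve M (\<lambda>t. chart_inv c (x + t *\<^sub>R v))"
    and "(\<And>t. t \<in> {0..1} \<Longrightarrow> sqrt (ip c (x + t *\<^sub>R v) v v) \<le> B) \<Longrightarrow>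
      curve_length M g (\<lambda>t. chart_inv c (x + t *\<^sub>R v)) \<le> B"
proof -
  define \<gamma> where "\<gamma> = (\<lambda>t. chart_inv c (x + t *\<^sub>R v))"
  have in_c: "\<gamma> t \<in> fst c" "snd c (\<gamma> t) = x + t *\<^sub>R v" if "t \<in> {0..1}" for t
    using seg[OF that] by (simp_all add: \<gamma>_def chart_inv_in chart_chart_inv)
  have cont: "continuous_map (top_of_set {a..b}) (manifold_topology M) \<gamma>" if "0 \<le> a" "b \<le> 1" for a b
  proof -
    have "continuous_map (top_of_set {a..b}) (top_of_set (snd c ` fst c)) (\<lambda>t. x + t *\<^sub>R v)"
      unfolding continuous_map_subtopology_eu
    proof (intro conjI continuous_intros Pi_I)
      show "x + t *\<^sub>R v \<in> snd c ` fst c" if "t \<in> {a..b}" for t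
        using that \<open>0 \<le> a\<close> \<open>b \<le> 1\<close> by (intro seg) simp
    qed
    from continuous_map_compose[OF this continuous_map_chart_inv[OF c]] show ?thesis
      by (simp add: \<gamma>_def o_def)
  qed
  have vd: "(snd c \<circ> \<gamma> has_vector_derivative v) (at t within {a..b})"
    if "0 \<le> a" "b \<le> 1" "t \<in> {a..b}" for a b t
  proof (rule has_vector_derivative_transform[where f = "\<lambda>t. x + t *\<^sub>R v"])
    show "((\<lambda>t. x + t *\<^sub>R v) has_vector_derivative v) (at t within {a..b})"
      by (auto intro!: derivative_eq_intros)
  qed (use that in_c in auto)
  have C1: "C1_curve M {a..b} \<gamma>" if ab: "0 \<le> a" "a < b" "b \<le> 1" for a b
    unfolding C1_curve_def
  proof (intro conjI ballI)
    show ct: "continuous_map (top_of_set {a..b}) (manifold_topology M) \<gamma>" using cont ab by simp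
    fix d assume d: "d \<in> M"
    define J where "J = {t \<in> {a..b}. \<gamma> t \<in> fst d}"
    have J: "t \<in> {a..b}" "t \<in> {0..1}" "c \<in> charts_at M (\<gamma> t)" "d \<in> charts_at M (\<gamma> t)" if "t \<in> J" for t
      using that ab c d in_c[of t] by (auto simp: J_def charts_at_iff)
    have dd: "(snd d \<circ> \<gamma> has_vector_derivative jac c d (\<gamma> t) v) (at t within {a..b})" if "t \<in> J" for t
      by (rule curve_chart_change[OF ct J(1,3,4)[OF that] vd[OF ab(1,3) J(1)[OF that]]])
    show "(snd d \<circ> \<gamma>) differentiable at t within {a..b}" if "t \<in> {t \<in> {a..b}. \<gamma> t \<in> fst d}" for t
      using dd[of t] that by (auto simp: J_def has_vector_derivative_def differentiable_def)
    have "vector_derivative (snd d \<circ> \<gamma>) (at t within {a..b}) =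
        frechet_derivative (snd d \<circ> chart_inv c) (at (x + t *\<^sub>R v)) v" if "t \<in> J" for t
      using vector_derivative_within[OF at_within_Icc_nontrivial[OF ab(2) J(1)[OF that]] dd[OF that]]
        in_c(2)[OF J(2)[OF that]] by simp
    moreover have "continuous_on J (\<lambda>t. frechet_derivative (snd d \<circ> chart_inv c) (at (x + t *\<^sub>R v)) v)"
    proof (rule continuous_on_compose2[where g = "\<lambda>y. frechet_derivative (snd d \<circ> chart_inv c) (at y) v"])
      show "continuous_on (snd c ` (fst c \<inter> fst d)) (\<lambda>y. frechet_derivative (snd d \<circ> chart_inv c) (at y) v)"
        using transition_C1[OF c d] by simp
      show "continuous_on J (\<lambda>t. x + t *\<^sub>R v)" by (intro continuous_intros)
      show "(\<lambda>t. x + t *\<^sub>R v) ` J \<subseteq> snd c ` (fst c \<inter> fst d)"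
      proof (rule image_subsetI)
        fix t assume t: "t \<in> J"
        show "x + t *\<^sub>R v \<in> snd c ` (fst c \<inter> fst d)"
          using in_c[OF J(2)[OF t]] J(4)[OF t] by (intro image_eqI[of _ _ "\<gamma> t"]) (auto simp: charts_at_iff)
      qed
    qed
    ultimately have "continuous_on J (\<lambda>t. vector_derivative (snd d \<circ> \<gamma>) (at t within {a..b}))"
      by (subst continuous_on_cong[OF refl])
    then show "continuous_on {t \<in> {a..b}. \<gamma> t \<in> fst d} (\<lambda>t. vector_derivative (snd d \<circ> \<gamma>) (at t within {a..b}))"
      by (simp add: J_def)
  qed
  have pw: "piecewise_C1_curve M \<gamma>"
    unfolding piecewise_C1_curve_def using cont[of 0 1] C1 by (intro conjI exI[of _ "{}"]) auto
  then show "piecewise_C1_curve M (\<lambda>t. chart_inv c (x + t *\<^sub>R v))"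
    by (simp add: \<gamma>_def)
  assume B: "\<And>t. t \<in> {0..1} \<Longrightarrow> sqrt (ip c (x + t *\<^sub>R v) v v) \<le> B"
  have sp: "speed \<gamma> t = sqrt (ip c (x + t *\<^sub>R v) v v)" if t: "t \<in> {0..1} - {0, 1}" for t
  proof -
    have t': "0 < t" "t < 1" "t \<in> {0..1}" using t by auto
    show ?thesis
      using speed_eq[OF cont[of 0 1] t'(1,2), of c v] vd[of 0 1 t] in_c[OF t'(3)] c t'
      by (simp add: charts_at_iff at_within_Icc_at)
  qed
  have int: "(\<lambda>t. sqrt (ip c (x + t *\<^sub>R v) v v)) integrable_on {0..1}"
    using seg by (intro integrable_continuous_real continuous_on_real_sqrt continuous_on_ip[OF c] continuous_intros) auto
  have "integral {0..1} (speed \<gamma>) = integral {0..1} (\<lambda>t. sqrt (ip c (x + t *\<^sub>R v) v v))"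
    by (rule integral_spike[of "{0, 1}"]) (use sp in auto)
  also have "\<dots> \<le> integral {0..1::real} (\<lambda>_. B)"
    by (rule Henstock_Kurzweil_Integration.integral_le[OF int]) (use B in auto)
  finally show "curve_length M g (\<lambda>t. chart_inv c (x + t *\<^sub>R v)) \<le> B"
    unfolding curve_length_eq \<gamma>_def[symmetric] by simp
qed

section \<open>Reparametrization, concatenation and connectedness\<close>

lemma affine_vector_derivative:
  fixes f :: "real \<Rightarrow> 'c::real_normed_vector"
  assumes f: "(f has_vector_derivative D) (at (m * t + k) within {a..b})"
    and im: "(\<lambda>t. m * t + k) ` {a'..b'} = {a..b}" and t: "t \<in> {a'..b'}"
    and h: "\<And>t. t \<in> {a'..b'} \<Longrightarrow> h t = f (m * t + k)"
  shows "(h has_vector_derivative m *\<^sub>R D) (at t within {a'..b'})"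
proof -
  have "((\<lambda>t. m * t + k) has_vector_derivative m) (at t within {a'..b'})"
    by (auto intro!: derivative_eq_intros)
  then have "(f \<circ> (\<lambda>t. m * t + k) has_vector_derivative m *\<^sub>R D) (at t within {a'..b'})"
    by (rule vector_diff_chain_within) (use f im in simp)
  then show ?thesis
    by (rule has_vector_derivative_transform[OF t, rotated]) (simp add: h)
qed

lemma continuous_map_affine:
  fixes \<gamma> \<eta> :: "real \<Rightarrow> 'a"
  assumes \<gamma>: "continuous_map (top_of_set {a..b}) X \<gamma>"
    and im: "(\<lambda>t. m * t + k) ` {a'..b'} = {a..b}" 
    and \<eta>: "\<And>t. t \<in> {a'..b'} \<Longrightarrow> \<eta> t = \<gamma> (m * t + k)"
  shows "continuous_map (top_of_set {a'..b'}) X \<eta>"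
proof -
  have "continuous_map (top_of_set {a'..b'}) (top_of_set {a..b}) (\<lambda>t. m * t + k)"
    unfolding continuous_map_subtopology_eu im[symmetric] by (intro conjI continuous_intros Pi_I imageI)
  from continuous_map_compose[OF this \<gamma>] show ?thesis
    by (rule continuous_map_eq) (simp add: \<eta>)
qed

text \<open>
Reversal and concatenation are made of affine changes of parameter, which act in the same way in all
the charts.
\<close>

lemma C1_curve_affine:
  assumes \<gamma>: "C1_curve M {a..b} \<gamma>" and im: "(\<lambda>t. m * t + k) ` {a'..b'} = {a..b}"
    and ab: "a' < b'" "a < b" and \<eta>: "\<And>t. t \<in> {a'..b'} \<Longrightarrow> \<eta> t = \<gamma> (m * t + k)"
  shows "C1_curve M {a'..b'} \<eta>"
  unfolding C1_curve_def
proof (intro conjI ballI)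
  have "continuous_map (top_of_set {a..b}) (manifold_topology M) \<gamma>"
    using \<gamma> by (simp add: C1_curve_def)
  then show "continuous_map (top_of_set {a'..b'}) (manifold_topology M) \<eta>"
    by (rule continuous_map_affine[OF _ im]) (rule \<eta>)
  fix d assume d: "d \<in> M"
  define D where "D = (\<lambda>t. vector_derivative (snd d \<circ> \<gamma>) (at t within {a..b}))"
  define J where "J = {t \<in> {a..b}. \<gamma> t \<in> fst d}"
  define J' where "J' = {t \<in> {a'..b'}. \<eta> t \<in> fst d}"
  have D: "(snd d \<circ> \<gamma> has_vector_derivative D t) (at t within {a..b})" if "t \<in> J" for t
    using \<gamma> that d unfolding C1_curve_def D_def J_def by (auto simp: vector_derivative_works)
  have DJ: "continuous_on J D"
    using \<gamma> d unfolding C1_curve_def D_def J_def by auto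
  have J': "t \<in> {a'..b'}" "m * t + k \<in> J" if "t \<in> J'" for t
  proof -
    show t: "t \<in> {a'..b'}" using that by (simp add: J'_def)
    have "m * t + k \<in> {a..b}" unfolding im[symmetric] using t by (rule imageI)
    then show "m * t + k \<in> J" using that \<eta>[OF t] by (simp add: J_def J'_def)
  qed
  have vd: "(snd d \<circ> \<eta> has_vector_derivative m *\<^sub>R D (m * t + k)) (at t within {a'..b'})" if "t \<in> J'" for t
    by (rule affine_vector_derivative[OF D[OF J'(2)[OF that]] im J'(1)[OF that]]) (simp add: \<eta>)
  then show "(snd d \<circ> \<eta>) differentiable at t within {a'..b'}" if "t \<in> {t \<in> {a'..b'}. \<eta> t \<in> fst d}" for t
    using that by (auto simp: J'_def has_vector_derivative_def differentiable_def)
  have "vector_derivative (snd d \<circ> \<eta>) (at t within {a'..b'}) = m *\<^sub>R D (m * t + k)" if "t \<in> J'" for t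
    by (rule vector_derivative_within[OF at_within_Icc_nontrivial[OF ab(1) J'(1)[OF that]] vd[OF that]])
  moreover have "continuous_on J' (\<lambda>t. m *\<^sub>R D (m * t + k))"
    by (intro continuous_intros continuous_on_compose2[OF DJ]) (use J'(2) in auto)
  ultimately show "continuous_on {t \<in> {a'..b'}. \<eta> t \<in> fst d} (\<lambda>t. vector_derivative (snd d \<circ> \<eta>) (at t within {a'..b'}))"
    unfolding J'_def[symmetric] by (subst continuous_on_cong[OF refl])
qed

text \<open>
Invariance of length under affine changes of parameter: the speed is multiplied by \<open>\<bar>m\<bar>\<close>, which the
substitution in the integral cancels.
\<close>

lemma speed_affine:
  assumes \<gamma>: "piecewise_C1_curve M \<gamma>" and im: "(\<lambda>t. m * t + k) ` {a'..b'} = {0..1}" and m: "m \<noteq> 0"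
    and ab: "a' < b'" and \<eta>: "\<And>t. t \<in> {a'..b'} \<Longrightarrow> \<eta> t = \<gamma> (m * t + k)"
  shows "(speed \<eta> has_integral curve_length M g \<gamma>) {a'..b'}"
proof -
  obtain S where S: "finite S" "\<And>t c. t \<in> {0<..<1} - S \<Longrightarrow> c \<in> charts_at M (\<gamma> t) \<Longrightarrow>
      \<exists>u. (snd c \<circ> \<gamma> has_vector_derivative u) (at t) \<and>
          speed \<gamma> t = sqrt (ip c (snd c (\<gamma> t)) u u)"
    using piecewise_C1_velocity[OF \<gamma>] by blast
  define \<psi> where "\<psi> = (\<lambda>s. (1 / m) *\<^sub>R s + - ((1 / m) *\<^sub>R k))"
  have inv: "\<psi> (m * t + k) = t" for t using m by (simp add: \<psi>_def field_simps)
  have inv': "m * \<psi> s + k = s" for s using m by (simp add: \<psi>_def field_simps)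
  have "\<psi> ` {0..1} = {a'..b'}"
    unfolding im[symmetric] image_image inv by simp
  moreover have "(speed \<gamma> has_integral curve_length M g \<gamma>) (cbox 0 1)"
    using piecewise_C1_speed_integrable[OF \<gamma>, of 0 1] by (simp add: curve_length_eq has_integral_iff)
  ultimately have "((\<lambda>t. speed \<gamma> (m *\<^sub>R t + k)) has_integral (1 / \<bar>m\<bar>) *\<^sub>R curve_length M g \<gamma>) {a'..b'}"
    using has_integral_affinity[of "speed \<gamma>" "curve_length M g \<gamma>" 0 1 m k] m unfolding \<psi>_def by simp
  from has_integral_mult_right[OF this, of "\<bar>m\<bar>"]
  have int: "((\<lambda>t. \<bar>m\<bar> * speed \<gamma> (m * t + k)) has_integral curve_length M g \<gamma>) {a'..b'}"
    using m by simp
  have cont': "continuous_map (top_of_set {a'..b'}) (manifold_topology M) \<eta>"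
    by (rule continuous_map_affine[OF piecewise_C1_continuous[OF \<gamma>] im \<eta>])
  show ?thesis
  proof (rule has_integral_spike_finite[OF _ _ int])
    show "finite (\<psi> ` (S \<union> {0, 1}) \<union> {a', b'})" using S(1) by simp
    fix t assume t: "t \<in> {a'..b'} - (\<psi> ` (S \<union> {0, 1}) \<union> {a', b'})"
    then have t': "a' < t" "t < b'" by auto
    define s where "s = m * t + k"
    have "\<psi> s = t" by (simp add: s_def inv)
    then have "s \<notin> S \<union> {0, 1}" using t by auto
    moreover have "s \<in> {0..1}" unfolding im[symmetric] s_def using t by blast
    ultimately have s: "s \<in> {0<..<1} - S" "s \<in> {0..1}" by auto
    obtain c where c: "c \<in> charts_at M (\<gamma> s)"
      using some_chart[OF piecewise_C1_in_points[OF \<gamma> s(2)]] by blast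
    then obtain u where u: "(snd c \<circ> \<gamma> has_vector_derivative u) (at s)"
        "speed \<gamma> s = sqrt (ip c (snd c (\<gamma> s)) u u)"
      using S(2)[OF s(1) c] by blast
    have \<eta>t: "\<eta> t = \<gamma> s" using t' by (simp add: \<eta> s_def)
    have "(snd c \<circ> \<eta> has_vector_derivative m *\<^sub>R u) (at t within {a'..b'})"
      by (rule affine_vector_derivative[OF _ im, of "snd c \<circ> \<gamma>"])
        (use u(1) t' in \<open>auto simp: \<eta> s_def intro: has_vector_derivative_at_within\<close>)
    then have "(snd c \<circ> \<eta> has_vector_derivative m *\<^sub>R u) (at t)"
      using t' by (simp add: at_within_Icc_at)
    then have "speed \<eta> t = sqrt (ip c (snd c (\<eta> t)) (m *\<^sub>R u) (m *\<^sub>R u))"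
      by (rule speed_eq[OF cont' t', rotated]) (simp add: \<eta>t c)
    also have "ip c (snd c (\<eta> t)) (m *\<^sub>R u) (m *\<^sub>R u) = m\<^sup>2 * ip c (snd c (\<gamma> s)) u u"
      using linear_scale[OF ip_linear_left[of c "snd c (\<gamma> s)"]] linear_scale[OF ip_linear_right[of c "snd c (\<gamma> s)"]] c
      by (simp add: \<eta>t charts_at_iff power2_eq_square)
    finally show "speed \<eta> t = \<bar>m\<bar> * speed \<gamma> (m * t + k)"
      using u(2) by (simp add: real_sqrt_mult s_def)
  qed
qed

lemma reverse_curve:
  assumes \<gamma>: "piecewise_C1_curve M \<gamma>"
  shows "piecewise_C1_curve M (\<lambda>t. \<gamma> (1 - t))" "curve_length M g (\<lambda>t. \<gamma> (1 - t)) = curve_length M g \<gamma>"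
proof -
  have im: "(\<lambda>t. (-1) * t + 1) ` {a..b} = {1 - b..1 - a}" for a b :: real
    by (auto simp: image_iff intro!: bexI[of _ "1 - _"])
  have im01: "(\<lambda>t. (-1) * t + 1) ` {0..1} = {0..1::real}" using im[of 0 1] by simp
  obtain S where S: "finite S" "\<forall>a b. 0 \<le> a \<longrightarrow> a < b \<longrightarrow> b \<le> 1 \<longrightarrow> {a<..<b} \<inter> S = {} \<longrightarrow> C1_curve M {a..b} \<gamma>"
    using \<gamma> unfolding piecewise_C1_curve_def by blast
  show "piecewise_C1_curve M (\<lambda>t. \<gamma> (1 - t))"
    unfolding piecewise_C1_curve_def
  proof (intro conjI exI[of _ "(\<lambda>s. 1 - s) ` S"] allI impI)
    show "continuous_map (top_of_set {0..1}) (manifold_topology M) (\<lambda>t. \<gamma> (1 - t))"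
      by (rule continuous_map_affine[OF piecewise_C1_continuous[OF \<gamma>] im01]) simp
    show "finite ((\<lambda>s. 1 - s) ` S)" using S(1) by simp
    fix a b :: real assume ab: "0 \<le> a" "a < b" "b \<le> 1" "{a<..<b} \<inter> (\<lambda>s. 1 - s) ` S = {}"
    have "{1 - b<..<1 - a} \<inter> S = {}"
    proof (rule ccontr)
      assume "{1 - b<..<1 - a} \<inter> S \<noteq> {}"
      then obtain s where "s \<in> S" "1 - b < s" "s < 1 - a" by auto
      then have "1 - s \<in> {a<..<b} \<inter> (\<lambda>s. 1 - s) ` S" by auto
      then show False using ab(4) by blast
    qed
    then have "C1_curve M {1 - b..1 - a} \<gamma>" using S(2) ab by simp
    then show "C1_curve M {a..b} (\<lambda>t. \<gamma> (1 - t))"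
      by (rule C1_curve_affine[OF _ im]) (use ab in auto)
  qed
  have "(speed (\<lambda>t. \<gamma> (1 - t)) has_integral curve_length M g \<gamma>) {0..1}"
    by (rule speed_affine[OF \<gamma> im01]) auto
  then show "curve_length M g (\<lambda>t. \<gamma> (1 - t)) = curve_length M g \<gamma>"
    by (simp add: curve_length_eq integral_unique)
qed

definition concat_curves :: "(real \<Rightarrow> 'a) \<Rightarrow> (real \<Rightarrow> 'a) \<Rightarrow> real \<Rightarrow> 'a" where
  "concat_curves \<gamma> \<delta> t = (if t \<le> 1/2 then \<gamma> (2 * t) else \<delta> (2 * t - 1))"

lemma concat_curves:
  assumes \<gamma>: "piecewise_C1_curve M \<gamma>" and \<delta>: "piecewise_C1_curve M \<delta>" and eq: "\<gamma> 1 = \<delta> 0"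
  shows "piecewise_C1_curve M (concat_curves \<gamma> \<delta>)"
    and "curve_length M g (concat_curves \<gamma> \<delta>) = curve_length M g \<gamma> + curve_length M g \<delta>"
proof -
  have im: "(\<lambda>t. 2 * t + k) ` {a..b} = {2 * a + k..2 * b + k}" for a b k :: real
    by (simp add: image_affinity_atLeastAtMost)
  have im1: "(\<lambda>t. 2 * t + 0) ` {0..1/2} = {0..1::real}" using im[of 0 0 "1/2"] by simp
  have im2: "(\<lambda>t. 2 * t + (-1)) ` {1/2..1} = {0..1::real}" using im[of "-1" "1/2" 1] by simp
  have left: "concat_curves \<gamma> \<delta> t = \<gamma> (2 * t + 0)" if "t \<le> 1/2" for t
    using that by (simp add: concat_curves_def)
  have right: "concat_curves \<gamma> \<delta> t = \<delta> (2 * t + (-1))" if "1/2 \<le> t" for t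
  proof (cases "t = 1/2")
    case True
    show ?thesis unfolding True by (simp add: concat_curves_def eq)
  next
    case False
    then show ?thesis using that by (simp add: concat_curves_def)
  qed
  obtain S where S: "finite S" "\<forall>a b. 0 \<le> a \<longrightarrow> a < b \<longrightarrow> b \<le> 1 \<longrightarrow> {a<..<b} \<inter> S = {} \<longrightarrow> C1_curve M {a..b} \<gamma>"
    using \<gamma> unfolding piecewise_C1_curve_def by blast
  obtain T where T: "finite T" "\<forall>a b. 0 \<le> a \<longrightarrow> a < b \<longrightarrow> b \<le> 1 \<longrightarrow> {a<..<b} \<inter> T = {} \<longrightarrow> C1_curve M {a..b} \<delta>"
    using \<delta> unfolding piecewise_C1_curve_def by blast
  have cl: "continuous_map (top_of_set {0..1/2}) (manifold_topology M) (concat_curves \<gamma> \<delta>)"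
    by (rule continuous_map_affine[OF piecewise_C1_continuous[OF \<gamma>] im1]) (rule left, simp)
  have cr: "continuous_map (top_of_set {1/2..1}) (manifold_topology M) (concat_curves \<gamma> \<delta>)"
    by (rule continuous_map_affine[OF piecewise_C1_continuous[OF \<delta>] im2]) (rule right, simp)
  \<comment> \<open>the corners of both curves and the junction\<close>
  define U where "U = (\<lambda>s. s / 2) ` S \<union> (\<lambda>s. (s + 1) / 2) ` T \<union> {1/2}"
  show pw: "piecewise_C1_curve M (concat_curves \<gamma> \<delta>)"
    unfolding piecewise_C1_curve_def
  proof (intro conjI exI[of _ U] allI impI)
    have "{x::real. 0 \<le> x \<and> x \<le> 1 \<and> x \<le> 1/2} = {0..1/2}" "{x::real. 0 \<le> x \<and> x \<le> 1 \<and> 1/2 \<le> x} = {1/2..1}"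
      by auto
    then have "continuous_map (top_of_set {0..1}) (manifold_topology M)
      (\<lambda>t. if t \<le> 1/2 then concat_curves \<gamma> \<delta> t else concat_curves \<gamma> \<delta> t)"
      using cl cr
      by (intro continuous_map_cases_le) (simp_all add: subtopology_subtopology Int_def conj_ac)
    then show "continuous_map (top_of_set {0..1}) (manifold_topology M) (concat_curves \<gamma> \<delta>)"
      by simp
    show "finite U" using S(1) T(1) by (simp add: U_def)
    fix a b :: real assume ab: "0 \<le> a" "a < b" "b \<le> 1" "{a<..<b} \<inter> U = {}"
    then have "\<not> (a < 1/2 \<and> 1/2 < b)" by (auto simp: U_def)
    then consider "b \<le> 1/2" | "1/2 \<le> a" by linarith
    then show "C1_curve M {a..b} (concat_curves \<gamma> \<delta>)"
    proof cases
      case 1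
      have "{2 * a<..<2 * b} \<inter> S = {}"
      proof (rule ccontr)
        assume "{2 * a<..<2 * b} \<inter> S \<noteq> {}"
        then obtain s where "s \<in> S" "2 * a < s" "s < 2 * b" by auto
        then have "s / 2 \<in> {a<..<b} \<inter> U" by (auto simp: U_def)
        then show False using ab(4) by blast
      qed
      then have "C1_curve M {2 * a + 0..2 * b + 0} \<gamma>" using S(2) ab 1 by simp
      then show ?thesis
        by (rule C1_curve_affine[OF _ im]) (use ab 1 left in auto)
    next
      case 2
      have "{2 * a - 1<..<2 * b - 1} \<inter> T = {}"
      proof (rule ccontr)
        assume "{2 * a - 1<..<2 * b - 1} \<inter> T \<noteq> {}"
        then obtain s where s: "s \<in> T" "2 * a - 1 < s" "s < 2 * b - 1" by auto
        then have "(s + 1) / 2 \<in> {a<..<b}" by auto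
        moreover have "(s + 1) / 2 \<in> U" using s by (auto simp: U_def)
        ultimately show False using ab(4) by blast
      qed
      then have "C1_curve M {2 * a + (-1)..2 * b + (-1)} \<delta>" using T(2) ab 2 by simp
      then show ?thesis
        by (rule C1_curve_affine[OF _ im]) (use ab 2 right in auto)
    qed
  qed
  have "(speed (concat_curves \<gamma> \<delta>) has_integral curve_length M g \<gamma>) {0..1/2}"
    by (rule speed_affine[OF \<gamma> im1]) (use left in auto)
  moreover have "(speed (concat_curves \<gamma> \<delta>) has_integral curve_length M g \<delta>) {1/2..1}"
    by (rule speed_affine[OF \<delta> im2]) (use right in auto)
  ultimately have "(speed (concat_curves \<gamma> \<delta>) has_integral curve_length M g \<gamma> + curve_length M g \<delta>) {0..1}"
    by (intro has_integral_combine[of 0 "1/2" 1]) auto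
  then show "curve_length M g (concat_curves \<gamma> \<delta>) = curve_length M g \<gamma> + curve_length M g \<delta>"
    by (simp add: curve_length_eq integral_unique)
qed

lemma joined_sym: "curves_between M p q \<noteq> {} \<Longrightarrow> curves_between M q p \<noteq> {}"
proof -
  assume "curves_between M p q \<noteq> {}"
  then obtain \<gamma> where "piecewise_C1_curve M \<gamma>" "\<gamma> 0 = p" "\<gamma> 1 = q" by (auto simp: curves_between_def)
  then have "(\<lambda>t. \<gamma> (1 - t)) \<in> curves_between M q p" by (simp add: curves_between_def reverse_curve)
  then show ?thesis by blast
qed

lemma joined_trans:
  "curves_between M p q \<noteq> {} \<Longrightarrow> curves_between M q r \<noteq> {} \<Longrightarrow> curves_between M p r \<noteq> {}"
proof -
  assume "curves_between M p q \<noteq> {}" "curves_between M q r \<noteq> {}"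
  then obtain \<gamma> \<delta> where "piecewise_C1_curve M \<gamma>" "\<gamma> 0 = p" "\<gamma> 1 = q"
     "piecewise_C1_curve M \<delta>" "\<delta> 0 = q" "\<delta> 1 = r" by (auto simp: curves_between_def)
  then have "concat_curves \<gamma> \<delta> \<in> curves_between M p r"
    by (simp add: curves_between_def concat_curves) (simp add: concat_curves_def)
  then show ?thesis by blast
qed

lemma joined_by_segment:
  assumes c: "c \<in> M" and p: "p \<in> fst c" and q: "q \<in> fst c"
    and seg: "closed_segment (snd c p) (snd c q) \<subseteq> snd c ` fst c"
  shows "(\<lambda>t. chart_inv c (snd c p + t *\<^sub>R (snd c q - snd c p))) \<in> curves_between M p q"
    and "\<And>t. t \<in> {0..1} \<Longrightarrow> snd c p + t *\<^sub>R (snd c q - snd c p) \<in> closed_segment (snd c p) (snd c q)"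
proof -
  show *: "snd c p + t *\<^sub>R (snd c q - snd c p) \<in> closed_segment (snd c p) (snd c q)" if "t \<in> {0..1}" for t
    using that by (auto simp: in_segment algebra_simps intro!: exI[of _ t])
  have "piecewise_C1_curve M (\<lambda>t. chart_inv c (snd c p + t *\<^sub>R (snd c q - snd c p)))"
    by (rule chart_segment(1)[OF c]) (use * seg in blast)
  then show "(\<lambda>t. chart_inv c (snd c p + t *\<^sub>R (snd c q - snd c p))) \<in> curves_between M p q"
    using p q by (simp add: curves_between_def chart_inv_chart[OF c])
qed

text \<open>
Points of a coordinate ball are joined to its centre by a straight curve, so the set of points joined
to \<open>p\<close> is open and closed.
\<close>

lemma connected_imp_joined:
  assumes conn: "connected_space (manifold_topology M)" and p: "p \<in> points M" and q: "q \<in> points M"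
  shows "curves_between M p q \<noteq> {}"
proof -
  have nbhd: "\<exists>W. openin (manifold_topology M) W \<and> x \<in> W \<and> (\<forall>y\<in>W. curves_between M x y \<noteq> {})"
    if x: "x \<in> points M" for x
  proof -
    obtain c where c: "c \<in> M" "x \<in> fst c" using x by (auto simp: points_def)
    obtain r where r: "0 < r" "ball (snd c x) r \<subseteq> snd c ` fst c"
      using openE[OF open_chart_image[OF c(1)]] c(2) by blast
    show ?thesis
    proof (intro exI[of _ "{y \<in> fst c. snd c y \<in> ball (snd c x) r}"] conjI ballI)
      show "openin (manifold_topology M) {y \<in> fst c. snd c y \<in> ball (snd c x) r}"
        by (rule openin_chart_preimage[OF c(1) open_ball])
      show "x \<in> {y \<in> fst c. snd c y \<in> ball (snd c x) r}" using c r by simp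
      fix y assume y: "y \<in> {y \<in> fst c. snd c y \<in> ball (snd c x) r}"
      have "closed_segment (snd c x) (snd c y) \<subseteq> ball (snd c x) r"
        using y r by (intro closed_segment_subset) auto
      then show "curves_between M x y \<noteq> {}"
        using joined_by_segment(1)[OF c, of y] y r by blast
    qed
  qed
  define T where "T = {y \<in> points M. curves_between M p y \<noteq> {}}"
  have "openin (manifold_topology M) T"
  proof (subst openin_subopen, intro ballI)
    fix x assume x: "x \<in> T"
    then obtain W where W: "openin (manifold_topology M) W" "x \<in> W" "\<forall>y\<in>W. curves_between M x y \<noteq> {}"
      using nbhd by (auto simp: T_def)
    moreover have "W \<subseteq> T"
      using W x joined_trans openin_manifold unfolding T_def by blast
    ultimately show "\<exists>W. openin (manifold_topology M) W \<and> x \<in> W \<and> W \<subseteq> T" by blast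
  qed
  moreover have "openin (manifold_topology M) (points M - T)"
  proof (subst openin_subopen, intro ballI)
    fix x assume x: "x \<in> points M - T"
    then obtain W where W: "openin (manifold_topology M) W" "x \<in> W" "\<forall>y\<in>W. curves_between M x y \<noteq> {}"
      using nbhd by auto
    moreover have "W \<subseteq> points M - T"
    proof
      fix y assume y: "y \<in> W"
      have "y \<notin> T"
      proof
        assume "y \<in> T"
        then have "curves_between M p y \<noteq> {}" by (simp add: T_def)
        moreover have "curves_between M y x \<noteq> {}" using W(3) y joined_sym by blast
        ultimately have "curves_between M p x \<noteq> {}" by (rule joined_trans)
        then show False using x by (simp add: T_def)
      qed
      then show "y \<in> points M - T"
        using W(1) y by (auto simp: openin_manifold)
    qed
    ultimately show "\<exists>W. openin (manifold_topology M) W \<and> x \<in> W \<and> W \<subseteq> points M - T" by blast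
  qed
  moreover have "T \<subseteq> points M" by (auto simp: T_def)
  ultimately have "T = {} \<or> T = points M"
    using conn unfolding connected_space_clopen_in closedin_def topspace_manifold by blast
  moreover have "p \<in> T"
  proof -
    obtain W where "p \<in> W" "\<forall>y\<in>W. curves_between M p y \<noteq> {}" using nbhd[OF p] by blast
    then show ?thesis using p by (auto simp: T_def)
  qed
  ultimately show ?thesis using q by (auto simp: T_def)
qed

end

section \<open>The Riemannian distance\<close>

text \<open>
The definition of the distance is only meaningful if any two points are joined by a curve.
\<close>

locale joined_metric_manifold = metric_manifold M g
  for M :: "('a, 'e::euclidean_space) chart set" and g +
  assumes joined: "p \<in> points M \<Longrightarrow> q \<in> points M \<Longrightarrow> curves_between M p q \<noteq> {}"
begin

abbreviation dist_g :: "'a \<Rightarrow> 'a \<Rightarrow> real" where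
  "dist_g \<equiv> riemannian_dist M g"

lemma curve_lengths_nonneg: "x \<in> curve_length M g ` curves_between M p q \<Longrightarrow> 0 \<le> x"
  using curve_length_nonneg by (auto simp: curves_between_def)

lemma dist_le_length: "\<gamma> \<in> curves_between M p q \<Longrightarrow> dist_g p q \<le> curve_length M g \<gamma>"
  unfolding riemannian_dist_def using curve_lengths_nonneg
  by (auto intro!: cInf_lower bdd_belowI[of _ 0])

lemma dist_lessE:
  assumes "p \<in> points M" "q \<in> points M" "dist_g p q < e"
  obtains \<gamma> where "\<gamma> \<in> curves_between M p q" "curve_length M g \<gamma> < e"
proof -
  have "Inf (curve_length M g ` curves_between M p q) < e"
    using assms joined by (simp add: riemannian_dist_def)
  then obtain x where "x \<in> curve_length M g ` curves_between M p q" "x < e"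
    using cInf_lessD[of "curve_length M g ` curves_between M p q" e] joined[OF assms(1,2)] by blast
  then show ?thesis using that by blast
qed

lemma dist_nonneg: "0 \<le> dist_g p q"
  unfolding riemannian_dist_def using curve_lengths_nonneg by (auto intro!: cInf_greatest)

lemma dist_commute: "dist_g p q = dist_g q p"
proof -
  have "curve_length M g ` curves_between M p q \<subseteq> curve_length M g ` curves_between M q p" for p q
  proof
    fix x assume "x \<in> curve_length M g ` curves_between M p q"
    then obtain \<gamma> where "piecewise_C1_curve M \<gamma>" "\<gamma> 0 = p" "\<gamma> 1 = q" "x = curve_length M g \<gamma>"
      by (auto simp: curves_between_def)
    then show "x \<in> curve_length M g ` curves_between M q p"
      using reverse_curve[of \<gamma>] by (intro image_eqI[of _ _ "\<lambda>t. \<gamma> (1 - t)"]) (auto simp: curves_between_def)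
  qed
  then have "curve_length M g ` curves_between M p q = curve_length M g ` curves_between M q p" by blast
  then show ?thesis unfolding riemannian_dist_def by (metis image_is_empty)
qed

lemma dist_triangle:
  assumes "p \<in> points M" "q \<in> points M" "r \<in> points M"
  shows "dist_g p r \<le> dist_g p q + dist_g q r"
proof (rule field_le_epsilon)
  fix e :: real assume e: "0 < e"
  obtain \<gamma> where \<gamma>: "\<gamma> \<in> curves_between M p q" "curve_length M g \<gamma> < dist_g p q + e/2"
    using dist_lessE[OF assms(1,2), of "dist_g p q + e/2"] e by auto
  obtain \<delta> where \<delta>: "\<delta> \<in> curves_between M q r" "curve_length M g \<delta> < dist_g q r + e/2"
    using dist_lessE[OF assms(2,3), of "dist_g q r + e/2"] e by auto
  have pw: "piecewise_C1_curve M \<gamma>" "piecewise_C1_curve M \<delta>" "\<gamma> 1 = \<delta> 0" "\<gamma> 0 = p" "\<delta> 1 = r"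
    using \<gamma>(1) \<delta>(1) by (auto simp: curves_between_def)
  have "concat_curves \<gamma> \<delta> \<in> curves_between M p r"
    using concat_curves(1)[OF pw(1-3)] pw by (simp add: curves_between_def concat_curves_def)
  then have "dist_g p r \<le> curve_length M g (concat_curves \<gamma> \<delta>)" by (rule dist_le_length)
  also have "\<dots> \<le> dist_g p q + dist_g q r + e"
    using concat_curves(2)[OF pw(1-3)] \<gamma>(2) \<delta>(2) by simp
  finally show "dist_g p r \<le> dist_g p q + dist_g q r + e" .
qed

text \<open>
Near \<open>p\<close> the distance from \<open>p\<close> is equivalent to the Euclidean distance in the chart.  The lower bound
holds for all points of the manifold, since a curve that leaves the coordinate ball has length at
least \<open>a r\<close>; the upper bound is the length of a straight curve.
\<close>

lemma dist_chart_comparison: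
  assumes c: "c \<in> charts_at M p"
  obtains r a b where "0 < r" "0 < a" "0 < b" "cball (snd c p) r \<subseteq> snd c ` fst c"
    "\<And>x u. x \<in> cball (snd c p) r \<Longrightarrow> a * norm u \<le> sqrt (ip c x u u)"
    "\<And>q. q \<in> points M \<Longrightarrow> dist_g p q < a * r \<Longrightarrow> q \<in> fst c"
    "\<And>q. q \<in> points M \<Longrightarrow> dist_g p q < a * r \<Longrightarrow> a * norm (snd c q - snd c p) \<le> dist_g p q"
    "\<And>q. q \<in> fst c \<Longrightarrow> snd c q \<in> cball (snd c p) r \<Longrightarrow> dist_g p q \<le> b * norm (snd c q - snd c p)"
proof -
  have cM: "c \<in> M" and pc: "p \<in> fst c" and p: "p \<in> points M"
    using c charts_at_points by (auto simp: charts_at_iff)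
  obtain r where r: "0 < r" "cball (snd c p) r \<subseteq> snd c ` fst c"
    using open_chart_image[OF cM] pc open_contains_cball by blast
  obtain a b where ab: "0 < a" "0 < b"
    "\<And>x u. x \<in> cball (snd c p) r \<Longrightarrow> a * norm u \<le> sqrt (ip c x u u)"
    "\<And>x u. x \<in> cball (snd c p) r \<Longrightarrow> sqrt (ip c x u u) \<le> b * norm u"
    using chart_norm_comparison[OF cM compact_cball r(2)] by blast
  show ?thesis
  proof (rule that[OF r(1) ab(1,2) r(2) ab(3)])
    have short: "q \<in> fst c \<and> a * norm (snd c q - snd c p) \<le> e"
      if q: "q \<in> points M" and e: "dist_g p q < e" "e < a * r" for q e
    proof -
      obtain \<gamma> where \<gamma>: "\<gamma> \<in> curves_between M p q" "curve_length M g \<gamma> < e"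
        using dist_lessE[OF p q e(1)] by blast
      then have pw: "piecewise_C1_curve M \<gamma>" "\<gamma> 0 = p" "\<gamma> 1 = q" by (auto simp: curves_between_def)
      have "curve_length M g \<gamma> < a * r" using \<gamma> e by simp
      then show ?thesis
        using short_curve_in_chart[OF cM pw(1), of r a] pw(2,3) pc r(2) ab(1,3) \<gamma>(2) by force
    qed
    show "q \<in> fst c" if q: "q \<in> points M" "dist_g p q < a * r" for q
    proof -
      obtain e where "dist_g p q < e" "e < a * r" using dense[OF q(2)] by blast
      then show ?thesis using short[OF q(1)] by blast
    qed
    show "a * norm (snd c q - snd c p) \<le> dist_g p q" if "q \<in> points M" "dist_g p q < a * r" for q
      by (rule dense_ge_bounded[OF that(2)]) (use short[OF that(1)] in blast)
    show "dist_g p q \<le> b * norm (snd c q - snd c p)" if q: "q \<in> fst c" "snd c q \<in> cball (snd c p) r" for q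
    proof -
      have seg: "closed_segment (snd c p) (snd c q) \<subseteq> cball (snd c p) r"
        using q r by (intro closed_segment_subset) auto
      then have seg': "closed_segment (snd c p) (snd c q) \<subseteq> snd c ` fst c" using r(2) by blast
      have "dist_g p q \<le> curve_length M g (\<lambda>t. chart_inv c (snd c p + t *\<^sub>R (snd c q - snd c p)))"
        by (rule dist_le_length[OF joined_by_segment(1)[OF cM pc q(1) seg']])
      also have "\<dots> \<le> b * norm (snd c q - snd c p)"
      proof (rule chart_segment(2)[OF cM])
        fix t :: real assume t: "t \<in> {0..1}"
        note * = joined_by_segment(2)[OF cM pc q(1) seg' t]
        then show "snd c p + t *\<^sub>R (snd c q - snd c p) \<in> snd c ` fst c" using seg' by blast
        show "sqrt (ip c (snd c p + t *\<^sub>R (snd c q - snd c p)) (snd c q - snd c p) (snd c q - snd c p))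
            \<le> b * norm (snd c q - snd c p)"
          using * seg by (intro ab(4)) blast
      qed
      finally show ?thesis .
    qed
  qed
qed

lemma dist_eq_0_iff:
  assumes p: "p \<in> points M" and q: "q \<in> points M"
  shows "dist_g p q = 0 \<longleftrightarrow> p = q"
proof -
  obtain c where c: "c \<in> charts_at M p" using some_chart[OF p] by blast
  then have cM: "c \<in> M" "p \<in> fst c" by (auto simp: charts_at_iff)
  show ?thesis
  proof (rule dist_chart_comparison[OF c], goal_cases)
    case (1 r a b)
    note * = 1
    show ?thesis
    proof
      assume d: "dist_g p q = 0"
      then have "dist_g p q < a * r" using *(1,2) by simp
      from *(6)[OF q this] *(7)[OF q this] have "q \<in> fst c" "snd c q = snd c p"
        using d *(2) by (auto simp: mult_le_0_iff)
      then show "p = q" using inj_onD[OF inj_chart[OF cM(1)]] cM(2) by metis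
    next
      assume "p = q"
      then show "dist_g p q = 0"
        using *(8)[of p] *(1) cM dist_nonneg[of p p] by simp
    qed
  qed
qed

lemma Metric_space_dist: "Metric_space (points M) dist_g"
  by unfold_locales (use dist_nonneg dist_commute dist_eq_0_iff dist_triangle in auto)

end

lemma (in c1_atlas) riemannian_metric_manifold:
  assumes "riemannian_metric M g" "Hausdorff_space (manifold_topology M)"
  shows "metric_manifold M g"
proof unfold_locales
  fix c i j assume "c \<in> M"
  then have "Ck_on 0 (snd c ` fst c) (\<lambda>x. g (chart_inv c x) (coord_vec M c i (chart_inv c x)) (coord_vec M c j (chart_inv c x)))"
    using assms(1) unfolding riemannian_metric_def smooth_on_def by blast
  then show "continuous_on (snd c ` fst c) (\<lambda>x. g (chart_inv c x) (coord_vec M c i (chart_inv c x)) (coord_vec M c j (chart_inv c x)))"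
    by simp
qed (use assms in \<open>unfold riemannian_metric_def, blast+\<close>)

section \<open>The atlas of the tangent bundle\<close>

locale riemannian =
  fixes N :: "('a, 'e::euclidean_space) chart set" and g
  assumes riemannian: "riemannian_manifold N g"
begin

lemma transition_Ck:
  "c \<in> N \<Longrightarrow> d \<in> N \<Longrightarrow> Ck_on k (snd c ` (fst c \<inter> fst d)) (snd d \<circ> chart_inv c)"
  using riemannian unfolding riemannian_manifold_def smooth_manifold_def smooth_atlas_def smooth_on_def
  by blast

lemma is_c1_atlas: "c1_atlas N"
proof
  show "inj_on (snd c) (fst c)" if "c \<in> N" for c
    using riemannian that unfolding riemannian_manifold_def smooth_manifold_def smooth_atlas_def by blast
  show "open (snd c ` (fst c \<inter> fst d))" if "c \<in> N" "d \<in> N" for c d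
    using riemannian that unfolding riemannian_manifold_def smooth_manifold_def smooth_atlas_def by blast
qed (rule transition_Ck)

end

sublocale riemannian \<subseteq> metric_manifold N g
  using c1_atlas.riemannian_metric_manifold[OF is_c1_atlas] riemannian
  unfolding riemannian_manifold_def smooth_manifold_def by blast

context riemannian
begin

abbreviation TN where "TN \<equiv> tangent_bundle N"
abbreviation bc where "bc \<equiv> bundle_chart N"

lemma fst_bc: "z \<in> fst (bc c) \<longleftrightarrow> fst z \<in> fst c \<and> snd z \<in> tangent_space N (fst z)"
  by (cases z) (simp add: bundle_chart_def)

lemma snd_bc: "snd (bc c) z = (snd c (fst z), snd z c)"
  by (cases z) (simp add: bundle_chart_def)

lemma TN_iff: "C \<in> TN \<longleftrightarrow> (\<exists>c\<in>N. C = bc c)"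
  by (auto simp: tangent_bundle_def)

lemma points_TN: "z \<in> points TN \<longleftrightarrow> fst z \<in> points N \<and> snd z \<in> tangent_space N (fst z)"
  unfolding points_def tangent_bundle_def UN_iff bex_simps fst_bc by blast

lemma bc_in_TN: "c \<in> N \<Longrightarrow> bc c \<in> TN"
  by (simp add: tangent_bundle_def)

lemma charts_at_TN:
  "C \<in> charts_at TN z \<longleftrightarrow> snd z \<in> tangent_space N (fst z) \<and> (\<exists>c\<in>charts_at N (fst z). C = bc c)"
proof -
  have "C \<in> charts_at TN z \<longleftrightarrow> (\<exists>c\<in>N. C = bc c \<and> z \<in> fst (bc c))"
    unfolding charts_at_def TN_iff by blast
  then show ?thesis
    unfolding fst_bc charts_at_def by blast
qed

lemma inj_bc: "c \<in> N \<Longrightarrow> inj_on (snd (bc c)) (fst (bc c))"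
proof (rule inj_onI)
  fix z w assume c: "c \<in> N" and zw: "z \<in> fst (bc c)" "w \<in> fst (bc c)" "snd (bc c) z = snd (bc c) w"
  then have p: "fst z = fst w"
    using inj_onD[OF inj_chart[OF c]] by (auto simp: fst_bc snd_bc)
  moreover have "snd z = snd w"
    by (rule tangent_space_eqI[of c "fst z"]) (use c zw p in \<open>auto simp: fst_bc snd_bc charts_at_iff\<close>)
  ultimately show "z = w" by (simp add: prod_eq_iff)
qed

text \<open>
A bundle chart takes all values in the fibre direction, since every vector is the component of some
tangent vector.
\<close>

lemma bc_image:
  assumes "c \<in> N" "W \<subseteq> fst c"
  shows "snd (bc c) ` {z \<in> fst (bc c). fst z \<in> W} = (snd c ` W) \<times> UNIV"
proof
  show "snd (bc c) ` {z \<in> fst (bc c). fst z \<in> W} \<subseteq> (snd c ` W) \<times> UNIV"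
    by (auto simp: snd_bc)
  show "(snd c ` W) \<times> UNIV \<subseteq> snd (bc c) ` {z \<in> fst (bc c). fst z \<in> W}"
  proof
    fix y assume "y \<in> (snd c ` W) \<times> (UNIV :: 'e set)"
    then obtain p u where y: "y = (snd c p, u)" "p \<in> W" by auto
    then have c: "c \<in> charts_at N p" using assms by (auto simp: charts_at_iff)
    have "y = snd (bc c) (p, coord_vec N c u p)"
      by (simp add: snd_bc y coord_vec_same[OF c])
    moreover have "(p, coord_vec N c u p) \<in> {z \<in> fst (bc c). fst z \<in> W}"
      using coord_vec_tangent[OF c] c y by (simp add: fst_bc charts_at_iff)
    ultimately show "y \<in> snd (bc c) ` {z \<in> fst (bc c). fst z \<in> W}" by blast
  qed
qed

lemma bc_image_overlap:
  assumes "c \<in> N"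
  shows "snd (bc c) ` (fst (bc c) \<inter> fst (bc d)) = (snd c ` (fst c \<inter> fst d)) \<times> UNIV"
proof -
  have "fst (bc c) \<inter> fst (bc d) = {z \<in> fst (bc c). fst z \<in> fst c \<inter> fst d}" by (auto simp: fst_bc)
  then show ?thesis using bc_image[OF assms, of "fst c \<inter> fst d"] by simp
qed

lemma chart_inv_bc:
  assumes c: "c \<in> N" and x: "x \<in> snd c ` fst c"
  shows "chart_inv (bc c) (x, u) = (chart_inv c x, coord_vec N c u (chart_inv c x))"
proof -
  have c': "c \<in> charts_at N (chart_inv c x)" by (rule chart_inv_charts_at[OF c x])
  show ?thesis
    unfolding chart_inv_def[of "bc c"]
  proof (rule inv_into_f_eq[OF inj_bc[OF c]])
    show "(chart_inv c x, coord_vec N c u (chart_inv c x)) \<in> fst (bc c)"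
      using c' coord_vec_tangent[OF c'] by (simp add: fst_bc charts_at_iff)
    show "snd (bc c) (chart_inv c x, coord_vec N c u (chart_inv c x)) = (x, u)"
      by (simp add: snd_bc coord_vec_same[OF c'] chart_chart_inv[OF x])
  qed
qed

text \<open>
The change of bundle charts is \<open>(x, u) \<mapsto> (\<tau> x, d\<tau>\<^sub>x u)\<close> for the change of charts \<open>\<tau>\<close>.
\<close>

lemma transition_bc:
  assumes c: "c \<in> N" and d: "d \<in> N" and x: "x \<in> snd c ` (fst c \<inter> fst d)"
  shows "(snd (bc d) \<circ> chart_inv (bc c)) (x, u) =
    ((snd d \<circ> chart_inv c) x, frechet_derivative (snd d \<circ> chart_inv c) (at x) u)"
proof -
  obtain p where p: "x = snd c p" "p \<in> fst c" "p \<in> fst d" using x by blast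
  then have *: "chart_inv c x = p" "x \<in> snd c ` fst c" using c by (auto simp: chart_inv_chart)
  then have "chart_inv (bc c) (x, u) = (p, coord_vec N c u p)"
    using chart_inv_bc[OF c] by simp
  moreover have "coord_vec N c u p d = frechet_derivative (snd d \<circ> chart_inv c) (at x) u"
    using p d by (simp add: coord_vec_def charts_at_iff)
  ultimately show ?thesis
    using * by (simp add: snd_bc)
qed

text \<open>
The second component \<open>d\<tau>\<^sub>x u\<close> of the transition map is linear in \<open>u\<close>; expanding \<open>u\<close> in the basis
shows that it is of class \<open>C\<^sup>1\<close> if \<open>\<tau>\<close> is of class \<open>C\<^sup>2\<close>.
\<close>

lemma c1_atlas_TN: "c1_atlas TN"
proof
  show "inj_on (snd C) (fst C)" if "C \<in> TN" for C
    using that inj_bc by (auto simp: TN_iff)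
  show "open (snd C ` (fst C \<inter> fst D))" if CD: "C \<in> TN" "D \<in> TN" for C D
  proof -
    obtain c d where cd: "c \<in> N" "d \<in> N" "C = bc c" "D = bc d"
      using CD unfolding TN_iff by blast
    show ?thesis
      unfolding cd bc_image_overlap[OF cd(1)] by (intro open_Times open_overlap cd open_UNIV)
  qed
  fix C D assume "C \<in> TN" "D \<in> TN"
  then obtain c d where cd: "c \<in> N" "d \<in> N" "C = bc c" "D = bc d" by (auto simp: TN_iff)
  define S where "S = snd c ` (fst c \<inter> fst d)"
  define f where "f = snd d \<circ> chart_inv c"
  have S: "open S" unfolding S_def by (rule open_overlap[OF cd(1,2)])
  then have SU: "open (S \<times> (UNIV :: 'e set))" by (intro open_Times) auto
  have f: "Ck_on (Suc (Suc 0)) S f" unfolding S_def f_def by (rule transition_Ck[OF cd(1,2)])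
  have pull: "Ck_on (Suc 0) (S \<times> (UNIV :: 'e set)) (h \<circ> fst)" if "Ck_on (Suc 0) S h" for h :: "'e \<Rightarrow> 'e"
    by (rule Ck_on_compose[OF SU S that Ck_on_bounded_linear_fun[OF SU bounded_linear_fst]]) auto
  have f1: "Ck_on (Suc 0) (S \<times> (UNIV :: 'e set)) (f \<circ> fst)"
    by (rule pull[OF Ck_on_SucD[OF f]])
  have f2: "Ck_on (Suc 0) (S \<times> UNIV)
      (\<lambda>y. \<Sum>b\<in>Basis. (snd y \<bullet> b) *\<^sub>R ((\<lambda>x. frechet_derivative f (at x) b) \<circ> fst) y)"
  proof (rule Ck_on_sum[OF SU], rule Ck_on_bounded_bilinear[OF SU bounded_bilinear_scaleR])
    fix b :: 'e
    show "Ck_on (Suc 0) (S \<times> (UNIV :: 'e set)) (\<lambda>y. snd y \<bullet> b)"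
      by (rule Ck_on_bounded_linear[OF SU bounded_linear_inner_left Ck_on_bounded_linear_fun[OF SU bounded_linear_snd]])
    have "Ck_on (Suc 0) S (\<lambda>x. frechet_derivative f (at x) b)"
      using f by (subst (asm) Ck_on.simps(2)) blast
    then show "Ck_on (Suc 0) (S \<times> (UNIV :: 'e set)) (\<lambda>y. ((\<lambda>x. frechet_derivative f (at x) b) \<circ> fst) y)"
      by (rule pull)
  qed
  have "Ck_on (Suc 0) (S \<times> UNIV) (\<lambda>y. ((f \<circ> fst) y,
      \<Sum>b\<in>Basis. (snd y \<bullet> b) *\<^sub>R ((\<lambda>x. frechet_derivative f (at x) b) \<circ> fst) y))"
    by (rule Ck_on_Pair[OF SU f1 f2])
  moreover have "(snd (bc d) \<circ> chart_inv (bc c)) y = ((f \<circ> fst) y,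
      \<Sum>b\<in>Basis. (snd y \<bullet> b) *\<^sub>R ((\<lambda>x. frechet_derivative f (at x) b) \<circ> fst) y)" if y: "y \<in> S \<times> UNIV" for y
  proof -
    obtain x u where xu: "y = (x, u)" "x \<in> S" using y by auto
    have lin: "frechet_derivative f (at x) u = (\<Sum>b\<in>Basis. (u \<bullet> b) *\<^sub>R frechet_derivative f (at x) b)"
      by (rule linear_expand[OF has_derivative_linear[OF Ck_on_has_derivative[OF f xu(2)]]])
    show ?thesis
      using transition_bc[OF cd(1,2), of x u] xu lin by (simp add: S_def f_def)
  qed
  ultimately have "Ck_on (Suc 0) (S \<times> UNIV) (snd (bc d) \<circ> chart_inv (bc c))"
    by (subst Ck_on_cong[OF SU])
  then show "Ck_on (Suc 0) (snd C ` (fst C \<inter> fst D)) (snd D \<circ> chart_inv C)"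
    using cd by (simp add: bc_image_overlap S_def)
qed

end

sublocale riemannian \<subseteq> T: c1_atlas "tangent_bundle N"
  by (rule c1_atlas_TN)

context riemannian
begin

lemma openin_projection_preimage:
  assumes W: "openin (manifold_topology N) W"
  shows "openin (manifold_topology TN) {z \<in> points TN. fst z \<in> W}"
  unfolding T.openin_manifold
proof (intro conjI ballI)
  fix C assume "C \<in> TN"
  then obtain c where c: "c \<in> N" "C = bc c" by (auto simp: TN_iff)
  have "fst c \<subseteq> points N" using c(1) by (auto simp: points_def)
  then have "{z \<in> points TN. fst z \<in> W} \<inter> fst (bc c) = {z \<in> fst (bc c). fst z \<in> W \<inter> fst c}"
    by (auto simp: fst_bc points_TN)
  then have "snd C ` ({z \<in> points TN. fst z \<in> W} \<inter> fst C) = snd c ` (W \<inter> fst c) \<times> UNIV"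
    using bc_image[OF c(1), of "W \<inter> fst c"] c by simp
  then show "open (snd C ` ({z \<in> points TN. fst z \<in> W} \<inter> fst C))"
    using W c by (auto simp: openin_manifold intro: open_Times)
qed blast

lemma continuous_map_projection: "continuous_map (manifold_topology TN) (manifold_topology N) fst"
  unfolding continuous_map T.topspace_manifold topspace_manifold
  using openin_projection_preimage by (auto simp: points_TN)

text \<open>
Vectors at different points are separated by preimages of open sets of \<open>N\<close>, vectors at the same point
by their components in one chart.
\<close>

lemma Hausdorff_TN: "Hausdorff_space (manifold_topology TN)"
  unfolding Hausdorff_space_def T.topspace_manifold
proof (intro allI impI, elim conjE)
  fix z w assume zw: "z \<in> points TN" "w \<in> points TN" "z \<noteq> w"
  show "\<exists>U V. openin (manifold_topology TN) U \<and> openin (manifold_topology TN) V \<and> z \<in> U \<and> w \<in> V \<and> disjnt U V"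
  proof (cases "fst z = fst w")
    case False
    then obtain U V where "openin (manifold_topology N) U" "openin (manifold_topology N) V"
        "fst z \<in> U" "fst w \<in> V" "disjnt U V"
      using Hausdorff zw unfolding Hausdorff_space_def topspace_manifold points_TN by meson
    then show ?thesis
      using zw openin_projection_preimage
      by (intro exI[of _ "{z \<in> points TN. fst z \<in> U}"] exI[of _ "{z \<in> points TN. fst z \<in> V}"])
        (auto simp: disjnt_def)
  next
    case True
    obtain c where c: "c \<in> charts_at N (fst z)" using some_chart zw points_TN by blast
    have "snd z \<noteq> snd w" using zw True by (auto simp: prod_eq_iff)
    then have "snd z c \<noteq> snd w c"
      using tangent_space_eqI[OF c, of "snd z" "snd w"] zw True by (auto simp: points_TN)
    then obtain U V where UV: "open U" "open V" "snd z c \<in> U" "snd w c \<in> V" "U \<inter> V = {}"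
      using hausdorff by metis
    have "bc c \<in> TN" using c by (auto simp: TN_iff charts_at_iff)
    then show ?thesis
      using UV zw True c
      by (intro exI[of _ "{z \<in> fst (bc c). snd (bc c) z \<in> UNIV \<times> U}"] exI[of _ "{z \<in> fst (bc c). snd (bc c) z \<in> UNIV \<times> V}"]
          conjI T.openin_chart_preimage open_Times open_UNIV)
        (auto simp: disjnt_def fst_bc snd_bc points_TN charts_at_iff)
  qed
qed

section \<open>The projection and the zero section\<close>

text \<open>
In the charts \<open>bc c\<close> and \<open>c\<close> the projection is the projection to the first factor.
\<close>

lemma projection_C1_curve:
  assumes \<Gamma>: "C1_curve TN {a..b} \<Gamma>" and ab: "a < b"
  shows "C1_curve N {a..b} (fst \<circ> \<Gamma>)"
  unfolding C1_curve_def
proof (intro conjI ballI)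
  have cont: "continuous_map (top_of_set {a..b}) (manifold_topology TN) \<Gamma>"
    using \<Gamma> by (simp add: C1_curve_def)
  show "continuous_map (top_of_set {a..b}) (manifold_topology N) (fst \<circ> \<Gamma>)"
    by (rule continuous_map_compose[OF cont continuous_map_projection])
  fix c assume c: "c \<in> N"
  have C: "bc c \<in> TN" using c by (auto simp: TN_iff)
  have pts: "\<Gamma> t \<in> points TN" if "t \<in> {a..b}" for t
    using continuous_map_image_subset_topspace[OF cont] that by (auto simp: T.topspace_manifold)
  have J: "{t \<in> {a..b}. (fst \<circ> \<Gamma>) t \<in> fst c} = {t \<in> {a..b}. \<Gamma> t \<in> fst (bc c)}"
    using pts by (auto simp: fst_bc points_TN)
  define D where "D = (\<lambda>t. vector_derivative (snd (bc c) \<circ> \<Gamma>) (at t within {a..b}))"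
  have D: "(snd (bc c) \<circ> \<Gamma> has_vector_derivative D t) (at t within {a..b})"
    if "t \<in> {t \<in> {a..b}. \<Gamma> t \<in> fst (bc c)}" for t
    using \<Gamma> C that unfolding C1_curve_def D_def by (auto simp: vector_derivative_works)
  have eq: "snd c \<circ> (fst \<circ> \<Gamma>) = (\<lambda>t. fst ((snd (bc c) \<circ> \<Gamma>) t))" by (auto simp: snd_bc)
  have vd: "(snd c \<circ> (fst \<circ> \<Gamma>) has_vector_derivative fst (D t)) (at t within {a..b})"
    if "t \<in> {t \<in> {a..b}. \<Gamma> t \<in> fst (bc c)}" for t
    unfolding eq by (rule bounded_linear.has_vector_derivative[OF bounded_linear_fst D[OF that]])
  then show "(snd c \<circ> (fst \<circ> \<Gamma>)) differentiable at t within {a..b}"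
    if "t \<in> {t \<in> {a..b}. (fst \<circ> \<Gamma>) t \<in> fst c}" for t
    using that unfolding J by (auto simp: has_vector_derivative_def differentiable_def)
  have "vector_derivative (snd c \<circ> (fst \<circ> \<Gamma>)) (at t within {a..b}) = fst (D t)"
    if "t \<in> {t \<in> {a..b}. \<Gamma> t \<in> fst (bc c)}" for t
    by (rule vector_derivative_within[OF at_within_Icc_nontrivial[OF ab] vd[OF that]]) (use that in auto)
  moreover have "continuous_on {t \<in> {a..b}. \<Gamma> t \<in> fst (bc c)} (\<lambda>t. fst (D t))"
    using \<Gamma> C unfolding C1_curve_def D_def by (intro continuous_on_fst) blast
  ultimately show "continuous_on {t \<in> {a..b}. (fst \<circ> \<Gamma>) t \<in> fst c}
      (\<lambda>t. vector_derivative (snd c \<circ> (fst \<circ> \<Gamma>)) (at t within {a..b}))"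
    unfolding J by (subst continuous_on_cong[OF refl])
qed

lemma projection_piecewise_C1:
  assumes \<Gamma>: "piecewise_C1_curve TN \<Gamma>"
  shows "piecewise_C1_curve N (fst \<circ> \<Gamma>)"
proof -
  obtain S where "finite S" "\<forall>a b. 0 \<le> a \<longrightarrow> a < b \<longrightarrow> b \<le> 1 \<longrightarrow> {a<..<b} \<inter> S = {} \<longrightarrow> C1_curve TN {a..b} \<Gamma>"
    "continuous_map (top_of_set {0..1}) (manifold_topology TN) \<Gamma>"
    using \<Gamma> unfolding piecewise_C1_curve_def by blast
  then show ?thesis
    unfolding piecewise_C1_curve_def
    by (intro conjI exI[of _ S] continuous_map_compose[OF _ continuous_map_projection] allI impI
        projection_C1_curve) simp_all
qed

lemma continuous_map_zero_section:
  "continuous_map (manifold_topology N) (manifold_topology TN) (\<lambda>p. (p, tzero))"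
  unfolding continuous_map T.topspace_manifold topspace_manifold
proof (intro conjI allI impI)
  show "(\<lambda>p. (p, tzero)) ` points N \<subseteq> points TN"
    by (auto simp: points_TN tzero_tangent)
  fix W assume W: "openin (manifold_topology TN) W"
  show "openin (manifold_topology N) {p \<in> points N. (p, tzero) \<in> W}"
    unfolding openin_manifold
  proof (intro conjI ballI)
    fix c assume c: "c \<in> N"
    define V where "V = snd (bc c) ` (W \<inter> fst (bc c))"
    have "open V" using W bc_in_TN[OF c] unfolding V_def T.openin_manifold by blast
    then have "open ((\<lambda>x. (x, 0::'e)) -` V)"
      by (intro open_vimage continuous_intros) auto
    moreover have "snd c ` ({p \<in> points N. (p, tzero) \<in> W} \<inter> fst c) = (\<lambda>x. (x, 0)) -` V"
    proof
      show "snd c ` ({p \<in> points N. (p, tzero) \<in> W} \<inter> fst c) \<subseteq> (\<lambda>x. (x, 0)) -` V"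
        unfolding V_def by (auto simp: image_iff snd_bc fst_bc tzero_tangent tzero_def[symmetric] intro!: bexI[of _ "(_, tzero)"])
          (simp_all add: tzero_def)
      show "(\<lambda>x. (x, 0)) -` V \<subseteq> snd c ` ({p \<in> points N. (p, tzero) \<in> W} \<inter> fst c)"
      proof
        fix x assume "x \<in> (\<lambda>x. (x, 0)) -` V"
        then obtain z where z: "z \<in> W" "z \<in> fst (bc c)" "snd (bc c) z = (x, 0)"
          by (auto simp: V_def)
        then have cz: "c \<in> charts_at N (fst z)" using c by (simp add: fst_bc charts_at_iff)
        have "snd z = tzero"
          by (rule tangent_space_eqI[OF cz]) (use z in \<open>auto simp: fst_bc snd_bc tzero_tangent, simp add: tzero_def\<close>)
        then have "(fst z, tzero) \<in> W" using z(1) by (metis prod.collapse)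
        then show "x \<in> snd c ` ({p \<in> points N. (p, tzero) \<in> W} \<inter> fst c)"
          using z(2,3) cz charts_at_points by (intro image_eqI[of _ _ "fst z"]) (auto simp: snd_bc fst_bc)
      qed
    qed
    ultimately show "open (snd c ` ({p \<in> points N. (p, tzero) \<in> W} \<inter> fst c))" by simp
  qed auto
qed

lemma zero_section_chart: "snd (bc c) \<circ> (\<lambda>t. (\<gamma> t, tzero)) = (\<lambda>t. ((snd c \<circ> \<gamma>) t, 0))"
  by (auto simp: snd_bc tzero_def)

lemma zero_section_has_vector_derivative:
  "(snd c \<circ> \<gamma> has_vector_derivative u) (at t within I) \<Longrightarrow> (snd (bc c) \<circ> (\<lambda>t. (\<gamma> t, tzero)) has_vector_derivative (u, 0)) (at t within I)"
  unfolding zero_section_chart by (intro has_vector_derivative_Pair has_vector_derivative_const)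

lemma zero_section_C1_curve:
  assumes \<gamma>: "C1_curve N {a..b} \<gamma>" and ab: "a < b"
  shows "C1_curve TN {a..b} (\<lambda>t. (\<gamma> t, tzero))"
  unfolding C1_curve_def
proof (intro conjI ballI)
  have cont: "continuous_map (top_of_set {a..b}) (manifold_topology N) \<gamma>"
    using \<gamma> by (simp add: C1_curve_def)
  show "continuous_map (top_of_set {a..b}) (manifold_topology TN) (\<lambda>t. (\<gamma> t, tzero))"
    using continuous_map_compose[OF cont continuous_map_zero_section] by (simp add: o_def)
  fix C assume "C \<in> TN"
  then obtain c where c: "c \<in> N" "C = bc c" by (auto simp: TN_iff)
  have J: "{t \<in> {a..b}. (\<gamma> t, tzero) \<in> fst C} = {t \<in> {a..b}. \<gamma> t \<in> fst c}"
    by (auto simp: c fst_bc tzero_tangent)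
  define D where "D = (\<lambda>t. vector_derivative (snd c \<circ> \<gamma>) (at t within {a..b}))"
  have D: "(snd c \<circ> \<gamma> has_vector_derivative D t) (at t within {a..b})"
    if "t \<in> {t \<in> {a..b}. \<gamma> t \<in> fst c}" for t
    using \<gamma> c that unfolding C1_curve_def D_def by (auto simp: vector_derivative_works)
  note vd = zero_section_has_vector_derivative[OF D]
  show "(snd C \<circ> (\<lambda>t. (\<gamma> t, tzero))) differentiable at t within {a..b}"
    if "t \<in> {t \<in> {a..b}. (\<gamma> t, tzero) \<in> fst C}" for t
  proof -
    have "t \<in> {t \<in> {a..b}. \<gamma> t \<in> fst c}" using that unfolding J .
    then show ?thesis using differentiableI_vector[OF vd] by (simp only: c(2))
  qed
  have "vector_derivative (snd C \<circ> (\<lambda>t. (\<gamma> t, tzero))) (at t within {a..b}) = (D t, 0)"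
    if "t \<in> {t \<in> {a..b}. \<gamma> t \<in> fst c}" for t
    unfolding c by (rule vector_derivative_within[OF at_within_Icc_nontrivial[OF ab] vd[OF that]]) (use that in auto)
  moreover have "continuous_on {t \<in> {a..b}. \<gamma> t \<in> fst c} (\<lambda>t. (D t, 0::'e))"
    using \<gamma> c unfolding C1_curve_def D_def by (intro continuous_on_Pair continuous_on_const) blast
  ultimately show "continuous_on {t \<in> {a..b}. (\<gamma> t, tzero) \<in> fst C}
      (\<lambda>t. vector_derivative (snd C \<circ> (\<lambda>t. (\<gamma> t, tzero))) (at t within {a..b}))"
    unfolding J by (subst continuous_on_cong[OF refl])
qed

lemma zero_section_piecewise_C1:
  assumes \<gamma>: "piecewise_C1_curve N \<gamma>"
  shows "piecewise_C1_curve TN (\<lambda>t. (\<gamma> t, tzero))"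
proof -
  obtain S where S: "finite S" "\<forall>a b. 0 \<le> a \<longrightarrow> a < b \<longrightarrow> b \<le> 1 \<longrightarrow> {a<..<b} \<inter> S = {} \<longrightarrow> C1_curve N {a..b} \<gamma>"
    "continuous_map (top_of_set {0..1}) (manifold_topology N) \<gamma>"
    using \<gamma> unfolding piecewise_C1_curve_def by blast
  moreover have "continuous_map (top_of_set {0..1}) (manifold_topology TN) (\<lambda>t. (\<gamma> t, tzero))"
    using continuous_map_compose[OF S(3) continuous_map_zero_section] by (simp add: o_def)
  ultimately show ?thesis
    unfolding piecewise_C1_curve_def
    by (intro conjI exI[of _ S] allI impI zero_section_C1_curve) simp_all
qed

section \<open>Differentials of the projection and of sections, vertical lifts\<close>

text \<open>
The change of bundle charts covers the change of charts of the base.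
\<close>

lemma fst_jac_bc:
  assumes z: "z \<in> points TN" and c: "c \<in> charts_at N (fst z)" and d: "d \<in> charts_at N (fst z)"
  shows "fst (T.jac (bc c) (bc d) z y) = jac c d (fst z) (fst y)"
proof -
  have cN: "c \<in> N" "d \<in> N" "fst z \<in> fst c" "fst z \<in> fst d" using c d by (auto simp: charts_at_iff)
  have C: "bc c \<in> charts_at TN z" "bc d \<in> charts_at TN z"
    using z c d by (auto simp: charts_at_TN points_TN)
  have 1: "((\<lambda>y. fst ((snd (bc d) \<circ> chart_inv (bc c)) y)) has_derivative (\<lambda>y. fst (T.jac (bc c) (bc d) z y))) (at (snd (bc c) z))"
    by (rule bounded_linear.has_derivative[OF bounded_linear_fst T.transition_has_derivative[OF C]])
  have "((\<lambda>y. (snd d \<circ> chart_inv c) (fst y)) has_derivative (\<lambda>y. jac c d (fst z) (fst y))) (at (snd (bc c) z))"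
  proof (rule has_derivative_compose[OF bounded_linear_imp_has_derivative[OF bounded_linear_fst]])
    show "((snd d \<circ> chart_inv c) has_derivative jac c d (fst z)) (at (fst (snd (bc c) z)))"
      unfolding snd_bc fst_conv by (rule transition_has_derivative[OF c d])
  qed
  then have "((\<lambda>y. fst ((snd (bc d) \<circ> chart_inv (bc c)) y)) has_derivative (\<lambda>y. jac c d (fst z) (fst y))) (at (snd (bc c) z))"
  proof (rule has_derivative_transform_within_open)
    show "open ((snd c ` (fst c \<inter> fst d)) \<times> (UNIV :: 'e set))"
      by (intro open_Times open_overlap cN open_UNIV)
    show "snd (bc c) z \<in> (snd c ` (fst c \<inter> fst d)) \<times> UNIV"
      using cN by (simp add: snd_bc)
    fix y assume "y \<in> (snd c ` (fst c \<inter> fst d)) \<times> (UNIV :: 'e set)"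
    then obtain x u where "y = (x, u)" "x \<in> snd c ` (fst c \<inter> fst d)" by auto
    then show "(snd d \<circ> chart_inv c) (fst y) = fst ((snd (bc d) \<circ> chart_inv (bc c)) y)"
      using transition_bc[OF cN(1,2)] by simp
  qed
  from has_derivative_unique[OF 1 this] show ?thesis by (rule fun_cong)
qed

text \<open>
The definition of the differential uses an arbitrarily chosen bundle chart; since tangent vectors
transform by transition derivatives, any other bundle chart gives the same result.
\<close>

lemma differential_projection:
  assumes z: "z \<in> points TN" and \<xi>: "\<xi> \<in> tangent_space TN z" and c: "c \<in> charts_at N (fst z)"
  shows "differential TN N fst z \<xi> = coord_vec N c (fst (\<xi> (bc c))) (fst z)"
proof
  fix d
  have "some_chart TN z \<in> charts_at TN z" by (rule T.some_chart[OF z])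
  then obtain c' where c': "c' \<in> charts_at N (fst z)" "some_chart TN z = bc c'"
    by (auto simp: charts_at_TN)
  have at: "bc a \<in> charts_at TN z" if "a \<in> charts_at N (fst z)" for a
    using z that by (auto simp: charts_at_TN points_TN)
  show "differential TN N fst z \<xi> d = coord_vec N c (fst (\<xi> (bc c))) (fst z) d"
  proof (cases "d \<in> charts_at N (fst z)")
    case True
    have eq: "snd d \<circ> fst \<circ> chart_inv (bc c') = (\<lambda>y. fst ((snd (bc d) \<circ> chart_inv (bc c')) y))"
      by (rule ext) (simp add: snd_bc)
    have "((snd d \<circ> fst \<circ> chart_inv (bc c')) has_derivative (\<lambda>y. fst (T.jac (bc c') (bc d) z y))) (at (snd (bc c') z))"
      unfolding eq
      by (rule bounded_linear.has_derivative[OF bounded_linear_fst T.transition_has_derivative[OF at[OF c'(1)] at[OF True]]])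
    from fun_cong[OF frechet_derivative_at[OF this, symmetric], of "\<xi> (bc c')"]
    have "differential TN N fst z \<xi> d = fst (T.jac (bc c') (bc d) z (\<xi> (bc c')))"
      using True by (simp add: differential_def Let_def c'(2))
    also have "\<dots> = fst (\<xi> (bc d))"
      using T.tangent_component[OF \<xi> at[OF c'(1)] at[OF True]] by simp
    also have "\<dots> = fst (T.jac (bc c) (bc d) z (\<xi> (bc c)))"
      using T.tangent_component[OF \<xi> at[OF c] at[OF True]] by simp
    also have "\<dots> = coord_vec N c (fst (\<xi> (bc c))) (fst z) d"
      unfolding fst_jac_bc[OF z c True] using True by (simp add: coord_vec_def)
    finally show ?thesis .
  next
    case False
    then show ?thesis by (simp add: differential_def Let_def coord_vec_def)
  qed
qed

text \<open>
The differential is computed in the chosen chart \<open>c\<close>, where the section is \<open>x \<mapsto> (x, F x)\<close>; the components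
in the other bundle charts follow from the chain rule.
\<close>

lemma differential_section:
  assumes p: "p \<in> points N" and c_def: "c = some_chart N p"
    and Y: "smooth_field N W Y" and W: "p \<in> W"
    and F: "\<And>q. q \<in> W \<inter> fst c \<Longrightarrow> F (snd c q) = Y q c" "(F has_derivative F') (at (snd c p))"
  shows "differential N TN (\<lambda>q. (q, Y q)) p X = coord_vec TN (bc c) (X c, F' (X c)) (p, Y p)"
proof
  fix C
  define z where "z = (p, Y p)"
  have c: "c \<in> charts_at N p" unfolding c_def by (rule some_chart[OF p])
  then have cN: "c \<in> N" "p \<in> fst c" by (auto simp: charts_at_iff)
  have Yt: "Y q \<in> tangent_space N q" if "q \<in> W" for q using Y that by (simp add: smooth_field_def)
  have Wo: "openin (manifold_topology N) W" using Y by (simp add: smooth_field_def)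
  have at: "bc c \<in> charts_at TN z" using c Yt[OF W] by (auto simp: charts_at_TN z_def)
  show "differential N TN (\<lambda>q. (q, Y q)) p X C = coord_vec TN (bc c) (X c, F' (X c)) (p, Y p) C"
  proof (cases "C \<in> charts_at TN z")
    case True
    have G: "((\<lambda>x. (x, F x)) has_derivative (\<lambda>h. (h, F' h))) (at (snd c p))"
      by (intro has_derivative_Pair has_derivative_ident F(2))
    have pt: "(snd c p, F (snd c p)) = snd (bc c) z"
      using F(1)[of p] W cN by (simp add: snd_bc z_def)
    have "((\<lambda>x. (snd C \<circ> chart_inv (bc c)) (x, F x)) has_derivative (\<lambda>h. T.jac (bc c) C z (h, F' h))) (at (snd c p))"
      by (rule has_derivative_compose[OF G]) (use T.transition_has_derivative[OF at True] in \<open>simp only: pt\<close>)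
    then have "((snd C \<circ> (\<lambda>q. (q, Y q)) \<circ> chart_inv c) has_derivative (\<lambda>h. T.jac (bc c) C z (h, F' h))) (at (snd c p))"
    proof (rule has_derivative_transform_within_open)
      show "open (snd c ` (W \<inter> fst c))" using Wo cN unfolding openin_manifold by blast
      show "snd c p \<in> snd c ` (W \<inter> fst c)" using W cN by blast
      fix x assume "x \<in> snd c ` (W \<inter> fst c)"
      then obtain q where q: "q \<in> W" "q \<in> fst c" "x = snd c q" by blast
      then have "(x, F x) = snd (bc c) (q, Y q)" using F(1)[of q] by (simp add: snd_bc)
      moreover have "(q, Y q) \<in> fst (bc c)" using q Yt by (simp add: fst_bc)
      ultimately have "chart_inv (bc c) (x, F x) = (q, Y q)"
        using T.chart_inv_chart[OF bc_in_TN[OF cN(1)]] by simp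
      then show "(snd C \<circ> chart_inv (bc c)) (x, F x) = (snd C \<circ> (\<lambda>q. (q, Y q)) \<circ> chart_inv c) x"
        using q cN by (simp add: chart_inv_chart)
    qed
    from frechet_derivative_at[OF this] show ?thesis
      using True by (simp add: differential_def Let_def c_def[symmetric] z_def coord_vec_def fun_eq_iff)
  next
    case False
    then show ?thesis by (simp add: differential_def Let_def z_def coord_vec_def)
  qed
qed

text \<open>
In a bundle chart the defining curve \<open>t \<mapsto> v + t X\<close> is a straight line in the fibre.
\<close>

lemma vertical_lift_eq:
  assumes z: "z \<in> points TN" and c: "c \<in> charts_at N (fst z)" and X: "X \<in> tangent_space N (fst z)"
  shows "vertical_lift N z X = coord_vec TN (bc c) (0, X c) z"
proof -
  define \<Gamma> where "\<Gamma> t = (fst z, tadd (snd z) (tscale t X))" for t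
  have cN: "c \<in> N" "fst z \<in> fst c" using c by (auto simp: charts_at_iff)
  have at: "bc c \<in> charts_at TN z" using z c by (auto simp: charts_at_TN points_TN)
  have \<Gamma>0: "\<Gamma> 0 = z" by (simp add: \<Gamma>_def tadd_def tscale_def)
  have v: "snd z \<in> tangent_space N (fst z)" using z by (simp add: points_TN)
  have in_c: "\<Gamma> t \<in> fst (bc c)" for t
    using cN tadd_tangent[OF v tscale_tangent[OF X]] by (simp add: \<Gamma>_def fst_bc)
  have line: "snd (bc c) (\<Gamma> t) = (snd c (fst z), snd z c + t *\<^sub>R X c)" for t
    by (simp add: snd_bc \<Gamma>_def tadd_def tscale_def)
  have "continuous_map (top_of_set UNIV) (top_of_set (snd (bc c) ` fst (bc c))) (snd (bc c) \<circ> \<Gamma>)"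
    unfolding continuous_map_subtopology_eu
  proof
    show "continuous_on UNIV (snd (bc c) \<circ> \<Gamma>)"
      unfolding o_def line by (intro continuous_intros)
  qed (use in_c in auto)
  from continuous_map_compose[OF this T.continuous_map_chart_inv[OF bc_in_TN[OF cN(1)]]]
  have cont: "continuous_map (top_of_set UNIV) (manifold_topology TN) \<Gamma>"
    by (rule continuous_map_eq) (simp add: T.chart_inv_chart[OF bc_in_TN[OF cN(1)] in_c])
  have vd: "(snd (bc c) \<circ> \<Gamma> has_vector_derivative (0, X c)) (at 0 within UNIV)"
    unfolding o_def line by (intro has_vector_derivative_Pair) (auto intro!: derivative_eq_intros)
  have "velocity TN UNIV \<Gamma> 0 = coord_vec TN (bc c) (0, X c) (\<Gamma> 0)"
    by (rule T.velocity_eq_coord_vec[OF cont _ _ _ vd]) (simp_all add: \<Gamma>0 at)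
  then have "velocity TN UNIV \<Gamma> 0 = coord_vec TN (bc c) (0, X c) z"
    by (simp only: \<Gamma>0)
  then show ?thesis
    unfolding vertical_lift_def \<Gamma>_def .
qed

section \<open>Smooth fields in coordinates\<close>

text \<open>
In another chart \<open>d\<close> the field has the components \<open>d\<tau>\<^sub>y (F y)\<close> at \<open>y = \<tau>\<inverse> x\<close>, where \<open>\<tau>\<close> is the
transition map from \<open>c\<close> to \<open>d\<close>.
\<close>

lemma smooth_coord_field:
  assumes c: "c \<in> N" and W: "openin (manifold_topology N) W" "W \<subseteq> fst c"
    and F: "\<And>k. Ck_on k (snd c ` W) F"
  shows "smooth_field N W (\<lambda>q. coord_vec N c (F (snd c q)) q)"
  unfolding smooth_field_def smooth_on_def
proof (intro conjI ballI allI)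
  show "openin (manifold_topology N) W" by (rule W)
  show "coord_vec N c (F (snd c p)) p \<in> tangent_space N p" if "p \<in> W" for p
    using that c W by (intro coord_vec_tangent) (auto simp: charts_at_iff)
  fix d k assume d: "d \<in> N"
  have Wd: "openin (manifold_topology N) (W \<inter> fst d)"
    by (intro openin_Int W openin_domain d)
  have "W \<inter> fst d \<inter> fst c = W \<inter> fst d" using W by blast
  then have open_c: "open (snd c ` (W \<inter> fst d))"
    using Wd c unfolding openin_manifold by metis
  have open_d: "open (snd d ` (W \<inter> fst d))"
    using W d unfolding openin_manifold by blast
  define H where "H y = frechet_derivative (snd d \<circ> chart_inv c) (at y) (F y)" for y
  have H: "Ck_on k (snd c ` (W \<inter> fst d)) H"
    unfolding H_def
    by (rule Ck_on_derivative_apply[OF open_c Ck_on_subset[OF transition_Ck[OF c d]] Ck_on_subset[OF F]])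
      (use W in auto)
  have img: "(snd c \<circ> chart_inv d) ` (snd d ` (W \<inter> fst d)) \<subseteq> snd c ` (W \<inter> fst d)"
    using chart_inv_chart[OF d] by auto
  have "Ck_on k (snd d ` (W \<inter> fst d)) (H \<circ> (snd c \<circ> chart_inv d))"
    by (rule Ck_on_compose[OF open_d open_c H Ck_on_subset[OF transition_Ck[OF d c]] img]) (use W in auto)
  moreover have "coord_vec N c (F (snd c (chart_inv d x))) (chart_inv d x) d = (H \<circ> (snd c \<circ> chart_inv d)) x"
    if x: "x \<in> snd d ` (W \<inter> fst d)" for x
  proof -
    obtain q where "q \<in> W" "q \<in> fst d" "x = snd d q" using x by blast
    then show ?thesis
      using d by (simp add: chart_inv_chart[OF d] coord_vec_def charts_at_iff H_def)
  qed
  ultimately show "Ck_on k (snd d ` (W \<inter> fst d)) (\<lambda>x. coord_vec N c (F (snd c (chart_inv d x))) (chart_inv d x) d)"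
    by (subst Ck_on_cong[OF open_d])
qed

lemma smooth_coord_function:
  assumes c: "c \<in> N" and W: "openin (manifold_topology N) W" "W \<subseteq> fst c"
    and F: "\<And>k. Ck_on k (snd c ` W) F"
  shows "smooth_function N W (\<lambda>q. F (snd c q))"
  unfolding smooth_function_def smooth_on_def
proof (intro conjI ballI allI)
  show "openin (manifold_topology N) W" by (rule W)
  fix d k assume d: "d \<in> N"
  have open_d: "open (snd d ` (W \<inter> fst d))"
    using W d unfolding openin_manifold by blast
  have "W \<inter> fst c = W" using W by blast
  then have open_c: "open (snd c ` W)"
    using W c unfolding openin_manifold by metis
  have img: "(snd c \<circ> chart_inv d) ` (snd d ` (W \<inter> fst d)) \<subseteq> snd c ` W"
    using chart_inv_chart[OF d] by auto
  have "Ck_on k (snd d ` (W \<inter> fst d)) (F \<circ> (snd c \<circ> chart_inv d))"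
    by (rule Ck_on_compose[OF open_d open_c F Ck_on_subset[OF transition_Ck[OF d c]] img]) (use W in auto)
  then show "Ck_on k (snd d ` (W \<inter> fst d)) ((\<lambda>q. F (snd c q)) \<circ> chart_inv d)"
    by (simp add: o_def)
qed

lemma smooth_field_subset:
  assumes Y: "smooth_field N W Y" and V: "openin (manifold_topology N) V" "V \<subseteq> W"
  shows "smooth_field N V Y"
proof -
  have "Ck_on k (snd c ` (V \<inter> fst c)) (\<lambda>x. Y (chart_inv c x) c)" if "c \<in> N" for k c
    by (rule Ck_on_subset[of k "snd c ` (W \<inter> fst c)"])
      (use Y V that in \<open>auto simp: smooth_field_def smooth_on_def\<close>)
  then show ?thesis using Y V unfolding smooth_field_def smooth_on_def by blast
qed

lemma smooth_field_cong:
  assumes Y: "smooth_field N W Y" and eq: "\<And>q. q \<in> W \<Longrightarrow> Z q = Y q"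
  shows "smooth_field N W Z"
proof -
  have "Ck_on k (snd c ` (W \<inter> fst c)) (\<lambda>x. Z (chart_inv c x) c)" if c: "c \<in> N" for c k
  proof -
    have "open (snd c ` (W \<inter> fst c))" using Y c unfolding smooth_field_def openin_manifold by blast
    moreover have "Z (chart_inv c x) c = Y (chart_inv c x) c" if "x \<in> snd c ` (W \<inter> fst c)" for x
      using that eq by (auto simp: chart_inv_chart[OF c])
    moreover have "Ck_on k (snd c ` (W \<inter> fst c)) (\<lambda>x. Y (chart_inv c x) c)"
      using Y c unfolding smooth_field_def smooth_on_def by blast
    ultimately show ?thesis by (subst Ck_on_cong)
  qed
  then show ?thesis
    using Y eq by (simp add: smooth_field_def smooth_on_def)
qed

lemma smooth_field_vanishing:
  assumes W: "openin (manifold_topology N) W" and Z: "\<And>q. q \<in> W \<Longrightarrow> Z q = tzero"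
  shows "smooth_field N W Z"
proof (rule smooth_field_cong[OF _ Z])
  show "smooth_field N W (\<lambda>q. tzero)"
    using W by (simp add: smooth_field_def smooth_on_def tzero_tangent Ck_on_const)
qed

end

section \<open>The connection in coordinates\<close>

locale riemannian_connection = riemannian N g
  for N :: "('a, 'e::euclidean_space) chart set" and g +
  fixes D :: "('a, 'e) connection"
  assumes levi_civita: "levi_civita N g D"
begin

lemma affine: "affine_connection N D"
  using levi_civita by (simp add: levi_civita_def)

context
  fixes W Y p X
  assumes Y: "smooth_field N W Y" and p: "p \<in> W" and X: "X \<in> tangent_space N p"
begin

lemma D_tangent: "D p X Y \<in> tangent_space N p"
  using affine Y p X unfolding affine_connection_def by meson

lemma D_add_vector: "X' \<in> tangent_space N p \<Longrightarrow> D p (tadd X X') Y = tadd (D p X Y) (D p X' Y)"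
  using affine Y p X unfolding affine_connection_def by meson

lemma D_scale_vector: "D p (tscale a X) Y = tscale a (D p X Y)"
  using affine Y p X unfolding affine_connection_def by meson

lemma D_add_field: "smooth_field N W Y' \<Longrightarrow> D p X (\<lambda>q. tadd (Y q) (Y' q)) = tadd (D p X Y) (D p X Y')"
  using affine Y p X unfolding affine_connection_def by meson

lemma D_leibniz: "smooth_function N W f \<Longrightarrow>
    D p X (\<lambda>q. tscale (f q) (Y q)) = tadd (tscale (dir_deriv N p X f) (Y p)) (tscale (f p) (D p X Y))"
  using affine Y p X unfolding affine_connection_def by meson

end

text \<open>
A field that vanishes on \<open>W\<close> is unchanged when it is multiplied by a function that is \<open>0\<close> on \<open>W\<close> and
\<open>1\<close> elsewhere, and this function counts as smooth on \<open>W\<close>.  The Leibniz rule then gives \<open>D Z = 0\<close>.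
\<close>

lemma D_vanishing:
  assumes W: "openin (manifold_topology N) W" and Z: "\<And>q. q \<in> W \<Longrightarrow> Z q = tzero"
    and p: "p \<in> W" and X: "X \<in> tangent_space N p"
  shows "D p X Z = tzero"
proof -
  define f where "f q = (if q \<in> W then 0 else (1::real))" for q
  have sm: "smooth_field N W Z" by (rule smooth_field_vanishing[OF W Z])
  have "smooth_function N W f"
    unfolding smooth_function_def smooth_on_def
  proof (intro conjI ballI allI)
    fix c k assume c: "c \<in> N"
    have op: "open (snd c ` (W \<inter> fst c))" using W c unfolding openin_manifold by blast
    have "(f \<circ> chart_inv c) x = 0" if "x \<in> snd c ` (W \<inter> fst c)" for x
      using that by (auto simp: chart_inv_chart[OF c] f_def)
    then show "Ck_on k (snd c ` (W \<inter> fst c)) (f \<circ> chart_inv c)"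
      using Ck_on_const[of k "snd c ` (W \<inter> fst c)" "0::real"] by (subst Ck_on_cong[OF op])
  qed (rule W)
  from D_leibniz[OF sm p X this]
  have "D p X (\<lambda>q. tscale (f q) (Z q)) = tzero"
    using p by (simp add: Z[OF p] f_def tadd_def tscale_def tzero_def)
  moreover have "(\<lambda>q. tscale (f q) (Z q)) = Z"
    by (rule ext) (simp add: f_def Z tscale_def tzero_def)
  ultimately show ?thesis by simp
qed

text \<open>
The connection acts on total functions, so it has to be shown that values outside of \<open>W\<close> are
irrelevant; it suffices to consider the difference of the two fields.
\<close>

lemma D_local:
  assumes Y: "smooth_field N W Y" and Y': "smooth_field N W Y'" and eq: "\<And>q. q \<in> W \<Longrightarrow> Y q = Y' q"
    and p: "p \<in> W" and X: "X \<in> tangent_space N p"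
  shows "D p X Y = D p X Y'"
proof -
  have W: "openin (manifold_topology N) W" using Y by (simp add: smooth_field_def)
  define Z where "Z q = tadd (Y q) (tscale (-1) (Y' q))" for q
  have Z: "Z q = tzero" if "q \<in> W" for q
    using eq[OF that] by (simp add: Z_def tadd_def tscale_def tzero_def)
  have "(\<lambda>q. tadd (Y' q) (Z q)) = Y"
    by (simp add: Z_def tadd_def tscale_def)
  moreover have "D p X (\<lambda>q. tadd (Y' q) (Z q)) = tadd (D p X Y') (D p X Z)"
    by (rule D_add_field[OF Y' p X smooth_field_vanishing[OF W Z]])
  moreover have "D p X Z = tzero" by (rule D_vanishing[OF W Z p X])
  ultimately show ?thesis by (simp add: tadd_def tzero_def)
qed

text \<open>
The Christoffel symbols at \<open>p\<close> in the chosen chart.  All computations at \<open>p\<close> are done in this chart,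
because \<open>dir_deriv\<close> and \<open>differential\<close> are defined with it.
\<close>

definition christoffel :: "'a \<Rightarrow> 'e \<Rightarrow> 'e \<Rightarrow> 'e" where
  "christoffel p h u = (let c = some_chart N p in D p (coord_vec N c h p) (coord_vec N c u) c)"

context
  fixes p c
  assumes p: "p \<in> points N" and c_def: "c = some_chart N p"
begin

lemma some_chart_around: "c \<in> charts_at N p"
  unfolding c_def by (rule some_chart[OF p])

lemma some_chart_in_atlas: "c \<in> N" and some_chart_contains: "p \<in> fst c"
  using some_chart_around by (auto simp: charts_at_iff)

text \<open>
The Leibniz rule, applied to \<open>F = \<Sum> F\<^sub>b b\<close> one basis vector at a time.  The Christoffel symbols are
not yet known to be linear in the second argument, which is why they only occur at basis vectors.
\<close>

lemma coord_field_derivative_aux: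
  assumes W: "openin (manifold_topology N) W" "W \<subseteq> fst c" "p \<in> W"
    and F: "\<And>k. Ck_on k (snd c ` W) F" and B: "finite B"
  shows "D p (coord_vec N c h p) (\<lambda>q. coord_vec N c (\<Sum>b\<in>B. (F (snd c q) \<bullet> b) *\<^sub>R b) q) c =
    (\<Sum>b\<in>B. (frechet_derivative F (at (snd c p)) h \<bullet> b) *\<^sub>R b) + (\<Sum>b\<in>B. (F (snd c p) \<bullet> b) *\<^sub>R christoffel p h b)"
  using B
proof (induction B rule: finite_induct)
  case empty
  have "D p (coord_vec N c h p) (\<lambda>q. coord_vec N c 0 q) = tzero"
    by (rule D_vanishing[OF W(1) coord_vec_zero W(3) coord_vec_tangent[OF some_chart_around]])
      (use W(2) some_chart_in_atlas in \<open>auto simp: charts_at_iff\<close>)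
  then show ?case by (simp add: tzero_def)
next
  case (insert b B)
  have "snd c ` (W \<inter> fst c) = snd c ` W" using W by (simp add: Int_absorb2)
  then have op: "open (snd c ` W)" using W(1) some_chart_in_atlas unfolding openin_manifold by metis
  define X where "X = coord_vec N c h p"
  have X: "X \<in> tangent_space N p" "X c = h"
    by (simp_all add: X_def coord_vec_tangent[OF some_chart_around] coord_vec_same[OF some_chart_around])
  define f where "f = (\<lambda>q. F (snd c q) \<bullet> b)"
  define Y where "Y = (\<lambda>q. coord_vec N c b q)"
  define R where "R = (\<lambda>q. coord_vec N c (\<Sum>b\<in>B. (F (snd c q) \<bullet> b) *\<^sub>R b) q)"
  have inner: "Ck_on k (snd c ` W) (\<lambda>x. F x \<bullet> b)" for k b
    by (rule Ck_on_bounded_linear[OF op bounded_linear_inner_left F])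
  have comp: "Ck_on k (snd c ` W) (\<lambda>x. (F x \<bullet> b) *\<^sub>R b)" for k b
    by (rule Ck_on_bounded_linear[OF op bounded_linear_scaleR_left inner])
  have f: "smooth_function N W f"
    unfolding f_def by (rule smooth_coord_function[OF some_chart_in_atlas W(1,2) inner])
  have Y: "smooth_field N W Y"
    unfolding Y_def by (rule smooth_coord_field[OF some_chart_in_atlas W(1,2) Ck_on_const])
  have R: "smooth_field N W R"
    unfolding R_def by (rule smooth_coord_field[OF some_chart_in_atlas W(1,2)]) (rule Ck_on_sum[OF op comp])
  have fY_eq: "coord_vec N c ((F (snd c q) \<bullet> b) *\<^sub>R b) q = tscale (f q) (Y q)" if "q \<in> W" for q
    unfolding f_def Y_def by (rule coord_vec_scaleR) (use that W(2) some_chart_in_atlas in \<open>auto simp: charts_at_iff\<close>)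
  have fY0: "smooth_field N W (\<lambda>q. coord_vec N c ((F (snd c q) \<bullet> b) *\<^sub>R b) q)"
    by (rule smooth_coord_field[OF some_chart_in_atlas W(1,2) comp])
  have fY: "smooth_field N W (\<lambda>q. tscale (f q) (Y q))"
    by (rule smooth_field_cong[OF fY0 fY_eq[symmetric]])
  have whole: "smooth_field N W (\<lambda>q. coord_vec N c (\<Sum>b\<in>insert b B. (F (snd c q) \<bullet> b) *\<^sub>R b) q)"
    by (rule smooth_coord_field[OF some_chart_in_atlas W(1,2)]) (rule Ck_on_sum[OF op comp])
  have sum_eq: "coord_vec N c (\<Sum>b\<in>insert b B. (F (snd c q) \<bullet> b) *\<^sub>R b) q = tadd (tscale (f q) (Y q)) (R q)"
    if q: "q \<in> W" for q
  proof -
    have cq: "c \<in> charts_at N q" using q W(2) some_chart_in_atlas by (auto simp: charts_at_iff)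
    show ?thesis
      unfolding sum.insert[OF insert.hyps] coord_vec_add[OF cq] fY_eq[OF q] R_def ..
  qed
  have "D p X (\<lambda>q. coord_vec N c (\<Sum>b\<in>insert b B. (F (snd c q) \<bullet> b) *\<^sub>R b) q) =
      D p X (\<lambda>q. tadd (tscale (f q) (Y q)) (R q))"
    by (rule D_local[OF whole smooth_field_cong[OF whole sum_eq[symmetric]] sum_eq W(3) X(1)])
  also have "\<dots> = tadd (D p X (\<lambda>q. tscale (f q) (Y q))) (D p X R)"
    by (rule D_add_field[OF fY W(3) X(1) R])
  also have "D p X (\<lambda>q. tscale (f q) (Y q)) = tadd (tscale (dir_deriv N p X f) (Y p)) (tscale (f p) (D p X Y))"
    by (rule D_leibniz[OF Y W(3) X(1) f])
  finally have "D p X (\<lambda>q. coord_vec N c (\<Sum>b\<in>insert b B. (F (snd c q) \<bullet> b) *\<^sub>R b) q) c =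
      dir_deriv N p X f *\<^sub>R b + f p *\<^sub>R D p X Y c + D p X R c"
    by (simp add: tadd_def tscale_def Y_def coord_vec_same[OF some_chart_around])
  moreover have "dir_deriv N p X f = frechet_derivative F (at (snd c p)) h \<bullet> b"
  proof -
    have x0: "snd c p \<in> snd c ` W" using W(3) by blast
    have F': "(F has_derivative frechet_derivative F (at (snd c p))) (at (snd c p))"
      by (rule Ck_on_has_derivative[OF F x0])
    have "((\<lambda>x. F x \<bullet> b) has_derivative (\<lambda>v. frechet_derivative F (at (snd c p)) v \<bullet> b)) (at (snd c p))"
      by (rule bounded_linear.has_derivative[OF bounded_linear_inner_left F'])
    then have "((f \<circ> chart_inv c) has_derivative (\<lambda>v. frechet_derivative F (at (snd c p)) v \<bullet> b)) (at (snd c p))"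
      by (rule has_derivative_transform_within_open[OF _ op x0])
        (use W(2) in \<open>auto simp: f_def chart_inv_chart[OF some_chart_in_atlas] subset_iff\<close>)
    then have "frechet_derivative (f \<circ> chart_inv c) (at (snd c p)) = (\<lambda>v. frechet_derivative F (at (snd c p)) v \<bullet> b)"
      using frechet_derivative_at by metis
    then show ?thesis by (simp add: dir_deriv_def c_def[symmetric] X(2))
  qed
  moreover have "D p X Y c = christoffel p h b"
    unfolding christoffel_def c_def[symmetric] Let_def X_def Y_def ..
  ultimately show ?case
    using insert.IH insert.hyps unfolding X_def[symmetric] R_def[symmetric]
    by (simp add: f_def)
qed

text \<open>
The preceding lemma for constant \<open>F\<close>.
\<close>

lemma christoffel_expand: "christoffel p h u = (\<Sum>b\<in>Basis. (u \<bullet> b) *\<^sub>R christoffel p h b)"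
  using coord_field_derivative_aux[OF openin_domain[OF some_chart_in_atlas] subset_refl some_chart_contains, of "\<lambda>_. u" Basis h]
  by (simp add: Ck_on_const christoffel_def c_def[symmetric] Let_def euclidean_representation)

lemma coord_field_derivative:
  assumes W: "openin (manifold_topology N) W" "W \<subseteq> fst c" "p \<in> W"
    and F: "\<And>k. Ck_on k (snd c ` W) F"
  shows "D p (coord_vec N c h p) (\<lambda>q. coord_vec N c (F (snd c q)) q) c =
    frechet_derivative F (at (snd c p)) h + christoffel p h (F (snd c p))"
  using coord_field_derivative_aux[OF W F finite_Basis, of h] christoffel_expand[of h "F (snd c p)", symmetric]
  by (simp add: euclidean_representation)

lemma christoffel_zero_right: "christoffel p h 0 = 0"
  by (subst christoffel_expand) simp

lemma linear_christoffel_left: "linear (\<lambda>h. christoffel p h u)"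
proof -
  have E: "smooth_field N (fst c) (coord_vec N c u)"
    using smooth_coord_field[OF some_chart_in_atlas openin_domain[OF some_chart_in_atlas] subset_refl Ck_on_const, of u] by simp
  note X = coord_vec_tangent[OF some_chart_around]
  show ?thesis
  proof (rule linearI)
    show "christoffel p (h + k) u = christoffel p h u + christoffel p k u" for h k
      unfolding christoffel_def c_def[symmetric] Let_def coord_vec_add[OF some_chart_around] D_add_vector[OF E some_chart_contains X X]
      by (simp only: tadd_def)
    show "christoffel p (r *\<^sub>R h) u = r *\<^sub>R christoffel p h u" for r h
      unfolding christoffel_def c_def[symmetric] Let_def coord_vec_scaleR[OF some_chart_around] D_scale_vector[OF E some_chart_contains X]
      by (simp only: tscale_def)
  qed
qed

end

section \<open>Horizontal lifts\<close>

text \<open>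
By the coordinate formula, a field \<open>Y\<close> with \<open>Y(p) = v\<close> and \<open>D\<^sub>X Y = 0\<close> has \<open>dY(X) = - \<Gamma>(X, v)\<close>, whatever
\<open>Y\<close> is.  So the vectors of the horizontal space are determined by their projections, and such a field
exists, namely one with affine components.
\<close>

lemma horizontal_lift_eq:
  assumes z: "z \<in> points TN" and X: "X \<in> tangent_space N (fst z)" and c_def: "c = some_chart N (fst z)"
  shows "horizontal_lift N D z X = coord_vec TN (bc c) (X c, - christoffel (fst z) (X c) (snd z c)) z"
proof -
  define p v where "p = fst z" and "v = snd z"
  have zpv: "z = (p, v)" by (simp add: p_def v_def)
  have p: "p \<in> points N" and v: "v \<in> tangent_space N p" using z by (simp_all add: points_TN p_def v_def)
  have cp: "c = some_chart N p" by (simp add: c_def p_def)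
  note c = some_chart_around[OF p cp] and cN = some_chart_in_atlas[OF p cp] and pc = some_chart_contains[OF p cp]
  have at: "bc c \<in> charts_at TN z" using z c by (auto simp: charts_at_TN points_TN p_def)
  have X: "X \<in> tangent_space N p" using X by (simp add: p_def)
  have XX: "coord_vec N c (X c) p = X" by (rule coord_vec_component[OF c X])
  define \<xi> where "\<xi> = coord_vec TN (bc c) (X c, - christoffel p (X c) (v c)) z"
  have \<xi>T: "\<xi> \<in> tangent_space TN z" unfolding \<xi>_def by (rule T.coord_vec_tangent[OF at])
  have proj: "differential TN N fst z (coord_vec TN (bc c) (h, k) z) = coord_vec N c h p" for h k
    using differential_projection[OF z T.coord_vec_tangent[OF at], of c "(h, k)"] c
    by (simp add: T.coord_vec_same[OF at] p_def)
  have "(THE \<xi>. \<xi> \<in> horizontal_space N D z \<and> differential TN N fst z \<xi> = X) = \<xi>"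
  proof (rule the_equality, rule conjI)
    show "differential TN N fst z \<xi> = X"
      unfolding \<xi>_def proj by (rule XX)
    \<comment> \<open>affine components with the prescribed value and derivative at \<open>p\<close>\<close>
    define F where "F x = v c - christoffel p (x - snd c p) (v c)" for x
    define Y where "Y = (\<lambda>q. coord_vec N c (F (snd c q)) q)"
    have lin: "linear (\<lambda>h. christoffel p h (v c))" by (rule linear_christoffel_left[OF p cp])
    have F_eq: "F x = - christoffel p x (v c) + (v c + christoffel p (snd c p) (v c))" for x
      by (simp add: F_def linear_diff[OF lin])
    have bl: "bounded_linear (\<lambda>h. - christoffel p h (v c))"
      using lin by (intro bounded_linear_minus) (simp add: linear_conv_bounded_linear)
    have F': "(F has_derivative (\<lambda>h. - christoffel p h (v c))) (at x)" for x
      unfolding F_eq[abs_def] by (intro has_derivative_add_const bounded_linear_imp_has_derivative[OF bl])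
    have F0: "F (snd c p) = v c" by (simp add: F_def linear_0[OF lin])
    have op: "open (snd c ` fst c)" by (rule open_chart_image[OF cN])
    have FCk: "Ck_on k (snd c ` fst c) F" for k
      unfolding F_eq[abs_def] by (intro Ck_on_add[OF op] Ck_on_const Ck_on_bounded_linear_fun[OF op bl])
    have Y: "smooth_field N (fst c) Y"
      unfolding Y_def by (rule smooth_coord_field[OF cN openin_domain[OF cN] subset_refl FCk])
    have Yp: "Y p = v" unfolding Y_def F0 by (rule coord_vec_component[OF c v])
    have "D p X Y c = 0"
      using coord_field_derivative[OF p cp openin_domain[OF cN] subset_refl pc FCk, of "X c"]
      unfolding XX Y_def[symmetric] F0 frechet_derivative_at[OF F', symmetric] by simp
    then have DY: "D p X Y = tzero"
      by (intro tangent_space_eqI[OF c D_tangent[OF Y pc X] tzero_tangent]) (simp add: tzero_def)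
    have "differential N TN (\<lambda>q. (q, Y q)) p X = coord_vec TN (bc c) (X c, - christoffel p (X c) (v c)) (p, Y p)"
    proof (rule differential_section[OF p cp Y pc _ F'])
      show "F (snd c q) = Y q c" if "q \<in> fst c \<inter> fst c" for q
        unfolding Y_def using that cN by (simp add: coord_vec_same charts_at_iff)
    qed
    then have "\<xi> = differential N TN (\<lambda>q. (q, Y q)) (fst z) X"
      by (simp add: \<xi>_def Yp zpv)
    then show "\<xi> \<in> horizontal_space N D z"
      unfolding horizontal_space_def mem_Collect_eq
      using X Y pc Yp DY by (intro exI[of _ X] exI[of _ Y] exI[of _ "fst c"]) (simp add: p_def v_def)
  next
    fix \<zeta> assume "\<zeta> \<in> horizontal_space N D z \<and> differential TN N fst z \<zeta> = X"
    then obtain X' Y W where \<zeta>: "\<zeta> = differential N TN (\<lambda>q. (q, Y q)) p X'" "X' \<in> tangent_space N p"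
      "smooth_field N W Y" "p \<in> W" "Y p = v" "D p X' Y = tzero" and dX: "differential TN N fst z \<zeta> = X"
      unfolding horizontal_space_def by (auto simp: p_def v_def)
    define V where "V = W \<inter> fst c"
    define F where "F = (\<lambda>x. Y (chart_inv c x) c)"
    have V: "openin (manifold_topology N) V" "V \<subseteq> fst c" "V \<subseteq> W" "p \<in> V"
      using \<zeta>(3,4) pc openin_domain[OF cN] by (auto simp: V_def smooth_field_def)
    have F: "Ck_on k (snd c ` V) F" for k
      using \<zeta>(3) cN unfolding F_def V_def smooth_field_def smooth_on_def by blast
    have F': "(F has_derivative frechet_derivative F (at (snd c p))) (at (snd c p))"
      by (rule Ck_on_has_derivative[OF F]) (use V in blast)
    have FY: "F (snd c q) = Y q c" if "q \<in> fst c" for q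
      by (simp add: F_def chart_inv_chart[OF cN that])
    have \<zeta>': "\<zeta> = coord_vec TN (bc c) (X' c, frechet_derivative F (at (snd c p)) (X' c)) z"
      unfolding \<zeta>(1) zpv \<zeta>(5)[symmetric]
      by (rule differential_section[OF p cp \<zeta>(3,4) _ F']) (simp add: FY)
    have "coord_vec N c (X' c) p = X"
      using dX unfolding \<zeta>' proj .
    then have X': "X' = X"
      using coord_vec_component[OF c \<zeta>(2)] by simp
    have "D p X Y = D p X (\<lambda>q. coord_vec N c (F (snd c q)) q)"
    proof (rule D_local[OF smooth_field_subset[OF \<zeta>(3) V(1,3)] smooth_coord_field[OF cN V(1,2) F] _ V(4) X])
      fix q assume q: "q \<in> V"
      then have "c \<in> charts_at N q" "Y q \<in> tangent_space N q"
        using V cN \<zeta>(3) by (auto simp: charts_at_iff smooth_field_def)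
      then show "Y q = coord_vec N c (F (snd c q)) q"
        using coord_vec_component[of c q "Y q"] FY[of q] q V(2) by auto
    qed
    then have "D p X (\<lambda>q. coord_vec N c (F (snd c q)) q) c = 0"
      using \<zeta>(6) by (simp add: X' tzero_def)
    then have "frechet_derivative F (at (snd c p)) (X c) + christoffel p (X c) (F (snd c p)) = 0"
      using coord_field_derivative[OF p cp V(1,2,4) F, of "X c"] unfolding XX by simp
    then have "frechet_derivative F (at (snd c p)) (X c) = - christoffel p (X c) (v c)"
      by (simp add: FY[OF pc] \<zeta>(5) eq_neg_iff_add_eq_0)
    then show "\<zeta> = \<xi>" by (simp add: \<zeta>' \<xi>_def X')
  qed
  then show ?thesis
    unfolding horizontal_lift_def \<xi>_def p_def v_def .
qed

lemma ip_differentiable: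
  assumes "c \<in> N"
  shows "Ck_on k (snd c ` fst c) (\<lambda>x. ip c x u w)"
  using riemannian assms unfolding riemannian_manifold_def riemannian_metric_def smooth_on_def ip_def by blast

text \<open>
Metric compatibility for the field with constant components \<open>u\<close>.
\<close>

lemma ip_derivative:
  assumes p: "p \<in> points N" and cp: "c = some_chart N p"
  shows "frechet_derivative (\<lambda>x. ip c x u u) (at (snd c p)) h = 2 * ip c (snd c p) (christoffel p h u) u"
proof -
  note c = some_chart_around[OF p cp] and cN = some_chart_in_atlas[OF p cp] and pc = some_chart_contains[OF p cp]
  define X where "X = coord_vec N c h p"
  define Y where "Y = coord_vec N c u"
  have X: "X \<in> tangent_space N p" "X c = h" 
    by (simp_all add: X_def coord_vec_tangent[OF c] coord_vec_same[OF c])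
  have Y: "smooth_field N (fst c) Y"
    using smooth_coord_field[OF cN openin_domain[OF cN] subset_refl Ck_on_const, of u] by (simp add: Y_def)
  have DXY: "D p X Y = coord_vec N c (christoffel p h u) p"
    using coord_vec_component[OF c D_tangent[OF Y pc X(1)]]
    by (simp add: christoffel_def cp[symmetric] Let_def X_def Y_def)
  have "dir_deriv N p X (\<lambda>q. g q (Y q) (Y q)) = g p (D p X Y) (Y p) + g p (Y p) (D p X Y)"
    using levi_civita Y pc X(1) unfolding levi_civita_def metric_compatible_def by blast
  also have "\<dots> = 2 * ip c (snd c p) (christoffel p h u) u"
    unfolding DXY unfolding Y_def ip_chart[OF c] using ip_sym[OF cN, of "snd c p" u "christoffel p h u"] pc by simp
  finally have dd: "dir_deriv N p X (\<lambda>q. g q (Y q) (Y q)) = 2 * ip c (snd c p) (christoffel p h u) u" .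
  have "((\<lambda>x. ip c x u u) has_derivative frechet_derivative (\<lambda>x. ip c x u u) (at (snd c p))) (at (snd c p))"
    by (rule Ck_on_has_derivative[OF ip_differentiable[OF cN]]) (use pc in blast)
  moreover have "(\<lambda>x. ip c x u u) = (\<lambda>q. g q (Y q) (Y q)) \<circ> chart_inv c"
    by (rule ext) (simp add: ip_def Y_def)
  ultimately show ?thesis
    using dd by (simp add: dir_deriv_def Let_def cp[symmetric] X(2))
qed

end

section \<open>The Sasaki metric\<close>

locale sasaki = riemannian_connection N g D
  for N :: "('a, 'e::euclidean_space) chart set" and g D +
  fixes G :: "('a \<times> ('a, 'e) tangent, 'e \<times> 'e) metric_tensor"
  assumes G_metric: "riemannian_metric (tangent_bundle N) G"
    and G_lifts: "z \<in> points (tangent_bundle N) \<Longrightarrow> X \<in> tangent_space N (fst z) \<Longrightarrow> Y \<in> tangent_space N (fst z) \<Longrightarrow>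
      G z (horizontal_lift N D z X) (horizontal_lift N D z Y) = g (fst z) X Y \<and>
      G z (vertical_lift N z X) (vertical_lift N z Y) = g (fst z) X Y \<and>
      G z (horizontal_lift N D z X) (vertical_lift N z Y) = 0"

sublocale sasaki \<subseteq> TM: metric_manifold "tangent_bundle N" G
  by (rule T.riemannian_metric_manifold[OF G_metric Hausdorff_TN])

context sasaki
begin

text \<open>
The vector with components \<open>(h, k)\<close> is the sum of the horizontal lift of \<open>h\<close>, which has the components
\<open>(h, - \<Gamma>(h, v))\<close>, and of the vertical lift of \<open>k + \<Gamma>(h, v)\<close>.
\<close>

lemma sasaki_decomposition:
  assumes z: "z \<in> points TN" and c_def: "c = some_chart N (fst z)"
  shows "TM.ip (bc c) (snd (bc c) z) (h, k) (h, k) =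
    ip c (snd c (fst z)) h h +
    ip c (snd c (fst z)) (k + christoffel (fst z) h (snd z c)) (k + christoffel (fst z) h (snd z c))"
proof -
  have p: "fst z \<in> points N" using z by (simp add: points_TN)
  note c = some_chart_around[OF p c_def]
  have at: "bc c \<in> charts_at TN z" using z c by (auto simp: charts_at_TN points_TN)
  then have C: "bc c \<in> TN" "snd (bc c) z \<in> snd (bc c) ` fst (bc c)" by (auto simp: T.charts_at_iff)
  define w where "w = k + christoffel (fst z) h (snd z c)"
  define X where "X = coord_vec N c h (fst z)"
  define Y where "Y = coord_vec N c w (fst z)"
  have XY: "X \<in> tangent_space N (fst z)" "X c = h" "Y \<in> tangent_space N (fst z)" "Y c = w"
    by (simp_all add: X_def Y_def coord_vec_tangent[OF c] coord_vec_same[OF c])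
  have H: "horizontal_lift N D z X = coord_vec TN (bc c) (h, - christoffel (fst z) h (snd z c)) z"
    using horizontal_lift_eq[OF z XY(1) c_def] by (simp add: XY)
  have V: "vertical_lift N z Y = coord_vec TN (bc c) (0, w) z"
    using vertical_lift_eq[OF z c XY(3)] by (simp add: XY)
  have "TM.ip (bc c) (snd (bc c) z) (h, - christoffel (fst z) h (snd z c)) (h, - christoffel (fst z) h (snd z c)) = ip c (snd c (fst z)) h h"
    using G_lifts[OF z XY(1,1)] unfolding H TM.ip_chart[OF at] unfolding X_def ip_chart[OF c] by blast
  moreover have "TM.ip (bc c) (snd (bc c) z) (0, w) (0, w) = ip c (snd c (fst z)) w w"
    using G_lifts[OF z XY(3,3)] unfolding V TM.ip_chart[OF at] unfolding Y_def ip_chart[OF c] by blast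
  moreover have "TM.ip (bc c) (snd (bc c) z) (h, - christoffel (fst z) h (snd z c)) (0, w) = 0"
    using G_lifts[OF z XY(1,3)] unfolding H V TM.ip_chart[OF at] by blast
  moreover have "(h, k) = (h, - christoffel (fst z) h (snd z c)) + (0, w)"
    by (simp add: w_def)
  ultimately show ?thesis
    unfolding w_def[symmetric] using TM.ip_add_self[OF C, of "(h, - christoffel (fst z) h (snd z c))" "(0, w)"] by simp
qed

text \<open>
The speed of a curve of tangent vectors in terms of the velocity \<open>h\<close> of its base point and the
derivative \<open>k\<close> of its components; \<open>k + \<Gamma>(h, v)\<close> is its covariant derivative.
\<close>

definition sasaki_velocity ::
    "(real \<Rightarrow> 'a \<times> ('a, 'e) tangent) \<Rightarrow> real \<Rightarrow> ('a, 'e) chart \<Rightarrow> 'e \<Rightarrow> 'e \<Rightarrow> bool" where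
  "sasaki_velocity \<Gamma> t c h k \<longleftrightarrow>
     (snd c \<circ> (fst \<circ> \<Gamma>) has_vector_derivative h) (at t) \<and>
     ((\<lambda>s. snd (\<Gamma> s) c) has_vector_derivative k) (at t) \<and>
     TM.speed \<Gamma> t = sqrt (ip c (snd c (fst (\<Gamma> t))) h h +
       ip c (snd c (fst (\<Gamma> t))) (k + christoffel (fst (\<Gamma> t)) h (snd (\<Gamma> t) c)) (k + christoffel (fst (\<Gamma> t)) h (snd (\<Gamma> t) c)))"

lemma bundle_curve_derivative:
  assumes \<Gamma>: "piecewise_C1_curve TN \<Gamma>"
  shows "\<exists>S. finite S \<and> (\<forall>t\<in>{0<..<1} - S. \<exists>h k. sasaki_velocity \<Gamma> t (some_chart N (fst (\<Gamma> t))) h k)"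
proof -
  obtain S where S: "finite S" "\<And>t C. t \<in> {0<..<1} - S \<Longrightarrow> C \<in> charts_at TN (\<Gamma> t) \<Longrightarrow>
      \<exists>u. (snd C \<circ> \<Gamma> has_vector_derivative u) (at t) \<and>
          TM.speed \<Gamma> t = sqrt (TM.ip C (snd C (\<Gamma> t)) u u)"
    using TM.piecewise_C1_velocity[OF \<Gamma>] by blast
  have "\<exists>h k. sasaki_velocity \<Gamma> t (some_chart N (fst (\<Gamma> t))) h k" if t: "t \<in> {0<..<1} - S" for t
  proof -
    define c where c_def: "c = some_chart N (fst (\<Gamma> t))"
    have z: "\<Gamma> t \<in> points TN" using TM.piecewise_C1_in_points[OF \<Gamma>, of t] t by simp
    then have "c \<in> charts_at N (fst (\<Gamma> t))" unfolding c_def by (intro some_chart) (simp add: points_TN)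
    then have at: "bc c \<in> charts_at TN (\<Gamma> t)" using z by (auto simp: charts_at_TN points_TN)
    obtain u where u: "(snd (bc c) \<circ> \<Gamma> has_vector_derivative u) (at t)"
      "TM.speed \<Gamma> t = sqrt (TM.ip (bc c) (snd (bc c) (\<Gamma> t)) u u)"
      using S(2)[OF t at] by blast
    have eq: "snd c \<circ> (fst \<circ> \<Gamma>) = (\<lambda>s. fst ((snd (bc c) \<circ> \<Gamma>) s))" "(\<lambda>s. snd (\<Gamma> s) c) = (\<lambda>s. snd ((snd (bc c) \<circ> \<Gamma>) s))"
      by (auto simp: snd_bc)
    have "sasaki_velocity \<Gamma> t c (fst u) (snd u)"
      unfolding sasaki_velocity_def
    proof (intro conjI)
      show "(snd c \<circ> (fst \<circ> \<Gamma>) has_vector_derivative fst u) (at t)"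
        unfolding eq by (rule bounded_linear.has_vector_derivative[OF bounded_linear_fst u(1)])
      show "((\<lambda>s. snd (\<Gamma> s) c) has_vector_derivative snd u) (at t)"
        unfolding eq by (rule bounded_linear.has_vector_derivative[OF bounded_linear_snd u(1)])
      show "TM.speed \<Gamma> t = sqrt (ip c (snd c (fst (\<Gamma> t))) (fst u) (fst u) +
          ip c (snd c (fst (\<Gamma> t))) (snd u + christoffel (fst (\<Gamma> t)) (fst u) (snd (\<Gamma> t) c)) (snd u + christoffel (fst (\<Gamma> t)) (fst u) (snd (\<Gamma> t) c)))"
        unfolding u(2) sasaki_decomposition[OF z c_def, symmetric] by simp
    qed
    then show ?thesis unfolding c_def by blast
  qed
  then show ?thesis using S(1) by blast
qed

lemma some_chart_at:
  assumes "z \<in> points TN" "c = some_chart N (fst z)"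
  shows "c \<in> charts_at N (fst z)" "c \<in> N" "snd c (fst z) \<in> snd c ` fst c"
  using some_chart_around[OF _ assms(2)] assms(1) by (auto simp: points_TN charts_at_iff)

lemma projection_length_le:
  assumes \<Gamma>: "piecewise_C1_curve TN \<Gamma>"
  shows "curve_length N g (fst \<circ> \<Gamma>) \<le> curve_length TN G \<Gamma>"
proof -
  obtain S where S: "finite S"
    "\<forall>t\<in>{0<..<1} - S. \<exists>h k. sasaki_velocity \<Gamma> t (some_chart N (fst (\<Gamma> t))) h k"
    using bundle_curve_derivative[OF \<Gamma>] by blast
  note \<gamma> = projection_piecewise_C1[OF \<Gamma>]
  have int: "speed (fst \<circ> \<Gamma>) integrable_on {0..1}" "TM.speed \<Gamma> integrable_on {0..1}"
    using piecewise_C1_speed_integrable[OF \<gamma>] TM.piecewise_C1_speed_integrable[OF \<Gamma>] by auto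
  have "norm ((0::real) - 0) \<le> integral {0..1} (\<lambda>t. TM.speed \<Gamma> t - speed (fst \<circ> \<Gamma>) t)"
  proof (rule increment_le_integral[OF S(1), of 0 1 "\<lambda>_. 0"])
    show "(\<lambda>t. TM.speed \<Gamma> t - speed (fst \<circ> \<Gamma>) t) integrable_on {0..1}"
      by (rule integrable_diff[OF int(2,1)])
    fix t assume t: "t \<in> {0<..<1} - S"
    define c where "c = some_chart N (fst (\<Gamma> t))"
    obtain h k where hk: "(snd c \<circ> (fst \<circ> \<Gamma>) has_vector_derivative h) (at t)"
        "TM.speed \<Gamma> t = sqrt (ip c (snd c (fst (\<Gamma> t))) h h +
          ip c (snd c (fst (\<Gamma> t))) (k + christoffel (fst (\<Gamma> t)) h (snd (\<Gamma> t) c)) (k + christoffel (fst (\<Gamma> t)) h (snd (\<Gamma> t) c)))"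
      using S(2) t unfolding c_def sasaki_velocity_def by blast
    have z: "\<Gamma> t \<in> points TN" using TM.piecewise_C1_in_points[OF \<Gamma>, of t] t by simp
    note c = some_chart_at[OF z c_def]
    have "speed (fst \<circ> \<Gamma>) t = sqrt (ip c (snd c (fst (\<Gamma> t))) h h)"
      using speed_eq[OF piecewise_C1_continuous[OF \<gamma>] _ _ _ hk(1)] c(1) t by simp
    then have "speed (fst \<circ> \<Gamma>) t \<le> TM.speed \<Gamma> t"
      unfolding hk(2) using ip_nonneg[OF c(2,3)] by simp
    then show "\<exists>f'. ((\<lambda>_. 0::real) has_vector_derivative f') (at t) \<and> norm f' \<le> TM.speed \<Gamma> t - speed (fst \<circ> \<Gamma>) t"
      by (intro exI[of _ 0]) auto
  qed auto
  then show ?thesis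
    by (simp add: curve_length_eq TM.curve_length_eq integral_diff[OF int(2,1)])
qed

lemma zero_section_length:
  assumes \<gamma>: "piecewise_C1_curve N \<gamma>"
  shows "curve_length TN G (\<lambda>t. (\<gamma> t, tzero)) = curve_length N g \<gamma>"
proof -
  define \<Gamma> where "\<Gamma> = (\<lambda>t. (\<gamma> t, tzero :: ('a, 'e) tangent))"
  have \<Gamma>: "piecewise_C1_curve TN \<Gamma>" unfolding \<Gamma>_def by (rule zero_section_piecewise_C1[OF \<gamma>])
  have proj: "fst \<circ> \<Gamma> = \<gamma>" by (auto simp: \<Gamma>_def)
  obtain S where S: "finite S"
    "\<forall>t\<in>{0<..<1} - S. \<exists>h k. sasaki_velocity \<Gamma> t (some_chart N (fst (\<Gamma> t))) h k"
    using bundle_curve_derivative[OF \<Gamma>] by blast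
  have "integral {0..1} (TM.speed \<Gamma>) = integral {0..1} (speed \<gamma>)"
  proof (rule integral_spike[of "S \<union> {0, 1}"])
    show "negligible (S \<union> {0, 1})" using S(1) by (intro negligible_finite) simp
    fix t assume "t \<in> {0..1} - (S \<union> {0, 1})"
    then have t: "t \<in> {0<..<1} - S" by auto
    define c where "c = some_chart N (fst (\<Gamma> t))"
    obtain h k where hk: "(snd c \<circ> (fst \<circ> \<Gamma>) has_vector_derivative h) (at t)"
        "((\<lambda>s. snd (\<Gamma> s) c) has_vector_derivative k) (at t)"
        "TM.speed \<Gamma> t = sqrt (ip c (snd c (fst (\<Gamma> t))) h h +
          ip c (snd c (fst (\<Gamma> t))) (k + christoffel (fst (\<Gamma> t)) h (snd (\<Gamma> t) c)) (k + christoffel (fst (\<Gamma> t)) h (snd (\<Gamma> t) c)))"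
      using S(2) t unfolding c_def sasaki_velocity_def by blast
    have z: "\<Gamma> t \<in> points TN" using TM.piecewise_C1_in_points[OF \<Gamma>, of t] t by simp
    note c = some_chart_at[OF z c_def]
    have base: "fst (\<Gamma> t) = \<gamma> t" by (simp add: \<Gamma>_def)
    have "k = 0"
      using vector_derivative_at[OF hk(2)] by (simp add: \<Gamma>_def)
    moreover have "christoffel (fst (\<Gamma> t)) h (snd (\<Gamma> t) c) = 0"
      using christoffel_zero_right[OF _ c_def] z by (simp add: points_TN \<Gamma>_def tzero_def)
    ultimately have "TM.speed \<Gamma> t = sqrt (ip c (snd c (fst (\<Gamma> t))) h h)"
      using hk(3) ip_zero[OF c(2,3)] by simp
    moreover have "speed (fst \<circ> \<Gamma>) t = sqrt (ip c (snd c (fst (\<Gamma> t))) h h)"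
      using speed_eq[OF piecewise_C1_continuous _ _ _ hk(1)] c(1) t \<gamma>
      by (simp add: proj base)
    ultimately show "speed \<gamma> t = TM.speed \<Gamma> t" by (simp add: proj)
  qed
  then show ?thesis
    by (simp add: curve_length_eq TM.curve_length_eq \<Gamma>_def)
qed

text \<open>
The norm itself is not differentiable at the zero vectors; this function is smooth and controls it.
\<close>

definition fibre_height :: "'a \<times> ('a, 'e) tangent \<Rightarrow> real" where
  "fibre_height z = sqrt (1 + g (fst z) (snd z) (snd z))"

lemma fibre_height_chart:
  assumes "z \<in> fst (bc c)" "c \<in> N"
  shows "fibre_height z = sqrt (1 + ip c (snd c (fst z)) (snd z c) (snd z c))"
proof -
  have c: "c \<in> charts_at N (fst z)" "snd z \<in> tangent_space N (fst z)"
    using assms by (auto simp: fst_bc charts_at_iff)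
  show ?thesis
    using ip_chart[OF c(1), of "snd z c" "snd z c"] coord_vec_component[OF c] by (simp add: fibre_height_def)
qed

lemma fibre_height_continuous:
  assumes \<Gamma>: "continuous_map (top_of_set I) (manifold_topology TN) \<Gamma>"
  shows "continuous_on I (\<lambda>t::real. fibre_height (\<Gamma> t))"
proof (rule T.continuous_on_chartwise[OF \<Gamma>])
  fix C assume "C \<in> TN"
  then obtain c where c: "c \<in> N" "C = bc c" by (auto simp: TN_iff)
  define J where "J = {t \<in> I. \<Gamma> t \<in> fst C}"
  have cont: "continuous_on J (snd C \<circ> \<Gamma>)"
    unfolding J_def by (rule T.continuous_on_chart_curve[OF \<Gamma> \<open>C \<in> TN\<close>])
  have "continuous_on J (\<lambda>t. sqrt (1 + ip c (fst ((snd C \<circ> \<Gamma>) t)) (snd ((snd C \<circ> \<Gamma>) t)) (snd ((snd C \<circ> \<Gamma>) t))))"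
    by (intro continuous_on_real_sqrt continuous_on_add continuous_on_const continuous_on_ip[OF c(1)]
        continuous_on_fst[OF cont] continuous_on_snd[OF cont])
      (auto simp: J_def c fst_bc snd_bc)
  moreover have "fibre_height (\<Gamma> t) = sqrt (1 + ip c (fst ((snd C \<circ> \<Gamma>) t)) (snd ((snd C \<circ> \<Gamma>) t)) (snd ((snd C \<circ> \<Gamma>) t)))"
    if "t \<in> J" for t
    using fibre_height_chart[of "\<Gamma> t" c] that c by (simp add: J_def snd_bc)
  ultimately have "continuous_on J (\<lambda>t. fibre_height (\<Gamma> t))"
    by (subst continuous_on_cong[OF refl])
  then show "continuous_on {t \<in> I. \<Gamma> t \<in> fst C} (\<lambda>t. fibre_height (\<Gamma> t))" by (simp add: J_def)
qed

text \<open>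
The product rule for the norm of a field along a curve: by metric compatibility, the derivative of the
coefficients of the metric combines with the derivative \<open>k\<close> of the components into the covariant
derivative.
\<close>

lemma ip_along_curve_derivative:
  assumes p: "p \<in> points N" and cp: "c = some_chart N p"
    and x: "(x has_vector_derivative h) (at t)" "x t = snd c p"
    and u: "(u has_vector_derivative k) (at t)"
    and ev: "\<forall>\<^sub>F s in at t. x s \<in> snd c ` fst c"
  shows "((\<lambda>s. ip c (x s) (u s) (u s)) has_real_derivative
    2 * ip c (snd c p) (k + christoffel p h (u t)) (u t)) (at t)"
proof -
  note cN = some_chart_in_atlas[OF p cp] and pc = some_chart_contains[OF p cp]
  have x0: "snd c p \<in> snd c ` fst c" using pc by blast
  define B where "B = (Basis :: 'e set)"
  define dg where "dg i j = frechet_derivative (\<lambda>y. ip c y i j) (at (snd c p)) h" for i j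
  have gd: "((\<lambda>y. ip c y i j) has_derivative frechet_derivative (\<lambda>y. ip c y i j) (at (snd c p))) (at (snd c p))" for i j
    by (rule Ck_on_has_derivative[OF ip_differentiable[OF cN] x0])
  have g': "((\<lambda>s. ip c (x s) i j) has_real_derivative dg i j) (at t)" for i j
  proof -
    have "((\<lambda>s. ip c (x s) i j) has_derivative (\<lambda>r. frechet_derivative (\<lambda>y. ip c y i j) (at (snd c p)) (r *\<^sub>R h))) (at t)"
      by (rule has_derivative_compose[OF x(1)[unfolded has_vector_derivative_def]]) (simp only: x(2) gd)
    moreover have "frechet_derivative (\<lambda>y. ip c y i j) (at (snd c p)) (r *\<^sub>R h) = r * dg i j" for r
      using linear_scale[OF has_derivative_linear[OF gd]] by (simp add: dg_def)
    ultimately show ?thesis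
      by (simp add: has_field_derivative_def mult_commute_abs)
  qed
  have u': "((\<lambda>s. u s \<bullet> i) has_real_derivative (k \<bullet> i)) (at t)" for i
    using bounded_linear.has_vector_derivative[OF bounded_linear_inner_left u, of i]
    by (simp add: has_real_derivative_iff_has_vector_derivative)
  have "((\<lambda>s. \<Sum>i\<in>B. \<Sum>j\<in>B. (u s \<bullet> i) * ((u s \<bullet> j) * ip c (x s) i j)) has_real_derivative
      (\<Sum>i\<in>B. \<Sum>j\<in>B. (k \<bullet> i) * ((u t \<bullet> j) * ip c (x t) i j) +
        ((k \<bullet> j) * ip c (x t) i j + dg i j * (u t \<bullet> j)) * (u t \<bullet> i))) (at t)"
    by (intro DERIV_sum DERIV_mult u' g')
  moreover have "(\<Sum>i\<in>B. \<Sum>j\<in>B. (k \<bullet> i) * ((u t \<bullet> j) * ip c (x t) i j) +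
        ((k \<bullet> j) * ip c (x t) i j + dg i j * (u t \<bullet> j)) * (u t \<bullet> i)) =
      2 * ip c (snd c p) (k + christoffel p h (u t)) (u t)" (is "?S = _")
  proof -
    have "?S = (\<Sum>i\<in>B. \<Sum>j\<in>B. (k \<bullet> i) * ((u t \<bullet> j) * ip c (snd c p) i j)) +
        (\<Sum>i\<in>B. \<Sum>j\<in>B. (u t \<bullet> i) * ((k \<bullet> j) * ip c (snd c p) i j)) +
        (\<Sum>i\<in>B. \<Sum>j\<in>B. (u t \<bullet> i) * ((u t \<bullet> j) * dg i j))"
      unfolding sum.distrib[symmetric] x(2) by (intro sum.cong refl) (simp add: algebra_simps)
    also have "(\<Sum>i\<in>B. \<Sum>j\<in>B. (k \<bullet> i) * ((u t \<bullet> j) * ip c (snd c p) i j)) = ip c (snd c p) k (u t)"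
      unfolding B_def by (rule ip_expand[OF cN x0, symmetric])
    also have "(\<Sum>i\<in>B. \<Sum>j\<in>B. (u t \<bullet> i) * ((k \<bullet> j) * ip c (snd c p) i j)) = ip c (snd c p) k (u t)"
      unfolding B_def ip_sym[OF cN x0, of k] by (rule ip_expand[OF cN x0, symmetric])
    also have "(\<Sum>i\<in>B. \<Sum>j\<in>B. (u t \<bullet> i) * ((u t \<bullet> j) * dg i j)) = 2 * ip c (snd c p) (christoffel p h (u t)) (u t)"
    proof -
      have "((\<lambda>y. \<Sum>i\<in>B. \<Sum>j\<in>B. (u t \<bullet> i) * ((u t \<bullet> j) * ip c y i j)) has_derivative
          (\<lambda>v. \<Sum>i\<in>B. \<Sum>j\<in>B. (u t \<bullet> i) * ((u t \<bullet> j) * frechet_derivative (\<lambda>y. ip c y i j) (at (snd c p)) v))) (at (snd c p))"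
        by (intro has_derivative_sum has_derivative_mult_right gd)
      then have "((\<lambda>y. ip c y (u t) (u t)) has_derivative
          (\<lambda>v. \<Sum>i\<in>B. \<Sum>j\<in>B. (u t \<bullet> i) * ((u t \<bullet> j) * frechet_derivative (\<lambda>y. ip c y i j) (at (snd c p)) v))) (at (snd c p))"
        by (rule has_derivative_transform_within_open[OF _ open_chart_image[OF cN] x0])
          (simp only: B_def ip_expand[OF cN, symmetric])
      from fun_cong[OF frechet_derivative_at[OF this], of h] show ?thesis
        unfolding dg_def ip_derivative[OF p cp, of "u t" h, symmetric] .
    qed
    finally show ?thesis
      using linear_add[OF ip_linear_left[OF cN x0]] by simp
  qed
  ultimately have sum': "((\<lambda>s. \<Sum>i\<in>B. \<Sum>j\<in>B. (u s \<bullet> i) * ((u s \<bullet> j) * ip c (x s) i j)) has_real_derivative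
      2 * ip c (snd c p) (k + christoffel p h (u t)) (u t)) (at t)"
    by simp
  have cong: "\<forall>\<^sub>F s in nhds t. (\<Sum>i\<in>B. \<Sum>j\<in>B. (u s \<bullet> i) * ((u s \<bullet> j) * ip c (x s) i j)) = ip c (x s) (u s) (u s)"
  proof -
    have "\<forall>\<^sub>F s in nhds t. x s \<in> snd c ` fst c"
      unfolding eventually_nhds_conv_at using ev x0 x(2) by simp
    then show ?thesis
      by eventually_elim (simp only: B_def ip_expand[OF cN, symmetric])
  qed
  show ?thesis
    using sum' DERIV_cong_ev[OF refl cong refl] by simp
qed

text \<open>
With the covariant derivative \<open>w\<close> of the field \<open>u\<close> along the curve, the derivative of
\<open>sqrt (1 + \<bar>u\<bar>\<^sup>2)\<close> is \<open>\<langle>w, u\<rangle> / sqrt (1 + \<bar>u\<bar>\<^sup>2)\<close>, which is bounded by \<open>\<bar>w\<bar>\<close> and so by the speed.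
\<close>

lemma fibre_height_Lipschitz:
  assumes \<Gamma>: "piecewise_C1_curve TN \<Gamma>"
  shows "\<bar>fibre_height (\<Gamma> 1) - fibre_height (\<Gamma> 0)\<bar> \<le> curve_length TN G \<Gamma>"
proof -
  obtain S where S: "finite S"
    "\<forall>t\<in>{0<..<1} - S. \<exists>h k. sasaki_velocity \<Gamma> t (some_chart N (fst (\<Gamma> t))) h k"
    using bundle_curve_derivative[OF \<Gamma>] by blast
  note cont = TM.piecewise_C1_continuous[OF \<Gamma>]
  have "norm (fibre_height (\<Gamma> 1) - fibre_height (\<Gamma> 0)) \<le> integral {0..1} (TM.speed \<Gamma>)"
  proof (rule increment_le_integral[OF S(1), of 0 1 "\<lambda>t. fibre_height (\<Gamma> t)"])
    show "TM.speed \<Gamma> integrable_on {0..1}" by (rule TM.piecewise_C1_speed_integrable[OF \<Gamma>]) auto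
    show "continuous_on {0..1} (\<lambda>t. fibre_height (\<Gamma> t))" by (rule fibre_height_continuous[OF cont])
    fix t assume t: "t \<in> {0<..<1} - S"
    define c where "c = some_chart N (fst (\<Gamma> t))"
    define p where "p = fst (\<Gamma> t)"
    define u where "u s = snd (\<Gamma> s) c" for s
    define x where "x = snd c \<circ> (fst \<circ> \<Gamma>)"
    obtain h k where hk: "(x has_vector_derivative h) (at t)" "(u has_vector_derivative k) (at t)"
        "TM.speed \<Gamma> t = sqrt (ip c (snd c p) h h + ip c (snd c p) (k + christoffel p h (u t)) (k + christoffel p h (u t)))"
      using S(2) t unfolding u_def x_def p_def c_def sasaki_velocity_def by blast
    have z: "\<Gamma> t \<in> points TN" using TM.piecewise_C1_in_points[OF \<Gamma>, of t] t by simp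
    note c = some_chart_at[OF z c_def]
    have p: "p \<in> points N" "c = some_chart N p" using z by (simp_all add: points_TN p_def c_def)
    have x0: "snd c p \<in> snd c ` fst c" using c(3) by (simp add: p_def)
    have "\<Gamma> t \<in> fst (bc c)" using z c(1) by (simp add: fst_bc points_TN charts_at_iff)
    then have "\<forall>\<^sub>F s in at t within {0..1}. \<Gamma> s \<in> fst (bc c)"
      using t by (intro T.eventually_curve_in[OF cont T.openin_domain[OF bc_in_TN[OF c(2)]]]) auto
    then have ev: "\<forall>\<^sub>F s in at t. \<Gamma> s \<in> fst (bc c)"
      using t by (simp add: at_within_Icc_at)
    define w where "w = k + christoffel p h (u t)"
    have "((\<lambda>s. ip c (x s) (u s) (u s)) has_real_derivative 2 * ip c (snd c p) w (u t)) (at t)"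
      unfolding w_def
    proof (rule ip_along_curve_derivative[OF p hk(1) _ hk(2)])
      show "x t = snd c p" by (simp add: x_def p_def)
      show "\<forall>\<^sub>F s in at t. x s \<in> snd c ` fst c"
        using ev by eventually_elim (simp add: x_def fst_bc)
    qed
    moreover have nn: "0 \<le> ip c (snd c p) (u t) (u t)" by (rule ip_nonneg[OF c(2) x0])
    moreover have xt: "x t = snd c p" by (simp add: x_def p_def)
    ultimately have sqrt': "((\<lambda>s. sqrt (1 + ip c (x s) (u s) (u s))) has_real_derivative
        ip c (snd c p) w (u t) / sqrt (1 + ip c (snd c p) (u t) (u t))) (at t)"
      by (auto intro!: derivative_eq_intros simp: field_simps)
    have cong: "\<forall>\<^sub>F s in nhds t. sqrt (1 + ip c (x s) (u s) (u s)) = fibre_height (\<Gamma> s)"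
    proof -
      have "\<forall>\<^sub>F s in nhds t. \<Gamma> s \<in> fst (bc c)"
        unfolding eventually_nhds_conv_at using ev \<open>\<Gamma> t \<in> fst (bc c)\<close> by simp
      then show ?thesis
        by eventually_elim (simp add: fibre_height_chart[OF _ c(2)] x_def u_def)
    qed
    have "((\<lambda>s. fibre_height (\<Gamma> s)) has_real_derivative
        ip c (snd c p) w (u t) / sqrt (1 + ip c (snd c p) (u t) (u t))) (at t)"
      using sqrt' DERIV_cong_ev[OF refl cong refl] by simp
    moreover have "\<bar>ip c (snd c p) w (u t) / sqrt (1 + ip c (snd c p) (u t) (u t))\<bar> \<le> TM.speed \<Gamma> t"
    proof -
      have "\<bar>ip c (snd c p) w (u t)\<bar> \<le> sqrt (ip c (snd c p) w w) * sqrt (ip c (snd c p) (u t) (u t))"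
        by (rule ip_cauchy_schwarz[OF c(2) x0])
      also have "\<dots> \<le> TM.speed \<Gamma> t * sqrt (1 + ip c (snd c p) (u t) (u t))"
        unfolding hk(3) w_def[symmetric] using ip_nonneg[OF c(2) x0] by (intro mult_mono) auto
      finally show ?thesis
        using nn by (simp add: abs_divide pos_divide_le_eq)
    qed
    ultimately show "\<exists>f'. ((\<lambda>t. fibre_height (\<Gamma> t)) has_vector_derivative f') (at t) \<and> norm f' \<le> TM.speed \<Gamma> t"
      by (auto simp: has_real_derivative_iff_has_vector_derivative)
  qed auto
  then show ?thesis by (simp add: TM.curve_length_eq)
qed

end

section \<open>Distances in the tangent bundle and completeness\<close>

locale connected_sasaki = sasaki N g D G for N :: "('a, 'e::euclidean_space) chart set" and g D G +
  assumes connected: "connected_space (manifold_topology N)"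

sublocale connected_sasaki \<subseteq> joined_metric_manifold N g
  by unfold_locales (rule connected_imp_joined[OF connected])

context connected_sasaki
begin

text \<open>
The curve scales the vector to zero; in a bundle chart it is a straight line.
\<close>

lemma joined_to_zero_section:
  assumes z: "z \<in> points TN"
  shows "curves_between TN z (fst z, tzero) \<noteq> {}"
proof -
  have p: "fst z \<in> points N" using z by (simp add: points_TN)
  obtain c where c: "c \<in> N" "fst z \<in> fst c" using p by (auto simp: points_def)
  have sub: "closed_segment (snd (bc c) z) (snd (bc c) (fst z, tzero)) \<subseteq> snd (bc c) ` fst (bc c)"
  proof
    fix y assume "y \<in> closed_segment (snd (bc c) z) (snd (bc c) (fst z, tzero))"
    then have "fst y = snd c (fst z)"
      by (auto simp: in_segment snd_bc scaleR_left_distrib[symmetric])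
    then have "y \<in> snd c ` fst c \<times> UNIV" using c by (cases y) auto
    then show "y \<in> snd (bc c) ` fst (bc c)" using bc_image_overlap[OF c(1), of c] by simp
  qed
  have "z \<in> fst (bc c)" "(fst z, tzero) \<in> fst (bc c)"
    using z c by (auto simp: fst_bc points_TN tzero_tangent)
  from TM.joined_by_segment(1)[OF bc_in_TN[OF c(1)] this sub] show ?thesis by blast
qed

lemma joined_TN:
  assumes z: "z \<in> points TN" and w: "w \<in> points TN"
  shows "curves_between TN z w \<noteq> {}"
proof -
  obtain \<gamma> where "\<gamma> \<in> curves_between N (fst z) (fst w)"
    using joined[of "fst z" "fst w"] z w by (auto simp: points_TN)
  then have "(\<lambda>t. (\<gamma> t, tzero)) \<in> curves_between TN (fst z, tzero) (fst w, tzero)"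
    using zero_section_piecewise_C1 by (simp add: curves_between_def)
  then have "curves_between TN (fst z, tzero) (fst w, tzero) \<noteq> {}" by blast
  then show ?thesis
    using TM.joined_trans TM.joined_sym joined_to_zero_section[OF z] joined_to_zero_section[OF w] by meson
qed

end

sublocale connected_sasaki \<subseteq> TJ: joined_metric_manifold "tangent_bundle N" G
  by unfold_locales (rule joined_TN)

context connected_sasaki
begin

lemma projection_dist_le:
  assumes z: "z \<in> points TN" and w: "w \<in> points TN"
  shows "dist_g (fst z) (fst w) \<le> TJ.dist_g z w"
proof (rule dense_ge)
  fix e assume "TJ.dist_g z w < e"
  then obtain \<Gamma> where "\<Gamma> \<in> curves_between TN z w" "curve_length TN G \<Gamma> < e"
    using TJ.dist_lessE[OF z w] by blast
  then have \<Gamma>: "piecewise_C1_curve TN \<Gamma>" "\<Gamma> 0 = z" "\<Gamma> 1 = w" "curve_length TN G \<Gamma> < e"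
    by (auto simp: curves_between_def)
  then have "fst \<circ> \<Gamma> \<in> curves_between N (fst z) (fst w)"
    by (simp add: curves_between_def projection_piecewise_C1)
  then have "dist_g (fst z) (fst w) \<le> curve_length N g (fst \<circ> \<Gamma>)" by (rule dist_le_length)
  also have "\<dots> \<le> e" using projection_length_le[OF \<Gamma>(1)] \<Gamma>(4) by simp
  finally show "dist_g (fst z) (fst w) \<le> e" .
qed

lemma zero_section_dist_le:
  assumes p: "p \<in> points N" and q: "q \<in> points N"
  shows "TJ.dist_g (p, tzero) (q, tzero) \<le> dist_g p q"
proof (rule dense_ge)
  fix e assume "dist_g p q < e"
  then obtain \<gamma> where "\<gamma> \<in> curves_between N p q" "curve_length N g \<gamma> < e"
    using dist_lessE[OF p q] by blast
  then have \<gamma>: "piecewise_C1_curve N \<gamma>" "\<gamma> 0 = p" "\<gamma> 1 = q" "curve_length N g \<gamma> < e"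
    by (auto simp: curves_between_def)
  then have "(\<lambda>t. (\<gamma> t, tzero)) \<in> curves_between TN (p, tzero) (q, tzero)"
    by (simp add: curves_between_def zero_section_piecewise_C1)
  then have "TJ.dist_g (p, tzero) (q, tzero) \<le> curve_length TN G (\<lambda>t. (\<gamma> t, tzero))"
    by (rule TJ.dist_le_length)
  also have "\<dots> \<le> e" using zero_section_length[OF \<gamma>(1)] \<gamma>(4) by simp
  finally show "TJ.dist_g (p, tzero) (q, tzero) \<le> e" .
qed

lemma fibre_height_dist_le:
  assumes z: "z \<in> points TN" and w: "w \<in> points TN"
  shows "\<bar>fibre_height w - fibre_height z\<bar> \<le> TJ.dist_g z w"
proof (rule dense_ge)
  fix e assume "TJ.dist_g z w < e"
  then obtain \<Gamma> where "\<Gamma> \<in> curves_between TN z w" "curve_length TN G \<Gamma> < e"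
    using TJ.dist_lessE[OF z w] by blast
  then show "\<bar>fibre_height w - fibre_height z\<bar> \<le> e"
    using fibre_height_Lipschitz[of \<Gamma>] by (auto simp: curves_between_def)
qed

lemma complete_base:
  assumes complete: "riemannian_complete TN G"
  shows "riemannian_complete N g"
proof -
  interpret B: Metric_space "points N" dist_g by (rule Metric_space_dist)
  interpret E: Metric_space "points TN" TJ.dist_g by (rule TJ.Metric_space_dist)
  show ?thesis
    unfolding riemannian_complete_def B.mcomplete_def
  proof (intro allI impI)
    fix \<sigma> assume \<sigma>: "B.MCauchy \<sigma>"
    then have \<sigma>p: "\<sigma> n \<in> points N" for n by (auto simp: B.MCauchy_def)
    have \<tau>p: "(\<sigma> n, tzero) \<in> points TN" for n using \<sigma>p by (simp add: points_TN tzero_tangent)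
    have "E.MCauchy (\<lambda>n. (\<sigma> n, tzero))"
      unfolding E.MCauchy_def
    proof (intro conjI allI impI)
      show "range (\<lambda>n. (\<sigma> n, tzero)) \<subseteq> points TN" using \<tau>p by blast
      fix \<epsilon> :: real assume "0 < \<epsilon>"
      then obtain K where "\<forall>n n'. K \<le> n \<longrightarrow> K \<le> n' \<longrightarrow> dist_g (\<sigma> n) (\<sigma> n') < \<epsilon>"
        using \<sigma> unfolding B.MCauchy_def by blast
      then show "\<exists>K. \<forall>n n'. K \<le> n \<longrightarrow> K \<le> n' \<longrightarrow> TJ.dist_g (\<sigma> n, tzero) (\<sigma> n', tzero) < \<epsilon>"
        using zero_section_dist_le[OF \<sigma>p \<sigma>p] by (meson le_less_trans)
    qed
    then obtain z where z: "limitin E.mtopology (\<lambda>n. (\<sigma> n, tzero)) z sequentially"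
      using complete unfolding riemannian_complete_def E.mcomplete_def by blast
    then have zp: "z \<in> points TN" by (simp add: E.limitin_metric)
    have "limitin B.mtopology \<sigma> (fst z) sequentially"
      unfolding B.limitin_metric
    proof (intro conjI allI impI)
      show "fst z \<in> points N" using zp by (simp add: points_TN)
      fix \<epsilon> :: real assume "0 < \<epsilon>"
      then have "\<forall>\<^sub>F n in sequentially. (\<sigma> n, tzero) \<in> points TN \<and> TJ.dist_g (\<sigma> n, tzero) z < \<epsilon>"
        using z unfolding E.limitin_metric by blast
      then show "\<forall>\<^sub>F n in sequentially. \<sigma> n \<in> points N \<and> dist_g (\<sigma> n) (fst z) < \<epsilon>"
      proof eventually_elim
        case (elim n)
        then show ?case
          using projection_dist_le[OF \<tau>p zp, of n] \<sigma>p by simp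
      qed
    qed
    then show "\<exists>x. limitin B.mtopology \<sigma> x sequentially" by blast
  qed
qed

text \<open>
Convergence of the coordinates implies convergence of the points, by the upper bound of the chart
comparison.
\<close>

lemma convergent_if_chart_bounded:
  fixes \<sigma> :: "nat \<Rightarrow> 'a \<times> ('a, 'e) tangent"
  assumes C: "C \<in> TN" and K: "compact K" "K \<subseteq> snd C ` fst C"
    and \<sigma>: "\<And>n. \<sigma> n \<in> fst C" "\<And>n. snd C (\<sigma> n) \<in> K"
  obtains z r where "z \<in> points TN" "strict_mono r" "(\<lambda>n. TJ.dist_g (\<sigma> (r n)) z) \<longlonglongrightarrow> 0"
proof -
  obtain y r where y: "y \<in> K" "strict_mono (r :: nat \<Rightarrow> nat)" "((\<lambda>n. snd C (\<sigma> n)) \<circ> r) \<longlonglongrightarrow> y"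
    using seq_compactE[OF compact_imp_seq_compact[OF K(1)], of "\<lambda>n. snd C (\<sigma> n)"] \<sigma>(2) by metis
  define z where "z = chart_inv C y"
  have z: "z \<in> fst C" "snd C z = y" using y(1) K(2) by (auto simp: z_def T.chart_inv_in T.chart_chart_inv)
  have at: "C \<in> charts_at TN z" using z C by (simp add: T.charts_at_iff)
  show ?thesis
  proof (rule TJ.dist_chart_comparison[OF at], goal_cases)
    case (1 \<rho> a b)
    have lim: "(\<lambda>n. norm (snd C (\<sigma> (r n)) - snd C z)) \<longlonglongrightarrow> 0"
      using y(3) unfolding z(2) o_def by (intro tendsto_norm_zero) (simp add: LIM_zero)
    have ev: "\<forall>\<^sub>F n in sequentially. norm (snd C (\<sigma> (r n)) - snd C z) < \<rho>"
      using order_tendstoD(2)[OF lim 1(1)] .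
    have "(\<lambda>n. TJ.dist_g (\<sigma> (r n)) z) \<longlonglongrightarrow> 0"
    proof (rule tendsto_sandwich[of "\<lambda>_. 0" _ _ "\<lambda>n. b * norm (snd C (\<sigma> (r n)) - snd C z)"])
      show "\<forall>\<^sub>F n in sequentially. TJ.dist_g (\<sigma> (r n)) z \<le> b * norm (snd C (\<sigma> (r n)) - snd C z)"
        using ev
      proof eventually_elim
        case (elim n)
        then show ?case
          using 1(8)[OF \<sigma>(1)[of "r n"]] TJ.dist_commute[of z "\<sigma> (r n)"]
          by (simp add: dist_norm norm_minus_commute)
      qed
      show "(\<lambda>n. b * norm (snd C (\<sigma> (r n)) - snd C z)) \<longlonglongrightarrow> 0"
        using tendsto_mult_right_zero[OF lim, of b] by simp
    qed (use TJ.dist_nonneg in auto)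
    then show ?thesis
      using that[of z r] y(2) TM.charts_at_points[OF at] by blast
  qed
qed

text \<open>
In a chart around the limit of the base points, the lower norm bound turns the bound for the fibre
heights into a bound for the components of the vectors.
\<close>

lemma complete_total:
  assumes complete: "riemannian_complete N g"
  shows "riemannian_complete TN G"
proof -
  interpret B: Metric_space "points N" dist_g by (rule Metric_space_dist)
  interpret E: Metric_space "points TN" TJ.dist_g by (rule TJ.Metric_space_dist)
  show ?thesis
    unfolding riemannian_complete_def E.mcomplete_def
  proof (intro allI impI)
    fix \<sigma> assume \<sigma>: "E.MCauchy \<sigma>"
    then have \<sigma>p: "\<sigma> n \<in> points TN" for n by (auto simp: E.MCauchy_def)
    then have \<sigma>N: "fst (\<sigma> n) \<in> points N" for n by (simp add: points_TN)
    have "B.MCauchy (fst \<circ> \<sigma>)"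
      unfolding B.MCauchy_def
    proof (intro conjI allI impI)
      show "range (fst \<circ> \<sigma>) \<subseteq> points N" using \<sigma>N by auto
      fix \<epsilon> :: real assume "0 < \<epsilon>"
      then obtain K where "\<forall>n n'. K \<le> n \<longrightarrow> K \<le> n' \<longrightarrow> TJ.dist_g (\<sigma> n) (\<sigma> n') < \<epsilon>"
        using \<sigma> unfolding E.MCauchy_def by blast
      then show "\<exists>K. \<forall>n n'. K \<le> n \<longrightarrow> K \<le> n' \<longrightarrow> dist_g ((fst \<circ> \<sigma>) n) ((fst \<circ> \<sigma>) n') < \<epsilon>"
        using projection_dist_le[OF \<sigma>p \<sigma>p] unfolding o_apply by (meson le_less_trans)
    qed
    then obtain p where p: "limitin B.mtopology (fst \<circ> \<sigma>) p sequentially"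
      using complete unfolding riemannian_complete_def B.mcomplete_def by blast
    then have pN: "p \<in> points N" by (simp add: B.limitin_metric)
    obtain c where c: "c \<in> charts_at N p" using some_chart[OF pN] by blast
    then have cN: "c \<in> N" by (simp add: charts_at_iff)
    obtain K where K: "\<forall>n n'. K \<le> n \<longrightarrow> K \<le> n' \<longrightarrow> TJ.dist_g (\<sigma> n) (\<sigma> n') < 1"
      using \<sigma> unfolding E.MCauchy_def by (meson zero_less_one)
    define H where "H = fibre_height (\<sigma> K) + 1"
    have height: "fibre_height (\<sigma> n) \<le> H" if "K \<le> n" for n
      using fibre_height_dist_le[OF \<sigma>p[of K] \<sigma>p[of n]] K[rule_format, of K n] that by (simp add: H_def)
    show "\<exists>z. limitin E.mtopology \<sigma> z sequentially"
    proof (rule dist_chart_comparison[OF c], goal_cases)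
      case (1 \<rho> a b)
      have "0 < a * \<rho>" using 1(1,2) by simp
      then have "\<forall>\<^sub>F n in sequentially. (fst \<circ> \<sigma>) n \<in> points N \<and> dist_g ((fst \<circ> \<sigma>) n) p < a * \<rho>"
        using p unfolding B.limitin_metric by blast
      then obtain L where L: "\<And>n. L \<le> n \<Longrightarrow> dist_g p (fst (\<sigma> n)) < a * \<rho>"
        using dist_commute unfolding eventually_sequentially by fastforce
      \<comment> \<open>from this index on, the base points are in the chart and the heights are bounded\<close>
      define m where "m = max K L"
      define C where "C = cball (snd c p) \<rho> \<times> cball (0 :: 'e) (H / a)"
      have inc: "fst (\<sigma> (n + m)) \<in> fst c" for n
        by (rule 1(6)[OF \<sigma>N L]) (simp add: m_def)
      have inb: "\<sigma> (n + m) \<in> fst (bc c)" for n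
        using inc \<sigma>p[of "n + m"] by (simp add: fst_bc points_TN)
      have inK: "snd (bc c) (\<sigma> (n + m)) \<in> C" for n
      proof -
        have near: "dist_g p (fst (\<sigma> (n + m))) < a * \<rho>" by (rule L) (simp add: m_def)
        have "a * norm (snd c (fst (\<sigma> (n + m))) - snd c p) < a * \<rho>"
          using 1(7)[OF \<sigma>N near] near by linarith
        then have x: "snd c (fst (\<sigma> (n + m))) \<in> cball (snd c p) \<rho>"
          using 1(2) by (simp add: dist_norm norm_minus_commute)
        have "a * norm (snd (\<sigma> (n + m)) c) \<le> sqrt (ip c (snd c (fst (\<sigma> (n + m)))) (snd (\<sigma> (n + m)) c) (snd (\<sigma> (n + m)) c))"
          by (rule 1(5)[OF x])
        also have "\<dots> \<le> fibre_height (\<sigma> (n + m))"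
          unfolding fibre_height_chart[OF inb cN] by simp
        also have "\<dots> \<le> H" by (rule height) (simp add: m_def)
        finally show ?thesis
          using x 1(2) by (simp add: C_def snd_bc pos_le_divide_eq mult.commute)
      qed
      have "compact C" unfolding C_def by (intro compact_Times compact_cball)
      moreover have "C \<subseteq> snd (bc c) ` fst (bc c)"
        using 1(4) bc_image_overlap[OF cN, of c] by (auto simp: C_def)
      ultimately obtain z r where z: "z \<in> points TN" "strict_mono r"
        "(\<lambda>n. TJ.dist_g (\<sigma> (r n + m)) z) \<longlonglongrightarrow> 0"
        by (rule convergent_if_chart_bounded[OF bc_in_TN[OF cN], of C "\<lambda>n. \<sigma> (n + m)"]) (use inb inK in auto)
      have "strict_mono (\<lambda>n. r n + m)" using z(2) by (simp add: strict_mono_def)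
      moreover have "limitin E.mtopology (\<sigma> \<circ> (\<lambda>n. r n + m)) z sequentially"
        unfolding E.limitin_metric
      proof (intro conjI allI impI)
        show "z \<in> points TN" by (rule z)
        fix \<epsilon> :: real assume "0 < \<epsilon>"
        then show "\<forall>\<^sub>F n in sequentially. (\<sigma> \<circ> (\<lambda>n. r n + m)) n \<in> points TN \<and> TJ.dist_g ((\<sigma> \<circ> (\<lambda>n. r n + m)) n) z < \<epsilon>"
          using order_tendstoD(2)[OF z(3)] \<sigma>p by simp
      qed
      ultimately show ?case
        using E.MCauchy_convergent_subsequence[OF \<sigma>] by blast
    qed
  qed
qed

end

theorem lemma3:
  fixes N :: "('a, 'e::euclidean_space) chart set"
    and g :: "('a, 'e) metric_tensor"
    and G :: "('a \<times> ('a, 'e) tangent, 'e \<times> 'e) metric_tensor"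
  assumes "riemannian_manifold N g"
    and "connected_space (manifold_topology N)"
    and "sasaki_metric N g G"
  shows "riemannian_complete (tangent_bundle N) G \<longleftrightarrow> riemannian_complete N g"
proof -
  obtain D where D: "levi_civita N g D"
    "\<And>z X Y. z \<in> points (tangent_bundle N) \<Longrightarrow> X \<in> tangent_space N (fst z) \<Longrightarrow> Y \<in> tangent_space N (fst z) \<Longrightarrow>
      G z (horizontal_lift N D z X) (horizontal_lift N D z Y) = g (fst z) X Y \<and>
      G z (vertical_lift N z X) (vertical_lift N z Y) = g (fst z) X Y \<and>
      G z (horizontal_lift N D z X) (vertical_lift N z Y) = 0"
    using assms(3) unfolding sasaki_metric_def by blast
  interpret connected_sasaki N g D G
    by unfold_locales (use assms D in \<open>auto simp: sasaki_metric_def\<close>)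
  show ?thesis
    using complete_base complete_total by blast
qed

end
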